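(* Let $n\ge1$ and $\varkappa\ge2$ be integers and let $T_m$ be the multilinear Hermite pseudo-multiplier on $\mathscr{D}(\mathbb{R}^n)^\varkappa$ with symbol $m$. (1) Suppose that $\Vert m\Vert_{l.u.,\mathcal{H}^s}<\infty$ or $\Vert m\Vert_{l.u.,H^s}<\infty$ for some $$s>\max\left\{\frac{3n\varkappa}{2}+(\varkappa-1)\gamma_\infty,\ \frac{3n\varkappa}{2}+\frac{(\varkappa-1)n}{4}\right\}.$$ Then $T_m$ extends to a bounded multilinear operator $$T_m:L^{p_1}(\mathbb{R}^n)\times L^{p_2}(\mathbb{R}^n)\times\cdots\times L^{p_\varkappa}(\mathbb{R}^n)\to L^p(\mathbb{R}^n)$$ provided that $1\le p_j\le\infty$, $1\le p\le2$ and $\frac1p=\frac1{p_1}+\cdots+\frac1{p_\varkappa}$. (2) Suppose that $\Vert m\Vert_{l.u.,\mathcal{H}^s}<\infty$ or $\Vert m\Vert_{l.u.,H^s}<\infty$ for some $$s>\max\left\{\frac{3n\varkappa}{2}+\frac{(\varkappa-1)n}{4},\ \frac{3n\varkappa}{2}+\frac{(n-1)(\varkappa-1)}{2}+\gamma_p\right\}.$$ Then the same boundedness $T_m:L^{p_1}\times\cdots\times L^{p_\varkappa}\to L^p(\mathbb{R}^n)$ holds for all $2\le p\le\infty$ with $\frac1p=\frac1{p_1}+\cdots+\frac1{p_\varkappa}$.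
   Context: Hermite functions: for $k\in\mathbb{N}_0$, $t\in\mathbb{R}$, $\phi_k(t)=(2^k k!\sqrt\pi)^{-1/2}H_k(t)e^{-t^2/2}$ with $H_k(t)=(-1)^k e^{t^2}\frac{d^k}{dt^k}e^{-t^2}$; for $\mu\in\mathbb{N}_0^d$, $\phi_\mu(x)=\prod_{j=1}^d\phi_{\mu_j}(x_j)$ on $\mathbb{R}^d$. For $f\in\mathscr{D}(\mathbb{R}^n)=C_0^\infty(\mathbb{R}^n)$, $\widehat f(\phi_\mu)=\int_{\mathbb{R}^n}f\phi_\mu\,dx$. Multilinear pseudo-multiplier: for a bounded symbol $m$ on $\mathbb{R}^n\times\mathbb{N}_0^{n\varkappa}$ and $f_1,\dots,f_\varkappa\in\mathscr{D}(\mathbb{R}^n)$, $$T_m(f_1,\dots,f_\varkappa)(x)=\sum_{\nu=(\nu_1,\dots,\nu_\varkappa)\in\mathbb{N}_0^{n\varkappa}}m(x,\nu)\widehat f_1(\phi_{\nu_1})\cdots\widehat f_\varkappa(\phi_{\nu_\varkappa})\phi_{\nu_1}(x)\cdots\phi_{\nu_\varkappa}(x),\quad \nu_i\in\mathbb{N}_0^n.$$ Notation: $\langle z\rangle=(1+|z|^2)^{1/2}$; $\psi\in\mathscr{D}(0,\infty)$ is a fixed function supported in $[\frac12,4]$ with $\psi\equiv1$ on $[1,2]$; $\mathscr{F}$ is the Fourier transform on $\mathbb{R}^{n\varkappa}$, $(\mathscr{F}f)(\xi)=\int e^{-2\pi i z\cdot\xi}f(z)\,dz$; $(\mathscr{F}_H^{-1}u)(z)=\sum_{\nu\in\mathbb{N}_0^{n\varkappa}}u(\nu)\phi_\nu(z)$,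 $z\in\mathbb{R}^{n\varkappa}$. $$\Vert m\Vert_{l.u.,\mathcal{H}^s}=\sup_{k>0,\,x\in\mathbb{R}^n}2^{k(s-\frac{n\varkappa}{2})}\Vert\langle z\rangle^s\mathscr{F}_H^{-1}[m(x,\cdot)\psi(2^{-k}|\cdot|)](z)\Vert_{L^2(\mathbb{R}^{n\varkappa}_z)},$$ $$\Vert m\Vert_{l.u.,H^s}=\sup_{k>0,\,x\in\mathbb{R}^n}2^{k(s-\frac{n\varkappa}{2})}\Vert\langle z\rangle^s\mathscr{F}[m(x,\cdot)\psi(2^{-k}|\cdot|)](z)\Vert_{L^2(\mathbb{R}^{n\varkappa}_z)},$$ where in the second case $m$ is a function on $\mathbb{R}^n\times\mathbb{R}^{n\varkappa}$ and the symbol of $T_m$ is its restriction to $\mathbb{R}^n\times\mathbb{N}_0^{n\varkappa}$. The exponent $\gamma_p$ ($2\le p\le\infty$) is an exponent for which $\Vert\phi_\mu\Vert_{L^p(\mathbb{R}^n)}\Vert\phi_\mu\Vert_{L^{p'}(\mathbb{R}^n)}\lesssim|\mu|^{\gamma_p}$ as $|\mu|\to\infty$, $\mu\in\mathbb{N}_0^n$ ($\frac1p+\frac1{p'}=1$), with values: for $n\ge2$, $\gamma_p=\frac{n-1}{2}(\frac12-\frac1p)$ if $2\le p<\frac{2(n+3)}{n+1}$; $\gamma_p=\frac{n-1}{2(n+3)}$ if $p=\frac{2(n+3)}{n+1}$; $\gamma_p=-\frac16+\frac{2n}{3}(\frac12-\frac1p)$ if $\frac{2(n+3)}{n+1}<p\le\frac{2n}{n-2}$;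 $\gamma_p=-\frac12+n(\frac12-\frac1p)$ if $\frac{2n}{n-2}\le p\le\infty$ (with $\frac{2n}{n-2}=\infty$ for $n=2$); for $n=1$, $\gamma_p=0$ if $2\le p<4$ and $\gamma_p=-\frac16+\frac23(\frac12-\frac1p)$ if $4<p\le\infty$; for $n=1$, $p=4$ it is any nonnegative exponent for which the bound holds. For every $n$ and $2\le p<4$, $\gamma_p=0$ is also admissible. In particular $\gamma_\infty=\frac{n-1}{2}$ for $n\ge2$ and $\gamma_\infty=\frac16$ for $n=1$.
   Formalization: The symbol m(x,ν) is assumed measurable in x for each ν, and in the H^s case each localized piece m(x,·)ψ(2^{-k}|·|) is taken to be its continuous representative, so that restricting m to the lattice is meaningful; without these the claim fails. *)

theory Defs
  imports "HOL-Analysis.Analysis" "HOL-Probability.Essential_Supremum"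
begin

section \<open>Test functions and Lebesgue spaces\<close>

primrec C_times :: "nat \<Rightarrow> ('a::real_normed_vector \<Rightarrow> 'b::real_normed_vector) \<Rightarrow> bool" where
  "C_times 0 f \<longleftrightarrow> continuous_on UNIV f"
| "C_times (Suc r) f \<longleftrightarrow> (\<forall>x. f differentiable (at x)) \<and>
     (\<forall>v. C_times r (\<lambda>x. frechet_derivative f (at x) v))"

definition test_function :: "('a::euclidean_space \<Rightarrow> complex) \<Rightarrow> bool" where
  "test_function f \<longleftrightarrow> (\<forall>r. C_times r f) \<and> compact (closure {x. f x \<noteq> 0})"

definition Lp_norm :: "ennreal \<Rightarrow> ('a::euclidean_space \<Rightarrow> 'b::real_normed_vector) \<Rightarrow> ennreal" where
  "Lp_norm p f =
    (if p = \<infinity> then esssup lebesgue (\<lambda>x. ennreal (norm (f x)))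
     else let I = (\<integral>\<^sup>+ x. ennreal (norm (f x) powr enn2real p) \<partial>lebesgue)
          in if I = \<infinity> then \<infinity> else ennreal (enn2real I powr (1 / enn2real p)))"

text \<open>Elements of Lebesgue spaces are represented by functions, not by classes modulo null sets.\<close>

definition Lp_space :: "ennreal \<Rightarrow> ('a::euclidean_space \<Rightarrow> complex) set" where
  "Lp_space p = {f \<in> borel_measurable lebesgue. Lp_norm p f < \<infinity>}"

section \<open>Hermite functions\<close>

definition hermite_poly :: "nat \<Rightarrow> real \<Rightarrow> real" where
  "hermite_poly k t = (- 1) ^ k * exp (t\<^sup>2) * (deriv ^^ k) (\<lambda>u. exp (- u\<^sup>2)) t"

definition hermite_fun :: "nat \<Rightarrow> real \<Rightarrow> real" where
  "hermite_fun k t = hermite_poly k t * exp (- t\<^sup>2 / 2) / sqrt (2 ^ k * fact k * sqrt pi)"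

definition hermite_fun_vec :: "nat ^ 'n \<Rightarrow> real ^ 'n \<Rightarrow> real" where
  "hermite_fun_vec \<mu> x = (\<Prod>j\<in>UNIV. hermite_fun (\<mu> $ j) (x $ j))"

text \<open>
  With \<open>n = CARD('n)\<close> and \<open>\<kappa> = CARD('k)\<close>, the type \<open>real ^ 'n ^ 'k\<close> is the Euclidean space of
  dimension \<open>n * \<kappa>\<close>, seen as \<open>\<kappa>\<close> blocks of size \<open>n\<close>, and \<open>nat ^ 'n ^ 'k\<close> is the set of its
  multi-indices.
\<close>

definition hermite_fun_block :: "nat ^ 'n ^ 'k \<Rightarrow> real ^ 'n ^ 'k \<Rightarrow> real" where
  "hermite_fun_block \<nu> z = (\<Prod>i\<in>UNIV. hermite_fun_vec (\<nu> $ i) (z $ i))"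

definition hermite_coeff :: "(real ^ 'n \<Rightarrow> complex) \<Rightarrow> nat ^ 'n \<Rightarrow> complex" where
  "hermite_coeff f \<mu> = (\<integral>x. f x * of_real (hermite_fun_vec \<mu> x) \<partial>lebesgue)"

section \<open>Multilinear pseudo-multipliers\<close>

definition pseudo_multiplier ::
    "(real ^ 'n \<Rightarrow> nat ^ 'n ^ 'k \<Rightarrow> complex) \<Rightarrow> ('k \<Rightarrow> real ^ 'n \<Rightarrow> complex) \<Rightarrow> real ^ 'n \<Rightarrow> complex" where
  "pseudo_multiplier m f x =
     (\<Sum>\<^sub>\<infinity>\<nu>. m x \<nu> * (\<Prod>i\<in>UNIV. hermite_coeff (f i) (\<nu> $ i)) *
            (\<Prod>i\<in>UNIV. of_real (hermite_fun_vec (\<nu> $ i) x)))"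

text \<open>
  Multilinearity is required up to null sets. Together with the norm bound it implies that \<open>T\<close>
  is well defined on classes modulo null sets.
\<close>

definition extends_to_bounded_multilinear ::
    "(('k::finite \<Rightarrow> real ^ 'n \<Rightarrow> complex) \<Rightarrow> real ^ 'n \<Rightarrow> complex) \<Rightarrow> ('k \<Rightarrow> ennreal) \<Rightarrow> ennreal \<Rightarrow> bool"
  where
  "extends_to_bounded_multilinear S P p \<longleftrightarrow>
    (\<exists>T :: ('k \<Rightarrow> real ^ 'n \<Rightarrow> complex) \<Rightarrow> real ^ 'n \<Rightarrow> complex.
      (\<forall>f. (\<forall>i. f i \<in> Lp_space (P i)) \<longrightarrow> T f \<in> Lp_space p) \<and>
      (\<forall>f i g h a b. (\<forall>i. f i \<in> Lp_space (P i)) \<longrightarrow> g \<in> Lp_space (P i) \<longrightarrow> h \<in> Lp_space (P i) \<longrightarrow>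
         (AE x in lebesgue. T (f(i := \<lambda>y. a * g y + b * h y)) x
            = a * T (f(i := g)) x + b * T (f(i := h)) x)) \<and>
      (\<exists>C::real. \<forall>f. (\<forall>i. f i \<in> Lp_space (P i)) \<longrightarrow>
         Lp_norm p (T f) \<le> ennreal C * (\<Prod>i\<in>UNIV. Lp_norm (P i) (f i))) \<and>
      (\<forall>f. (\<forall>i. test_function (f i)) \<longrightarrow> (AE x in lebesgue. T f x = S f x)))"

section \<open>Locally uniform Sobolev norms of symbols\<close>

definition fourier_transform :: "('a::euclidean_space \<Rightarrow> complex) \<Rightarrow> 'a \<Rightarrow> complex" where
  "fourier_transform f \<xi> = (\<integral>z. cis (- 2 * pi * (z \<bullet> \<xi>)) * f z \<partial>lebesgue)"

definition inverse_hermite_transform ::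
    "(nat ^ 'n ^ 'k \<Rightarrow> complex) \<Rightarrow> real ^ 'n ^ 'k \<Rightarrow> complex" where
  "inverse_hermite_transform u z = (\<Sum>\<^sub>\<infinity>\<nu>. u \<nu> * of_real (hermite_fun_block \<nu> z))"

definition weighted_L2_norm :: "real \<Rightarrow> ('a::euclidean_space \<Rightarrow> complex) \<Rightarrow> ennreal" where
  "weighted_L2_norm s F = Lp_norm 2 (\<lambda>z. of_real (sqrt (1 + (norm z)\<^sup>2) powr s) * F z)"

definition dyadic_cutoff :: "(real \<Rightarrow> complex) \<Rightarrow> nat \<Rightarrow> 'a::euclidean_space \<Rightarrow> complex" where
  "dyadic_cutoff \<psi> k \<xi> = \<psi> (2 powr (- real k) * norm \<xi>)"

text \<open>
  The length of a multi-index is its Euclidean length in \<open>real ^ 'n ^ 'k\<close>, so that both norms use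
  the same cut-offs; \<open>map_matrix real\<close> is the inclusion of the multi-indices in this space. The
  scales are the positive integers \<open>k\<close>.
\<close>

definition lu_hermite_norm ::
    "(real \<Rightarrow> complex) \<Rightarrow> real \<Rightarrow> (real ^ 'n \<Rightarrow> nat ^ 'n ^ 'k \<Rightarrow> complex) \<Rightarrow> ennreal" where
  "lu_hermite_norm \<psi> s m =
     (SUP k\<in>{k::nat. k > 0}. SUP x.
        ennreal (2 powr (real k * (s - real (CARD('n) * CARD('k)) / 2))) *
        weighted_L2_norm s
          (inverse_hermite_transform (\<lambda>\<nu>. m x \<nu> * dyadic_cutoff \<psi> k (map_matrix real \<nu>))))"

definition lu_sobolev_norm ::
    "(real \<Rightarrow> complex) \<Rightarrow> real \<Rightarrow> (real ^ 'n \<Rightarrow> real ^ 'n ^ 'k \<Rightarrow> complex) \<Rightarrow> ennreal" where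
  "lu_sobolev_norm \<psi> s M =
     (SUP k\<in>{k::nat. k > 0}. SUP x.
        ennreal (2 powr (real k * (s - real (CARD('n) * CARD('k)) / 2))) *
        weighted_L2_norm s (fourier_transform (\<lambda>\<xi>. M x \<xi> * dyadic_cutoff \<psi> k \<xi>)))"

text \<open>
  \<open>lu_sobolev_norm\<close> only sees \<open>M x\<close> up to null sets, and the multi-indices form a null set.
  Restricting \<open>M\<close> to them is meaningful because functions in a Sobolev space of order greater
  than half the dimension have a continuous representative; the second conjunct says that the
  localized pieces of \<open>M\<close> are these representatives.
\<close>

definition restricts_to_symbol ::
    "(real \<Rightarrow> complex) \<Rightarrow> (real ^ 'n \<Rightarrow> real ^ 'n ^ 'k \<Rightarrow> complex) \<Rightarrow> (real ^ 'n \<Rightarrow> nat ^ 'n ^ 'k \<Rightarrow> complex) \<Rightarrow> bool"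
  where
  "restricts_to_symbol \<psi> M m \<longleftrightarrow>
     (\<forall>x \<nu>. m x \<nu> = M x (map_matrix real \<nu>)) \<and>
     (\<forall>x. \<forall>k>0. continuous_on UNIV (\<lambda>\<xi>. M x \<xi> * dyadic_cutoff \<psi> k \<xi>))"

definition bounded_measurable_symbol :: "(real ^ 'n \<Rightarrow> nat ^ 'n ^ 'k \<Rightarrow> complex) \<Rightarrow> bool" where
  "bounded_measurable_symbol m \<longleftrightarrow>
     (\<exists>B. \<forall>x \<nu>. norm (m x \<nu>) \<le> B) \<and> (\<forall>\<nu>. (\<lambda>x. m x \<nu>) \<in> borel_measurable lebesgue)"

section \<open>The exponents governing norms of Hermite functions\<close>

definition hermite_Lp_bound :: "'n::finite itself \<Rightarrow> ennreal \<Rightarrow> real \<Rightarrow> bool" where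
  "hermite_Lp_bound _ p \<gamma> \<longleftrightarrow>
     (\<forall>q. 1 \<le> q \<longrightarrow> inverse p + inverse q = 1 \<longrightarrow>
       (\<exists>C R. \<forall>\<mu>::nat ^ 'n. R \<le> norm (\<chi> j. real (\<mu> $ j)) \<longrightarrow>
          Lp_norm p (hermite_fun_vec \<mu>) * Lp_norm q (hermite_fun_vec \<mu>)
            \<le> ennreal (C * norm (\<chi> j. real (\<mu> $ j)) powr \<gamma>)))"

text \<open>
  The explicit value for \<open>2 \<le> p\<close>, of no significance for \<open>n = 1\<close>, \<open>p = 4\<close>.
\<close>

definition gamma_value :: "nat \<Rightarrow> ennreal \<Rightarrow> real" where
  "gamma_value n p =
    (let d = 1 / 2 - enn2real (inverse p);
         p\<^sub>1 = ennreal (2 * (real n + 3) / (real n + 1));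
         p\<^sub>2 = (if n = 2 then \<infinity> else ennreal (2 * real n / (real n - 2)))
     in if n = 1 then (if p < 4 then 0 else - 1 / 6 + 2 / 3 * d)
        else if p < p\<^sub>1 then (real n - 1) / 2 * d
        else if p = p\<^sub>1 then (real n - 1) / (2 * (real n + 3))
        else if p \<le> p\<^sub>2 then - 1 / 6 + 2 * real n / 3 * d
        else - 1 / 2 + real n * d)"

lemma gamma_value_top: "n \<ge> 1 \<Longrightarrow> gamma_value n \<infinity> = (if n = 1 then 1 / 6 else (real n - 1) / 2)"
  by (auto simp: gamma_value_def Let_def field_simps top_unique)

definition gamma_exponent :: "'n::finite itself \<Rightarrow> ennreal \<Rightarrow> real \<Rightarrow> bool" where
  "gamma_exponent N p \<gamma> \<longleftrightarrow>
     \<not> (CARD('n) = 1 \<and> p = 4) \<and> \<gamma> = gamma_value CARD('n) p \<or>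
     CARD('n) = 1 \<and> p = 4 \<and> 0 \<le> \<gamma> \<and> hermite_Lp_bound N p \<gamma> \<or>
     2 \<le> p \<and> p < 4 \<and> \<gamma> = 0"

end

theory Submission
  imports Defs
    "HOL-Probability.Distributions"
    "HOL-Probability.Sinc_Integral"
    "HOL-Probability.Characteristic_Functions"
begin

text \<open>
  Write \<open>d = n * \<kappa>\<close>. Either norm of the symbol controls the supremum of its localized pieces (by Parseval,
  respectively by Fourier inversion), so \<open>m x \<nu>\<close> decays like the power \<open>- (s - d / 2)\<close> of \<open>norm \<nu>\<close>, and this
  is dominated by a product of weights \<open>(1 + \<nu> $ i $ j) powr (- \<tau>)\<close> with \<open>\<tau> > 1\<close> as soon as \<open>s > 3 * d / 2\<close>.
  Hence the multilinear operator is dominated pointwise by a product of \<open>\<kappa>\<close> positive linear operators, whose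
  kernels are products of the one-dimensional kernels
  \<open>\<Sum>a. (1 + a) powr (- \<tau>) * \<bar>hermite_fun a s\<bar> * \<bar>hermite_fun a t\<bar>\<close>. Because \<open>\<Sum>a<N. (hermite_fun a s)\<^sup>2\<close> is
  \<open>O(sqrt N)\<close> uniformly in \<open>s\<close> and the \<open>L\<^sup>1\<close> norm of \<open>hermite_fun a\<close> is \<open>O(a powr (1 / 4))\<close>, Schur's test bounds
  these operators on every \<open>L\<^sup>p\<close>, and Hoelder's inequality concludes.
\<close>

section \<open>Hermite functions\<close>

text \<open>Two facts fix the exponents; h_a stands for \<open>hermite_fun a\<close>, H_a for
  \<open>hermite_poly a\<close>. A decay of order s - d / 2, shared equally by the d coordinates,
  gives each the power \<tau> = (s - d / 2) / d, and \<tau> > 1 is the same as s > 3 d / 2. The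
  obstacle is to make \<tau> > 1 suffice. The row integral of the one-dimensional kernel is of the
  size of the sum over a of (1 + a)^(-\<tau>) (1 + a)^(1/4) |h_a(s)|, and the uniform bound of a
  single |h_a(s)|, of order a^(-1/12), would demand \<tau> > 7/6. But (1 + a)^(1/4) |h_a(s)| is at
  most half of 1 + (1 + a)^(1/2) h_a(s)^2, and h_a(s)^2 has size a^(-1/2) on average over a,
  uniformly in s. Summation by parts exploits this average, and the sum is dominated by the zeta
  series at \<tau>. Absolute values are taken throughout, so cancellation is given up; in return the
  same positive operator serves all exponents, the endpoints 1 and \<infinity> included.\<close>

lemma deriv_funpow_gauss:
  "(deriv ^^ k) (\<lambda>u. exp (- u\<^sup>2)) = (\<lambda>t. (- 1) ^ k * hermite_poly k t * exp (- t\<^sup>2))"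
proof
  fix t :: real
  have "(- 1) ^ k * hermite_poly k t * exp (- t\<^sup>2) =
      ((- 1) ^ k * (- 1) ^ k) * (exp (t\<^sup>2) * exp (- t\<^sup>2)) * (deriv ^^ k) (\<lambda>u. exp (- u\<^sup>2)) t"
    unfolding hermite_poly_def by (simp only: mult_ac)
  then show "(deriv ^^ k) (\<lambda>u. exp (- u\<^sup>2)) t = (- 1) ^ k * hermite_poly k t * exp (- t\<^sup>2)"
    by (simp flip: power_mult_distrib exp_add)
qed

lemma hermite_poly_0 [simp]: "hermite_poly 0 = (\<lambda>t. 1)"
  by (simp add: hermite_poly_def fun_eq_iff flip: exp_add)

text \<open>The k-th derivative of the Gaussian, (-1)^k H_k(t) e^(-t^2), is differentiated once
  more. \<open>D\<close> stays abstract because its value 2k H_(k-1) is itself proved from this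
  relation.\<close>

lemma hermite_poly_Suc_deriv:
  assumes "(hermite_poly k has_real_derivative D) (at t)"
  shows "hermite_poly (Suc k) t = 2 * t * hermite_poly k t - D"
proof -
  have "((\<lambda>t. (- 1) ^ k * hermite_poly k t * exp (- t\<^sup>2)) has_real_derivative
      (- 1) ^ k * (D - 2 * t * hermite_poly k t) * exp (- t\<^sup>2)) (at t)"
    by (auto intro!: derivative_eq_intros assms simp: algebra_simps)
  then have "deriv (\<lambda>t. (- 1) ^ k * hermite_poly k t * exp (- t\<^sup>2)) t =
      (- 1) ^ k * (D - 2 * t * hermite_poly k t) * exp (- t\<^sup>2)"
    by (rule DERIV_imp_deriv)
  then have "(- 1) ^ Suc k * hermite_poly (Suc k) t * exp (- t\<^sup>2) =
      (- 1) ^ Suc k * (2 * t * hermite_poly k t - D) * exp (- t\<^sup>2)"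
    using deriv_funpow_gauss[of "Suc k"] deriv_funpow_gauss[of k]
    by (simp add: fun_eq_iff algebra_simps)
  then show ?thesis
    by simp
qed

text \<open>Recurrence and derivative formula depend on each other, so both advance in one strong
  induction: lower derivatives give the recurrence, whose differentiation gives the next derivative.
  At k = 0 the truncated \<open>k - 1\<close> is harmless because of the factor k.\<close>

lemma DERIV_hermite_poly:
  "(hermite_poly k has_real_derivative 2 * real k * hermite_poly (k - 1) t) (at t)"
proof (induction k arbitrary: t rule: less_induct)
  case (less k)
  show ?case
  proof (cases k)
    case 0
    then show ?thesis by simp
  next
    case k: (Suc j)
    have rec: "hermite_poly (Suc i) = (\<lambda>t. 2 * t * hermite_poly i t - 2 * real i * hermite_poly (i - 1) t)"
      if "i \<le> j" for i
      using that k by (intro ext hermite_poly_Suc_deriv less.IH) simp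
    have D: "(hermite_poly j has_real_derivative 2 * real j * hermite_poly (j - 1) t) (at t)"
      "(hermite_poly (j - 1) has_real_derivative 2 * real (j - 1) * hermite_poly (j - 1 - 1) t) (at t)"
      by (rule less.IH, simp add: k)+
    have "((\<lambda>t. 2 * t * hermite_poly j t - 2 * real j * hermite_poly (j - 1) t) has_real_derivative
        2 * hermite_poly j t + 2 * t * (2 * real j * hermite_poly (j - 1) t)
        - 2 * real j * (2 * real (j - 1) * hermite_poly (j - 1 - 1) t)) (at t)"
    proof -
      have "((\<lambda>t. 2 * t) has_real_derivative 2) (at t)"
        by (auto intro!: derivative_eq_intros)
      from DERIV_diff[OF DERIV_mult[OF this D(1)] DERIV_cmult[OF D(2), of "2 * real j"]] show ?thesis
        by (simp only: add.commute mult.commute)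
    qed
    \<comment> \<open>The recurrence at index j - 1 turns the last two terms into 2j H_j.\<close>
    moreover have "2 * hermite_poly j t + 2 * t * (2 * real j * hermite_poly (j - 1) t)
        - 2 * real j * (2 * real (j - 1) * hermite_poly (j - 1 - 1) t) = 2 * real k * hermite_poly (k - 1) t"
      using rec[of "j - 1"] k by (cases j) (auto simp: algebra_simps)
    ultimately show ?thesis
      using rec[of j] k by simp
  qed
qed

lemma hermite_poly_Suc:
  "hermite_poly (Suc k) t = 2 * t * hermite_poly k t - 2 * real k * hermite_poly (k - 1) t"
  by (rule hermite_poly_Suc_deriv[OF DERIV_hermite_poly])

lemma hermite_normalization_Suc:
  "sqrt (2 ^ Suc k * fact (Suc k) * sqrt pi) = sqrt (2 * real (Suc k)) * sqrt (2 ^ k * fact k * sqrt pi)"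
proof -
  have "2 ^ Suc k * fact (Suc k) * sqrt pi = (2 * real (Suc k)) * (2 ^ k * fact k * sqrt pi)"
    by (simp only: fact_Suc power_Suc mult_ac of_nat_fact)
  then show ?thesis
    by (simp only: real_sqrt_mult)
qed

text \<open>The factor sqrt(2k) is the ratio of the norming constants of k and k - 1. The term 2k
  H_(k-1) occurs in the recurrence and in the derivative, and is normalized here for both.\<close>

lemma hermite_fun_lower:
  "sqrt (2 * real k) * hermite_fun (k - 1) t =
     2 * real k * hermite_poly (k - 1) t * exp (- t\<^sup>2 / 2) / sqrt (2 ^ k * fact k * sqrt pi)"
proof (cases k)
  case (Suc j)
  define c r where "c = sqrt (2 ^ j * fact j * sqrt pi)" and "r = sqrt (2 * real (Suc j))"
  have cr: "c > 0" "r > 0" "2 * real (Suc j) = r * r"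
    by (simp_all add: c_def r_def)
  have "r * (hermite_poly j t * exp (- t\<^sup>2 / 2) / c) =
      2 * real (Suc j) * hermite_poly j t * exp (- t\<^sup>2 / 2) / (r * c)"
    unfolding cr(3) using cr by simp
  then show ?thesis
    unfolding Suc hermite_normalization_Suc diff_Suc_1 hermite_fun_def
    unfolding r_def[symmetric] c_def[symmetric] .
qed simp

lemma hermite_fun_rec:
  "sqrt (2 * real (Suc k)) * hermite_fun (Suc k) t =
     2 * t * hermite_fun k t - sqrt (2 * real k) * hermite_fun (k - 1) t"
proof -
  define c r where "c = sqrt (2 ^ k * fact k * sqrt pi)" and "r = sqrt (2 * real (Suc k))"
  have cr: "c > 0" "r > 0"
    by (simp_all add: c_def r_def)
  have "r * (hermite_poly (Suc k) t * exp (- t\<^sup>2 / 2) / (r * c)) =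
      2 * t * (hermite_poly k t * exp (- t\<^sup>2 / 2) / c) - 2 * real k * hermite_poly (k - 1) t * exp (- t\<^sup>2 / 2) / c"
    unfolding hermite_poly_Suc using cr by (simp add: divide_simps) (simp add: algebra_simps)
  then show ?thesis
    unfolding hermite_fun_lower unfolding hermite_fun_def hermite_normalization_Suc
    unfolding r_def[symmetric] c_def[symmetric] .
qed

text \<open>Together with \<open>hermite_fun_rec\<close> this is the ladder relation:
  differentiation, like multiplication by t, combines only the neighbours k - 1 and k + 1.\<close>

lemma DERIV_hermite_fun:
  "(hermite_fun k has_real_derivative sqrt (2 * real k) * hermite_fun (k - 1) t - t * hermite_fun k t) (at t)"
proof -
  define c where "c = sqrt (2 ^ k * fact k * sqrt pi)"
  have "((\<lambda>t. exp (- t\<^sup>2 / 2) / c) has_real_derivative - t * exp (- t\<^sup>2 / 2) / c) (at t)"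
    by (rule DERIV_cdivide) (auto intro!: derivative_eq_intros)
  from DERIV_mult[OF DERIV_hermite_poly[of k t] this]
  have "((\<lambda>t. hermite_poly k t * (exp (- t\<^sup>2 / 2) / c)) has_real_derivative
      2 * real k * hermite_poly (k - 1) t * exp (- t\<^sup>2 / 2) / c - t * hermite_fun k t) (at t)"
    by (rule DERIV_cong) (simp add: hermite_fun_def c_def)
  moreover have "hermite_fun k = (\<lambda>t. hermite_poly k t * (exp (- t\<^sup>2 / 2) / c))"
    by (simp add: hermite_fun_def c_def fun_eq_iff)
  ultimately show ?thesis
    unfolding hermite_fun_lower c_def by argo
qed

lemma continuous_on_hermite_fun [continuous_intros]:
  "continuous_on A f \<Longrightarrow> continuous_on A (\<lambda>x. hermite_fun k (f x))"
  using continuous_on_compose2[of UNIV "hermite_fun k" A f] DERIV_isCont[OF DERIV_hermite_fun]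
  by (auto simp: continuous_on_eq_continuous_at)

lemma borel_measurable_hermite_fun [measurable]: "hermite_fun k \<in> borel_measurable borel"
  by (intro borel_measurable_continuous_onI continuous_intros)

section \<open>Decay and integrability of Hermite functions\<close>

text \<open>Qualitative decay, for integrability and vanishing at infinity. The polynomials are
  treated for every a > 0 so that the induction can give half of the exponent to H_j and half to the
  extra factor t; a = 1/4 then still leaves a Gaussian.\<close>

lemma hermite_fun_gauss_bound:
  "\<exists>C. \<forall>t. \<bar>hermite_fun k t\<bar> \<le> C * exp (- t\<^sup>2 / 4)"
proof -
  have "\<forall>a>0. \<exists>C. \<forall>t. \<bar>hermite_poly k t\<bar> \<le> C * exp (a * t\<^sup>2)"
  proof (induction k rule: less_induct)
    case (less k)
    show ?case
    proof (cases k)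
      case 0
      then show ?thesis
        by (auto intro!: exI[of _ 1])
    next
      case (Suc j)
      show ?thesis
      proof (intro allI impI)
        fix a :: real assume a: "a > 0"
        obtain C1 where C1: "\<And>t. \<bar>hermite_poly j t\<bar> \<le> C1 * exp (a / 2 * t\<^sup>2)"
        proof -
          have "j < k" "a / 2 > 0"
            using Suc a by auto
          from less.IH[rule_format, OF this] show ?thesis
            using that by blast
        qed
        obtain C2 where C2: "\<And>t. \<bar>hermite_poly (j - 1) t\<bar> \<le> C2 * exp (a * t\<^sup>2)"
        proof -
          have "j - 1 < k"
            using Suc by auto
          from less.IH[rule_format, OF this a] show ?thesis
            using that by blast
        qed
        have "C1 \<ge> 0"
          using C1[of 0] by simp
        have t: "2 * \<bar>t\<bar> \<le> (1 + 2 / a) * exp (a / 2 * t\<^sup>2)" for t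
        proof -
          have "2 * \<bar>t\<bar> \<le> 1 + t\<^sup>2"
            using zero_le_power2[of "\<bar>t\<bar> - 1"] by (simp add: power2_eq_square algebra_simps)
          also have "\<dots> \<le> (1 + 2 / a) * (1 + a / 2 * t\<^sup>2)"
            using a by (simp add: field_simps)
          also have "\<dots> \<le> (1 + 2 / a) * exp (a / 2 * t\<^sup>2)"
            using a by (intro mult_left_mono exp_ge_add_one_self) auto
          finally show ?thesis .
        qed
        have "\<bar>hermite_poly k t\<bar> \<le> ((1 + 2 / a) * C1 + 2 * real j * C2) * exp (a * t\<^sup>2)" for t
        proof -
          have "\<bar>hermite_poly k t\<bar> \<le> (2 * \<bar>t\<bar>) * \<bar>hermite_poly j t\<bar> + 2 * real j * \<bar>hermite_poly (j - 1) t\<bar>"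
            unfolding Suc hermite_poly_Suc by (rule order_trans[OF abs_triangle_ineq4]) (simp add: abs_mult)
          also have "\<dots> \<le> ((1 + 2 / a) * exp (a / 2 * t\<^sup>2)) * (C1 * exp (a / 2 * t\<^sup>2)) + 2 * real j * (C2 * exp (a * t\<^sup>2))"
            using a by (intro add_mono mult_mono[OF t C1] mult_left_mono[OF C2]) auto
          also have "\<dots> = (1 + 2 / a) * C1 * (exp (a / 2 * t\<^sup>2) * exp (a / 2 * t\<^sup>2)) + 2 * real j * C2 * exp (a * t\<^sup>2)"
            by (simp only: mult_ac)
          also have "\<dots> = ((1 + 2 / a) * C1 + 2 * real j * C2) * exp (a * t\<^sup>2)"
            by (simp flip: exp_add add: distrib_right)
          finally show ?thesis .
        qed
        then show "\<exists>C. \<forall>t. \<bar>hermite_poly k t\<bar> \<le> C * exp (a * t\<^sup>2)"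
          by blast
      qed
    qed
  qed
  then obtain C where C: "\<And>t. \<bar>hermite_poly k t\<bar> \<le> C * exp (1 / 4 * t\<^sup>2)"
  proof -
    assume *: "\<forall>a>0. \<exists>C. \<forall>t. \<bar>hermite_poly k t\<bar> \<le> C * exp (a * t\<^sup>2)"
    have "1 / 4 > (0::real)"
      by simp
    from *[rule_format, OF this] show ?thesis
      using that by blast
  qed
  define c where "c = sqrt (2 ^ k * fact k * sqrt pi)"
  have "c > 0" by (simp add: c_def)
  have "\<bar>hermite_fun k t\<bar> \<le> C / c * exp (- t\<^sup>2 / 4)" for t
  proof -
    have "\<bar>hermite_fun k t\<bar> = \<bar>hermite_poly k t\<bar> * exp (- t\<^sup>2 / 2) / c"
      using \<open>c > 0\<close> by (simp add: hermite_fun_def abs_mult flip: c_def)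
    also have "\<dots> \<le> C * exp (1 / 4 * t\<^sup>2) * exp (- t\<^sup>2 / 2) / c"
      using C[of t] \<open>c > 0\<close> by (intro divide_right_mono mult_right_mono) auto
    also have "\<dots> = C / c * exp (- t\<^sup>2 / 4)"
      by (simp flip: exp_add)
    finally show ?thesis .
  qed
  then show ?thesis by blast
qed

lemma gauss_integral:
  fixes c :: real
  assumes "c > 0"
  shows "integrable lborel (\<lambda>t. exp (- c * t\<^sup>2))" "(\<integral>t. exp (- c * t\<^sup>2) \<partial>lborel) = sqrt (pi / c)"
proof -
  define \<sigma> where "\<sigma> = sqrt (1 / (2 * c))"
  have \<sigma>: "\<sigma>\<^sup>2 = 1 / (2 * c)"
    using assms by (simp add: \<sigma>_def)
  have eq: "(\<lambda>t. exp (- c * t\<^sup>2)) = (\<lambda>t. sqrt (pi / c) * normal_density 0 \<sigma> t)"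
    using assms by (auto simp: normal_density_def \<sigma> fun_eq_iff field_simps)
  show "integrable lborel (\<lambda>t. exp (- c * t\<^sup>2))"
    unfolding eq by (intro integrable_mult_right integrable_normal_density) (use assms in \<open>simp add: \<sigma>_def\<close>)
  show "(\<integral>t. exp (- c * t\<^sup>2) \<partial>lborel) = sqrt (pi / c)"
    unfolding eq using assms by (simp add: \<sigma>_def)
qed

lemma hermite_fun_prod_bound:
  "\<exists>C\<ge>0. \<forall>t. \<bar>hermite_fun j t * hermite_fun k t\<bar> \<le> C * exp (- (1 / 2) * t\<^sup>2)"
proof -
  obtain C where C: "\<And>t. \<bar>hermite_fun j t\<bar> \<le> C * exp (- t\<^sup>2 / 4)"
    using hermite_fun_gauss_bound by blast
  obtain D where D: "\<And>t. \<bar>hermite_fun k t\<bar> \<le> D * exp (- t\<^sup>2 / 4)"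
    using hermite_fun_gauss_bound by blast
  have "C \<ge> 0" "D \<ge> 0"
    using C[of 0] D[of 0] by auto
  moreover have "\<bar>hermite_fun j t * hermite_fun k t\<bar> \<le> C * D * exp (- (1 / 2) * t\<^sup>2)" for t
  proof -
    have "\<bar>hermite_fun j t * hermite_fun k t\<bar> \<le> (C * exp (- t\<^sup>2 / 4)) * (D * exp (- t\<^sup>2 / 4))"
      unfolding abs_mult using \<open>C \<ge> 0\<close> by (intro mult_mono C D) auto
    also have "\<dots> = C * D * (exp (- t\<^sup>2 / 4) * exp (- t\<^sup>2 / 4))"
      by (simp only: mult_ac)
    also have "\<dots> = C * D * exp (- (1 / 2) * t\<^sup>2)"
      by (simp flip: exp_add)
    finally show ?thesis .
  qed
  ultimately show ?thesis
    by (intro exI[of _ "C * D"]) auto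
qed

lemma integrable_hermite_fun_prod [simp, intro]:
  "integrable lborel (\<lambda>t. hermite_fun j t * hermite_fun k t)"
proof -
  obtain C where C: "\<And>t. \<bar>hermite_fun j t * hermite_fun k t\<bar> \<le> C * exp (- (1 / 2) * t\<^sup>2)"
    using hermite_fun_prod_bound by blast
  have "integrable lborel (\<lambda>t. C * exp (- (1 / 2) * t\<^sup>2))"
    by (intro integrable_mult_right gauss_integral) simp
  then show ?thesis
    by (rule Bochner_Integration.integrable_bound) (auto intro!: AE_I2 C[THEN order_trans])
qed

lemma tendsto_hermite_fun_prod:
  "((\<lambda>t. hermite_fun j t * hermite_fun k t) \<longlongrightarrow> 0) at_infinity"
proof -
  obtain C where C: "\<And>t. \<bar>hermite_fun j t * hermite_fun k t\<bar> \<le> C * exp (- (1 / 2) * t\<^sup>2)" "C \<ge> 0"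
    using hermite_fun_prod_bound by blast
  have "norm (hermite_fun j t * hermite_fun k t) \<le> norm (inverse t) * C" if "t \<noteq> 0" for t
  proof -
    have "\<bar>t\<bar> \<le> 1 + 1 / 2 * t\<^sup>2"
      using zero_le_power2[of "\<bar>t\<bar> - 1"] by (simp add: power2_eq_square algebra_simps)
    also have "\<dots> \<le> exp (1 / 2 * t\<^sup>2)"
      by (rule exp_ge_add_one_self)
    finally have "exp (- (1 / 2) * t\<^sup>2) \<le> inverse \<bar>t\<bar>"
      using that by (simp add: exp_minus)
    then show ?thesis
      using C(1)[of t] mult_left_mono[OF _ C(2), of "exp (- (1 / 2) * t\<^sup>2)" "inverse \<bar>t\<bar>"]
      by (simp add: mult.commute)
  qed
  moreover have "\<forall>\<^sub>F t in at_infinity. (t::real) \<noteq> 0"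
    by (auto simp: eventually_at_infinity intro!: exI[of _ 1])
  ultimately have "\<forall>\<^sub>F t in at_infinity. norm (hermite_fun j t * hermite_fun k t) \<le> norm (inverse t) * C"
    by (auto elim: eventually_mono)
  then show ?thesis
    by (rule tendsto_0_le[OF tendsto_inverse_0])
qed

section \<open>Orthonormality and the sum of squares, from derivatives of products\<close>

lemma integral_derivative_eq_0:
  fixes F f :: "real \<Rightarrow> real"
  assumes "\<And>x. (F has_real_derivative f x) (at x)" "continuous_on UNIV f" "integrable lborel f"
    and "(F \<longlongrightarrow> 0) at_infinity"
  shows "(\<integral>x. f x \<partial>lborel) = 0"
proof -
  have "(LBINT x=-\<infinity>..\<infinity>. f x) = 0 - 0"
    using assms at_top_le_at_infinity at_bot_le_at_infinity
    by (intro interval_integral_FTC_integrable)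
       (auto simp: has_real_derivative_iff_has_vector_derivative continuous_on_eq_continuous_at
         set_integrable_def ereal_tendsto_simps intro: filterlim_mono)
  then show ?thesis
    by (simp add: interval_lebesgue_integral_def set_lebesgue_integral_def)
qed

text \<open>The recurrence for k removes 2t h_j h_k together with sqrt(2k) h_j h_(k-1), leaving one
  product with j lowered and one with k raised. Integrated over the line this gives orthonormality;
  for j = k the right side is a difference of consecutive terms, which telescopes.\<close>

lemma DERIV_hermite_fun_prod:
  "((\<lambda>t. hermite_fun j t * hermite_fun k t) has_real_derivative
     sqrt (2 * real j) * (hermite_fun (j - 1) t * hermite_fun k t)
     - sqrt (2 * real (Suc k)) * (hermite_fun j t * hermite_fun (Suc k) t)) (at t)"
  by (rule DERIV_cong[OF DERIV_mult[OF DERIV_hermite_fun DERIV_hermite_fun]])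
     (use hermite_fun_rec[of k t] in algebra)

lemma hermite_fun_inner_rec:
  "sqrt (2 * real (Suc k)) * (\<integral>t. hermite_fun j t * hermite_fun (Suc k) t \<partial>lborel) =
   sqrt (2 * real j) * (\<integral>t. hermite_fun (j - 1) t * hermite_fun k t \<partial>lborel)"
proof -
  have "(\<integral>t. sqrt (2 * real j) * (hermite_fun (j - 1) t * hermite_fun k t)
     - sqrt (2 * real (Suc k)) * (hermite_fun j t * hermite_fun (Suc k) t) \<partial>lborel) = 0"
    by (rule integral_derivative_eq_0[OF DERIV_hermite_fun_prod _ _ tendsto_hermite_fun_prod])
       (auto intro!: continuous_intros)
  then show ?thesis
    by (subst (asm) Bochner_Integration.integral_diff) auto
qed

text \<open>\<open>hermite_fun_inner_rec\<close> lowers both indices by one, down to an index 0,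
  where the lowered factor has coefficient 0, or to the Gaussian integral of h_0^2. On the diagonal
  the two square roots are equal and cancel.\<close>

lemma hermite_fun_orthonormal:
  "(\<integral>t. hermite_fun j t * hermite_fun k t \<partial>lborel) = (if j = k then 1 else 0)"
proof (induction j arbitrary: k)
  case 0
  show ?case
  proof (cases k)
    case 0
    have eq: "(\<lambda>t. hermite_fun 0 t * hermite_fun 0 t) = (\<lambda>t. exp (- 1 * t\<^sup>2) / sqrt pi)"
      by (auto simp: hermite_fun_def fun_eq_iff real_sqrt_mult[symmetric] simp flip: exp_add)
    show ?thesis
      unfolding \<open>k = 0\<close> eq using gauss_integral(2)[of 1] by simp
  next
    case (Suc i)
    then show ?thesis
      using hermite_fun_inner_rec[of i 0] by simp
  qed
next
  case (Suc j)
  show ?case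
  proof (cases k)
    case 0
    then show ?thesis
      using hermite_fun_inner_rec[of j 0] by (simp add: mult.commute)
  next
    case (Suc i)
    then show ?thesis
      using hermite_fun_inner_rec[of i "Suc j"] Suc.IH[of i] by auto
  qed
qed

lemma integral_hermite_fun_sq: "(\<integral>t. (hermite_fun k t)\<^sup>2 \<partial>lborel) = 1"
  using hermite_fun_orthonormal[of k k] by (simp add: power2_eq_square)

lemma integrable_hermite_fun_sq [simp, intro]: "integrable lborel (\<lambda>t. (hermite_fun k t)\<^sup>2)"
  using integrable_hermite_fun_prod[of k k] by (simp add: power2_eq_square)

text \<open>
  The derivative of the sum telescopes to \<open>- sqrt (2 * N) * hermite_fun (N - 1) * hermite_fun N\<close>,
  whose integral over any interval is at most \<open>sqrt (2 * N)\<close>.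
\<close>

lemma sum_hermite_fun_sq_le: "(\<Sum>a<N. (hermite_fun a x)\<^sup>2) \<le> sqrt (2 * real N)"
proof -
  define K where "K t = (\<Sum>a<N. (hermite_fun a t)\<^sup>2)" for t
  define k where "k t = - (sqrt (2 * real N) * (hermite_fun (N - 1) t * hermite_fun N t))" for t
  have DK: "(K has_real_derivative k t) (at t)" for t
  proof -
    have "((\<lambda>t. \<Sum>a<N. (hermite_fun a t)\<^sup>2) has_real_derivative k t) (at t)"
      unfolding k_def
    proof (induction N)
      case 0
      then show ?case by simp
    next
      case (Suc N)
      have "((\<lambda>t. (hermite_fun N t)\<^sup>2) has_real_derivative
         sqrt (2 * real N) * (hermite_fun (N - 1) t * hermite_fun N t)
         - sqrt (2 * real (Suc N)) * (hermite_fun N t * hermite_fun (Suc N) t)) (at t)"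
        using DERIV_hermite_fun_prod[of N N t] by (simp add: power2_eq_square)
      from DERIV_add[OF Suc this] show ?case
        by simp
    qed
    then show ?thesis
      unfolding K_def .
  qed
  have bound: "K x \<le> K y + sqrt (2 * real N)" if "x \<le> y" for y
  proof -
    have "(\<integral>t. indicator {x..y} t *\<^sub>R k t \<partial>lborel) = K y - K x"
    proof (rule integral_FTC_Icc[OF that])
      show "(K has_vector_derivative k t) (at t within {x..y})" for t
        using DK[of t] has_field_derivative_at_within
        unfolding has_real_derivative_iff_has_vector_derivative[symmetric] by blast
      show "continuous_on {x..y} k"
        unfolding k_def by (intro continuous_intros)
    qed
    \<comment> \<open>Each of the two squares has integral 1 over the whole line, so the bound does
      not depend on the length of [x, y]; the indicator may be dropped because the majorant is
      nonnegative.\<close>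
    moreover have "- (\<integral>t. indicator {x..y} t *\<^sub>R k t \<partial>lborel) \<le>
        (\<integral>t. sqrt (2 * real N) * (1 / 2 * ((hermite_fun (N - 1) t)\<^sup>2 + (hermite_fun N t)\<^sup>2)) \<partial>lborel)"
      unfolding integral_minus[symmetric]
    proof (rule integral_mono)
      fix t
      have "hermite_fun (N - 1) t * hermite_fun N t \<le> 1 / 2 * ((hermite_fun (N - 1) t)\<^sup>2 + (hermite_fun N t)\<^sup>2)"
        using sum_squares_bound[of "hermite_fun (N - 1) t" "hermite_fun N t"] by simp
      then have "- k t \<le> sqrt (2 * real N) * (1 / 2 * ((hermite_fun (N - 1) t)\<^sup>2 + (hermite_fun N t)\<^sup>2))"
        unfolding k_def minus_minus by (intro mult_left_mono) auto
      then show "- (indicator {x..y} t *\<^sub>R k t) \<le> sqrt (2 * real N) * (1 / 2 * ((hermite_fun (N - 1) t)\<^sup>2 + (hermite_fun N t)\<^sup>2))"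
        by (auto simp: indicator_def)
    next
      have "integrable lborel k"
        unfolding k_def by (intro integrable_minus integrable_mult_right integrable_hermite_fun_prod)
      then show "integrable lborel (\<lambda>t. - (indicator {x..y} t *\<^sub>R k t))"
        by (intro integrable_minus integrable_mult_indicator) auto
    qed (intro integrable_mult_right Bochner_Integration.integrable_add integrable_hermite_fun_sq)
    ultimately show ?thesis
      by (simp add: integral_hermite_fun_sq)
  qed
  \<comment> \<open>The estimate is anchored at infinity: K y tends to 0 and only sqrt(2N)
    remains.\<close>
  have "(K \<longlongrightarrow> 0) at_infinity"
    unfolding K_def using tendsto_sum[of "{..<N}" "\<lambda>a t. (hermite_fun a t)\<^sup>2" "\<lambda>_. 0"] tendsto_hermite_fun_prod
    by (simp add: power2_eq_square)
  then have "(K \<longlongrightarrow> 0) at_top"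
    by (rule tendsto_mono[OF at_top_le_at_infinity])
  then have "((\<lambda>y. K y + sqrt (2 * real N)) \<longlongrightarrow> 0 + sqrt (2 * real N)) at_top"
    by (intro tendsto_intros)
  moreover have "\<forall>\<^sub>F y in at_top. K x \<le> K y + sqrt (2 * real N)"
    using eventually_ge_at_top[of x] by (rule eventually_mono) (rule bound)
  ultimately have "K x \<le> 0 + sqrt (2 * real N)"
    by (rule tendsto_lowerbound) simp
  then show ?thesis
    by (simp add: K_def)
qed

section \<open>Second moments and integrals of absolute values\<close>

text \<open>Serves twice: with M = k + 1 for the integral of |h_k|, and with M = 1 for the
  integrable majorant of the inverse Sobolev weight.\<close>

lemma integral_inverse_sq_scaled:
  fixes M :: real
  assumes "M > 0"
  shows "integrable lborel (\<lambda>x. 1 / (M + x\<^sup>2))" "(\<integral>x. 1 / (M + x\<^sup>2) \<partial>lborel) = pi / sqrt M"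
proof -
  have int: "integrable lborel (\<lambda>x::real. inverse (1 + x\<^sup>2))" "(\<integral>x. inverse (1 + x\<^sup>2) \<partial>(lborel :: real measure)) = pi"
    using integrable_inverse_1_plus_square LBINT_inverse_1_plus_square
    by (simp_all add: set_integrable_def interval_lebesgue_integral_def set_lebesgue_integral_def)
  define r where "r = sqrt M"
  have r: "r > 0" "M = r\<^sup>2"
    using assms by (auto simp: r_def)
  have eq: "1 / (M + (0 + r * x)\<^sup>2) = inverse (1 + x\<^sup>2) / r\<^sup>2" for x
  proof -
    have "M + (0 + r * x)\<^sup>2 = r\<^sup>2 * (1 + x\<^sup>2)"
      by (simp add: r power_mult_distrib algebra_simps)
    then show ?thesis
      by (simp add: divide_simps)
  qed
  show "integrable lborel (\<lambda>x. 1 / (M + x\<^sup>2))"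
    using lborel_integrable_real_affine_iff[of r "\<lambda>x. 1 / (M + x\<^sup>2)" 0] r int(1)
    unfolding eq by auto
  show "(\<integral>x. 1 / (M + x\<^sup>2) \<partial>lborel) = pi / sqrt M"
    using lborel_integral_real_affine[of r "\<lambda>x. 1 / (M + x\<^sup>2)" 0] r int(2)
    unfolding eq by (simp add: power2_eq_square flip: r_def)
qed

text \<open>By the recurrence 2 t h_k is a sum a + b of multiples of the two neighbours. The
  inequality (a + b)^2 \<le> 2 (a^2 + b^2) avoids the cross term and yields twice the exact value k
  + 1/2.\<close>

lemma hermite_fun_moment:
  "integrable lborel (\<lambda>t. t\<^sup>2 * (hermite_fun k t)\<^sup>2)"
  "(\<integral>t. t\<^sup>2 * (hermite_fun k t)\<^sup>2 \<partial>lborel) \<le> 2 * real k + 1"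
proof -
  define g where "g t = real (Suc k) * (hermite_fun (Suc k) t)\<^sup>2 + real k * (hermite_fun (k - 1) t)\<^sup>2" for t
  have bound: "t\<^sup>2 * (hermite_fun k t)\<^sup>2 \<le> g t" for t
  proof -
    define a b where "a = sqrt (2 * real (Suc k)) * hermite_fun (Suc k) t"
      and "b = sqrt (2 * real k) * hermite_fun (k - 1) t"
    have "2 * t * hermite_fun k t = a + b"
      using hermite_fun_rec[of k t] by (simp add: a_def b_def)
    then have "(2 * t * hermite_fun k t)\<^sup>2 = (a + b)\<^sup>2"
      by simp
    also have "\<dots> \<le> 2 * (a\<^sup>2 + b\<^sup>2)"
      using sum_squares_bound[of a b] by (simp add: power2_sum)
    also have "\<dots> = 4 * g t"
      by (simp add: a_def b_def g_def power_mult_distrib)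
    finally show ?thesis
      by (simp add: power_mult_distrib)
  qed
  have g: "integrable lborel g" "(\<integral>t. g t \<partial>lborel) = 2 * real k + 1"
    unfolding g_def by (auto simp: integral_hermite_fun_sq)
  show int: "integrable lborel (\<lambda>t. t\<^sup>2 * (hermite_fun k t)\<^sup>2)"
    using g(1) by (rule Bochner_Integration.integrable_bound) (auto intro!: AE_I2 bound[THEN order_trans])
  show "(\<integral>t. t\<^sup>2 * (hermite_fun k t)\<^sup>2 \<partial>lborel) \<le> 2 * real k + 1"
    using integral_mono[OF int g(1) bound] g(2) by simp
qed

text \<open>Cauchy-Schwarz in the pointwise form 2 x y \<le> x^2 + y^2, with the weight M + t^2
  adapted to the region of width of order sqrt(k) where h_k is concentrated.\<close>

lemma hermite_fun_L1:
  "integrable lborel (hermite_fun k)"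
  "(\<integral>t. \<bar>hermite_fun k t\<bar> \<partial>lborel) \<le> 4 * real (Suc k) powr (1 / 4)"
proof -
  \<comment> \<open>With this \<open>c\<close> the two contributions, at most 3 c M and 4 / (c sqrt
    M), both have order M^(1/4).\<close>
  define M c where "M = real (Suc k)" and "c = M powr (- 3 / 4)"
  have "M > 0" "c > 0"
    by (simp_all add: M_def c_def)
  define g where "g t = 1 / 2 * (c * (M * (hermite_fun k t)\<^sup>2 + t\<^sup>2 * (hermite_fun k t)\<^sup>2) + (1 / c) * (1 / (M + t\<^sup>2)))" for t
  have bound: "\<bar>hermite_fun k t\<bar> \<le> g t" for t
  proof -
    define u where "u = c * (M + t\<^sup>2)"
    have u: "u > 0"
      using \<open>M > 0\<close> \<open>c > 0\<close> by (simp add: u_def add_pos_nonneg)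
    have "2 * (sqrt u * \<bar>hermite_fun k t\<bar>) * (1 / sqrt u) \<le> (sqrt u * \<bar>hermite_fun k t\<bar>)\<^sup>2 + (1 / sqrt u)\<^sup>2"
      by (rule sum_squares_bound)
    then have "2 * \<bar>hermite_fun k t\<bar> \<le> u * (hermite_fun k t)\<^sup>2 + 1 / u"
      using u by (simp add: power_mult_distrib power_divide)
    moreover have "u * (hermite_fun k t)\<^sup>2 = c * (M * (hermite_fun k t)\<^sup>2 + t\<^sup>2 * (hermite_fun k t)\<^sup>2)"
      "1 / u = (1 / c) * (1 / (M + t\<^sup>2))"
      by (simp_all add: u_def algebra_simps)
    moreover have "2 * g t = c * (M * (hermite_fun k t)\<^sup>2 + t\<^sup>2 * (hermite_fun k t)\<^sup>2) + (1 / c) * (1 / (M + t\<^sup>2))"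
      unfolding g_def by (rule trans[OF mult.assoc[symmetric]]) simp
    ultimately have "2 * \<bar>hermite_fun k t\<bar> \<le> 2 * g t"
      by (simp only:)
    then show ?thesis
      by simp
  qed
  have "has_bochner_integral lborel (\<lambda>t. (hermite_fun k t)\<^sup>2) 1"
    "has_bochner_integral lborel (\<lambda>t. t\<^sup>2 * (hermite_fun k t)\<^sup>2) (\<integral>t. t\<^sup>2 * (hermite_fun k t)\<^sup>2 \<partial>lborel)"
    "has_bochner_integral lborel (\<lambda>t. 1 / (M + t\<^sup>2)) (pi / sqrt M)"
    using integral_inverse_sq_scaled[OF \<open>M > 0\<close>]
    by (auto simp: has_bochner_integral_iff integral_hermite_fun_sq hermite_fun_moment)
  then have "has_bochner_integral lborel g
      (1 / 2 * (c * (M * 1 + (\<integral>t. t\<^sup>2 * (hermite_fun k t)\<^sup>2 \<partial>lborel)) + (1 / c) * (pi / sqrt M)))"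
    unfolding g_def by (intro has_bochner_integral_mult_right has_bochner_integral_add)
  then have g: "integrable lborel g"
    "(\<integral>t. g t \<partial>lborel) = 1 / 2 * (c * (M + (\<integral>t. t\<^sup>2 * (hermite_fun k t)\<^sup>2 \<partial>lborel)) + (1 / c) * (pi / sqrt M))"
    by (simp_all add: has_bochner_integral_iff)
  show int: "integrable lborel (hermite_fun k)"
    using g(1) by (rule Bochner_Integration.integrable_bound) (auto intro!: AE_I2 bound[THEN order_trans])
  have "(\<integral>t. \<bar>hermite_fun k t\<bar> \<partial>lborel) \<le> (\<integral>t. g t \<partial>lborel)"
    using int g(1) bound by (intro integral_mono) auto
  also have "\<dots> = 1 / 2 * (c * (M + (\<integral>t. t\<^sup>2 * (hermite_fun k t)\<^sup>2 \<partial>lborel)) + (1 / c) * (pi / sqrt M))"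
    by (rule g(2))
  also have "\<dots> \<le> 1 / 2 * (c * (3 * M) + (1 / c) * (4 / sqrt M))"
    using hermite_fun_moment(2)[of k] \<open>M > 0\<close> \<open>c > 0\<close> pi_less_4
    by (intro mult_left_mono add_mono divide_right_mono) (auto simp: M_def)
  also have "\<dots> = 7 / 2 * M powr (1 / 4)"
  proof -
    have "c * M = M powr (1 / 4)"
      using powr_add[of M "- 3 / 4" 1] \<open>M > 0\<close> by (simp add: c_def)
    moreover have "(1 / c) * (1 / sqrt M) = M powr (1 / 4)"
    proof -
      have "1 / c = M powr (3 / 4)" "1 / sqrt M = M powr (- 1 / 2)"
        using \<open>M > 0\<close> powr_minus_divide[of M "- 3 / 4"] powr_minus_divide[of M "1 / 2"]
        by (simp_all add: c_def powr_half_sqrt)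
      then show ?thesis
        by (simp flip: powr_add)
    qed
    moreover have "1 / 2 * (c * (3 * M) + (1 / c) * (4 / sqrt M)) = 3 / 2 * (c * M) + 2 * ((1 / c) * (1 / sqrt M))"
      by simp
    ultimately show ?thesis
      by (simp only:)
  qed
  also have "\<dots> \<le> 4 * M powr (1 / 4)"
    by simp
  finally show "(\<integral>t. \<bar>hermite_fun k t\<bar> \<partial>lborel) \<le> 4 * real (Suc k) powr (1 / 4)"
    by (simp add: M_def)
qed

section \<open>The weighted kernel of the Hermite functions\<close>

text \<open>Summation by parts as an induction: passing from w N to the smaller w (N + 1) can only
  decrease the multiple of a nonnegative partial sum.\<close>

lemma Abel_sum_lower:
  fixes w d :: "nat \<Rightarrow> real"
  assumes "\<And>n. w (Suc n) \<le> w n" "\<And>N. 0 \<le> (\<Sum>a<N. d a)"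
  shows "w N * (\<Sum>a<Suc N. d a) \<le> (\<Sum>a<Suc N. w a * d a)"
proof (induction N)
  case (Suc N)
  have "w (Suc N) * (\<Sum>a<Suc N. d a) \<le> w N * (\<Sum>a<Suc N. d a)"
    by (rule mult_right_mono[OF assms])
  with Suc show ?case
    by (simp add: algebra_simps)
qed simp

text \<open>A comparison of partial sums survives decreasing weights. This matters because h_a(x)^2
  is controlled on average over a, not term by term.\<close>

lemma Abel_sum_mono:
  fixes w u v :: "nat \<Rightarrow> real"
  assumes "\<And>n. w (Suc n) \<le> w n" "\<And>n. 0 \<le> w n" "\<And>N. (\<Sum>a<N. u a) \<le> (\<Sum>a<N. v a)"
  shows "(\<Sum>a<N. w a * u a) \<le> (\<Sum>a<N. w a * v a)"
proof (cases N)
  case (Suc M)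
  have d: "0 \<le> (\<Sum>a<N. v a - u a)" for N
    using assms(3)[of N] by (simp add: sum_subtractf)
  have "0 \<le> w M * (\<Sum>a<Suc M. v a - u a)"
    by (rule mult_nonneg_nonneg[OF assms(2) d])
  also have "\<dots> \<le> (\<Sum>a<Suc M. w a * (v a - u a))"
    by (rule Abel_sum_lower[where w = w and d = "\<lambda>a. v a - u a", OF assms(1) d])
  finally show ?thesis
    by (simp add: Suc sum_subtractf right_diff_distrib)
qed simp

definition zeta_sum :: "real \<Rightarrow> real" where
  "zeta_sum \<tau> = (\<Sum>a. real (Suc a) powr (- \<tau>))"

lemma summable_Suc_powr: "\<tau> > 1 \<Longrightarrow> summable (\<lambda>a. real (Suc a) powr (- \<tau>))"
  using summable_real_powr_iff[of "- \<tau>"] by (subst summable_Suc_iff) auto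

lemma zeta_sum_ge: "\<tau> > 1 \<Longrightarrow> (\<Sum>a<N. real (Suc a) powr (- \<tau>)) \<le> zeta_sum \<tau>"
  unfolding zeta_sum_def by (intro sum_le_suminf summable_Suc_powr) auto

lemma zeta_sum_nonneg: "\<tau> > 1 \<Longrightarrow> zeta_sum \<tau> \<ge> 0"
  using zeta_sum_ge[of \<tau> 0] by simp

text \<open>The increments \<open>v a\<close> of sqrt(2a) have as partial sums exactly the bounds
  known for h_a(x)^2, and \<open>v a\<close> is at most 2 (a + 1)^(-1/2). So h_a(x)^2 may be
  replaced by this average size, which the factor (a + 1)^(1/2) of the weight cancels.\<close>

lemma weighted_sum_hermite_fun_sq_le:
  assumes "\<tau> > 1"
  shows "(\<Sum>a<N. real (Suc a) powr (1 / 2 - \<tau>) * (hermite_fun a x)\<^sup>2) \<le> 2 * zeta_sum \<tau>"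
proof -
  define v where "v a = sqrt (2 * real (Suc a)) - sqrt (2 * real a)" for a
  have sum_v: "(\<Sum>a<N. v a) = sqrt (2 * real N)" for N
    unfolding v_def by (subst sum_lessThan_telescope) simp
  have v: "v a \<le> 2 * real (Suc a) powr (- 1 / 2)" for a
  proof -
    define p q where "p = sqrt (2 * real (Suc a))" and "q = sqrt (2 * real a)"
    have p: "p > 0" "q \<ge> 0" "p * p = 2 * real (Suc a)" "q * q = 2 * real a" "q \<le> p"
      by (simp_all add: p_def q_def)
    have "(p - q) * p \<le> (p - q) * (p + q)"
      using p by (intro mult_left_mono) auto
    also have "\<dots> = 2"
      using p by (simp add: algebra_simps)
    finally have "p - q \<le> 2 / p"
      using p(1) by (simp only: pos_le_divide_eq)
    then have "v a \<le> 2 / p"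
      by (simp only: v_def p_def q_def)
    also have "\<dots> \<le> 2 / sqrt (real (Suc a))"
      by (intro divide_left_mono) (auto simp: p_def)
    also have "\<dots> = 2 * real (Suc a) powr (- 1 / 2)"
      using powr_minus_divide[of "real (Suc a)" "1 / 2"] by (simp add: powr_half_sqrt)
    finally show ?thesis .
  qed
  have "(\<Sum>a<N. real (Suc a) powr (1 / 2 - \<tau>) * (hermite_fun a x)\<^sup>2) \<le>
      (\<Sum>a<N. real (Suc a) powr (1 / 2 - \<tau>) * v a)"
    using assms sum_hermite_fun_sq_le
    by (intro Abel_sum_mono) (auto simp: sum_v intro!: powr_mono2')
  also have "\<dots> \<le> (\<Sum>a<N. real (Suc a) powr (1 / 2 - \<tau>) * (2 * real (Suc a) powr (- 1 / 2)))"
    by (intro sum_mono mult_left_mono v) auto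
  also have "\<dots> = 2 * (\<Sum>a<N. real (Suc a) powr (- \<tau>))"
    unfolding sum_distrib_left
  proof (intro sum.cong refl)
    fix a
    have "real (Suc a) powr (1 / 2 - \<tau>) * real (Suc a) powr (- 1 / 2) = real (Suc a) powr (- \<tau>)"
      by (simp flip: powr_add)
    then show "real (Suc a) powr (1 / 2 - \<tau>) * (2 * real (Suc a) powr (- 1 / 2)) = 2 * real (Suc a) powr (- \<tau>)"
      by simp
  qed
  also have "\<dots> \<le> 2 * zeta_sum \<tau>"
    using zeta_sum_ge[OF assms] by simp
  finally show ?thesis .
qed

text \<open>Valued in \<open>ennreal\<close>, so that Tonelli and termwise integration apply before
  convergence is known.\<close>

definition hermite_kernel :: "real \<Rightarrow> real \<Rightarrow> real \<Rightarrow> ennreal" where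
  "hermite_kernel \<tau> s t = (\<Sum>a. ennreal (real (Suc a) powr (- \<tau>) * \<bar>hermite_fun a s\<bar> * \<bar>hermite_fun a t\<bar>))"

lemma hermite_kernel_commute: "hermite_kernel \<tau> s t = hermite_kernel \<tau> t s"
  by (simp add: hermite_kernel_def mult_ac)

lemma borel_measurable_hermite_kernel [measurable]:
  assumes [measurable]: "f \<in> borel_measurable M" "g \<in> borel_measurable M"
  shows "(\<lambda>x. hermite_kernel \<tau> (f x) (g x)) \<in> borel_measurable M"
  unfolding hermite_kernel_def by measurable

text \<open>The product of two values of h_a is at most half the sum of their squares, and the
  exponent -\<tau> is raised to 1/2 - \<tau> to meet the weighted sum of squares. This gives 2
  \<open>zeta_sum \<tau>\<close>; the factor 6 is that of the integral bound, so that one constant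
  serves both.\<close>

lemma hermite_kernel_le:
  assumes "\<tau> > 1"
  shows "hermite_kernel \<tau> s t \<le> ennreal (6 * zeta_sum \<tau>)"
  unfolding hermite_kernel_def
proof (rule suminf_le_const[OF summableI])
  fix N
  have "(\<Sum>a<N. real (Suc a) powr (- \<tau>) * \<bar>hermite_fun a s\<bar> * \<bar>hermite_fun a t\<bar>) \<le>
      (\<Sum>a<N. 1 / 2 * (real (Suc a) powr (1 / 2 - \<tau>) * (hermite_fun a s)\<^sup>2 + real (Suc a) powr (1 / 2 - \<tau>) * (hermite_fun a t)\<^sup>2))"
  proof (intro sum_mono)
    fix a
    have "\<bar>hermite_fun a s\<bar> * \<bar>hermite_fun a t\<bar> \<le> 1 / 2 * ((hermite_fun a s)\<^sup>2 + (hermite_fun a t)\<^sup>2)"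
      using sum_squares_bound[of "\<bar>hermite_fun a s\<bar>" "\<bar>hermite_fun a t\<bar>"] by simp
    then have "real (Suc a) powr (- \<tau>) * (\<bar>hermite_fun a s\<bar> * \<bar>hermite_fun a t\<bar>) \<le>
        real (Suc a) powr (1 / 2 - \<tau>) * (1 / 2 * ((hermite_fun a s)\<^sup>2 + (hermite_fun a t)\<^sup>2))"
      by (rule mult_mono[rotated]) (auto intro: powr_mono)
    then show "real (Suc a) powr (- \<tau>) * \<bar>hermite_fun a s\<bar> * \<bar>hermite_fun a t\<bar> \<le>
        1 / 2 * (real (Suc a) powr (1 / 2 - \<tau>) * (hermite_fun a s)\<^sup>2 + real (Suc a) powr (1 / 2 - \<tau>) * (hermite_fun a t)\<^sup>2)"
      by (simp only: mult_ac distrib_left)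
  qed
  also have "\<dots> \<le> 1 / 2 * (2 * zeta_sum \<tau> + 2 * zeta_sum \<tau>)"
    unfolding sum_distrib_left[symmetric] sum.distrib
    by (intro mult_left_mono add_mono weighted_sum_hermite_fun_sq_le assms) auto
  also have "\<dots> \<le> 6 * zeta_sum \<tau>"
    using zeta_sum_nonneg[OF assms] by simp
  finally show "(\<Sum>a<N. ennreal (real (Suc a) powr (- \<tau>) * \<bar>hermite_fun a s\<bar> * \<bar>hermite_fun a t\<bar>)) \<le> ennreal (6 * zeta_sum \<tau>)"
    by (simp add: sum_ennreal ennreal_leI)
qed

text \<open>Termwise integration leaves 4 (a + 1)^(1/4) |h_a(s)|, at most 2 (1 + (a + 1)^(1/2)
  h_a(s)^2). With the weight (a + 1)^(-\<tau>) the two parts contribute 2 and 4 times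
  \<open>zeta_sum \<tau>\<close>.\<close>

lemma nn_integral_hermite_kernel_le:
  assumes "\<tau> > 1"
  shows "(\<integral>\<^sup>+t. hermite_kernel \<tau> s t \<partial>lborel) \<le> ennreal (6 * zeta_sum \<tau>)"
proof -
  have "(\<integral>\<^sup>+t. hermite_kernel \<tau> s t \<partial>lborel) =
      (\<Sum>a. \<integral>\<^sup>+t. ennreal (real (Suc a) powr (- \<tau>) * \<bar>hermite_fun a s\<bar> * \<bar>hermite_fun a t\<bar>) \<partial>lborel)"
    unfolding hermite_kernel_def by (rule nn_integral_suminf) measurable
  also have "\<dots> \<le> ennreal (6 * zeta_sum \<tau>)"
  proof (rule suminf_le_const[OF summableI])
    fix N
    have "(\<Sum>a<N. \<integral>\<^sup>+t. ennreal (real (Suc a) powr (- \<tau>) * \<bar>hermite_fun a s\<bar> * \<bar>hermite_fun a t\<bar>) \<partial>lborel) \<le>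
        (\<Sum>a<N. ennreal (2 * (real (Suc a) powr (- \<tau>) + real (Suc a) powr (1 / 2 - \<tau>) * (hermite_fun a s)\<^sup>2)))"
    proof (intro sum_mono)
      fix a
      define A where "A = real (Suc a)"
      have A: "A > 0" by (simp add: A_def)
      have "(\<integral>\<^sup>+t. ennreal (A powr (- \<tau>) * \<bar>hermite_fun a s\<bar> * \<bar>hermite_fun a t\<bar>) \<partial>lborel) =
          ennreal (A powr (- \<tau>) * \<bar>hermite_fun a s\<bar> * (\<integral>t. \<bar>hermite_fun a t\<bar> \<partial>lborel))"
        using hermite_fun_L1(1)[of a] by (subst nn_integral_eq_integral) auto
      also have "\<dots> \<le> ennreal (A powr (- \<tau>) * \<bar>hermite_fun a s\<bar> * (4 * A powr (1 / 4)))"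
        using hermite_fun_L1(2)[of a] by (intro ennreal_leI mult_left_mono) (auto simp: A_def)
      also have "A powr (- \<tau>) * \<bar>hermite_fun a s\<bar> * (4 * A powr (1 / 4)) =
          4 * A powr (- \<tau>) * (A powr (1 / 4) * \<bar>hermite_fun a s\<bar>)"
        by (simp only: mult_ac)
      also have "ennreal \<dots> \<le> ennreal (4 * A powr (- \<tau>) * ((1 + A powr (1 / 2) * (hermite_fun a s)\<^sup>2) / 2))"
      proof (intro ennreal_leI mult_left_mono)
        have "2 * 1 * (A powr (1 / 4) * \<bar>hermite_fun a s\<bar>) \<le> 1\<^sup>2 + (A powr (1 / 4) * \<bar>hermite_fun a s\<bar>)\<^sup>2"
          by (rule sum_squares_bound)
        moreover have "(A powr (1 / 4))\<^sup>2 = A powr (1 / 2)"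
          by (simp add: power2_eq_square flip: powr_add)
        ultimately show "A powr (1 / 4) * \<bar>hermite_fun a s\<bar> \<le> (1 + A powr (1 / 2) * (hermite_fun a s)\<^sup>2) / 2"
          by (simp add: power_mult_distrib)
      qed simp
      also have "4 * A powr (- \<tau>) * ((1 + A powr (1 / 2) * (hermite_fun a s)\<^sup>2) / 2) =
          2 * (A powr (- \<tau>) + (A powr (1 / 2) * A powr (- \<tau>)) * (hermite_fun a s)\<^sup>2)"
        by (simp add: algebra_simps)
      also have "A powr (1 / 2) * A powr (- \<tau>) = A powr (1 / 2 - \<tau>)"
        by (simp flip: powr_add)
      finally show "(\<integral>\<^sup>+t. ennreal (real (Suc a) powr (- \<tau>) * \<bar>hermite_fun a s\<bar> * \<bar>hermite_fun a t\<bar>) \<partial>lborel) \<le>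
          ennreal (2 * (real (Suc a) powr (- \<tau>) + real (Suc a) powr (1 / 2 - \<tau>) * (hermite_fun a s)\<^sup>2))"
        unfolding A_def .
    qed
    also have "\<dots> = ennreal (2 * ((\<Sum>a<N. real (Suc a) powr (- \<tau>)) + (\<Sum>a<N. real (Suc a) powr (1 / 2 - \<tau>) * (hermite_fun a s)\<^sup>2)))"
      by (subst sum_ennreal) (auto simp: sum.distrib sum_distrib_left intro!: add_nonneg_nonneg)
    also have "\<dots> \<le> ennreal (2 * (zeta_sum \<tau> + 2 * zeta_sum \<tau>))"
      by (intro ennreal_leI mult_left_mono add_mono zeta_sum_ge weighted_sum_hermite_fun_sq_le assms) auto
    finally show "(\<Sum>a<N. \<integral>\<^sup>+t. ennreal (real (Suc a) powr (- \<tau>) * \<bar>hermite_fun a s\<bar> * \<bar>hermite_fun a t\<bar>) \<partial>lborel) \<le> ennreal (6 * zeta_sum \<tau>)"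
      by simp
  qed
  finally show ?thesis .
qed

section \<open>Integrals and sums of products\<close>

text \<open>An arbitrary index set for the basis, here and in
  \<open>integral_lborel_prod_axes\<close>, allows products over coordinates or over pairs of block
  and coordinate.\<close>

lemma nn_integral_lborel_prod_axes:
  fixes e :: "'i \<Rightarrow> 'a::euclidean_space" and f :: "'i \<Rightarrow> real \<Rightarrow> ennreal"
  assumes e: "bij_betw e I Basis" and [measurable]: "\<And>i. i \<in> I \<Longrightarrow> f i \<in> borel_measurable borel"
  shows "(\<integral>\<^sup>+x. (\<Prod>i\<in>I. f i (x \<bullet> e i)) \<partial>lborel) = (\<Prod>i\<in>I. \<integral>\<^sup>+t. f i t \<partial>lborel)"
proof -
  define g where "g b = f (the_inv_into I e b)" for b
  have g: "g (e i) = f i" if "i \<in> I" for i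
    using that e by (simp add: g_def the_inv_into_f_f bij_betw_def)
  have meas: "g b \<in> borel_measurable borel" if "b \<in> Basis" for b
    using that g assms(2) unfolding bij_betw_imp_surj_on[OF e, symmetric] by auto
  have "(\<Prod>i\<in>I. f i (x \<bullet> e i)) = (\<Prod>b\<in>Basis. g b (x \<bullet> b))" for x
    by (subst prod.reindex_bij_betw[OF e, symmetric]) (auto intro!: prod.cong simp: g)
  moreover have "(\<Prod>i\<in>I. \<integral>\<^sup>+t. f i t \<partial>lborel) = (\<Prod>b\<in>Basis. \<integral>\<^sup>+t. g b t \<partial>lborel)"
    by (subst prod.reindex_bij_betw[OF e, symmetric]) (auto intro!: prod.cong simp: g)
  ultimately show ?thesis
    using nn_integral_lborel_prod[of g] meas by simp
qed

text \<open>Fubini for separated variables: \<open>lborel\<close> is the image of the product of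
  one-dimensional Lebesgue measures under the coordinate map.\<close>

lemma integral_lborel_prod_Basis:
  fixes f :: "'a::euclidean_space \<Rightarrow> real \<Rightarrow> 'b::{real_normed_field,banach,second_countable_topology}"
  assumes int: "\<And>b. b \<in> Basis \<Longrightarrow> integrable lborel (f b)"
  shows "integrable lborel (\<lambda>x. \<Prod>b\<in>Basis. f b (x \<bullet> b))"
    "(\<integral>x. (\<Prod>b\<in>Basis. f b (x \<bullet> b)) \<partial>lborel) = (\<Prod>b\<in>Basis. \<integral>t. f b t \<partial>lborel)"
proof -
  interpret product_sigma_finite "\<lambda>_::'a. lborel :: real measure"
    by standard
  have meas[measurable]: "f b \<in> borel_measurable borel" if "b \<in> Basis" for b
    using borel_measurable_integrable[OF int[OF that]] by simp
  have [measurable]: "(\<lambda>f. \<Sum>b\<in>Basis. f b *\<^sub>R b) \<in> (\<Pi>\<^sub>M b\<in>Basis. lborel) \<rightarrow>\<^sub>M (borel :: 'a measure)"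
    by measurable
  show "integrable lborel (\<lambda>x. \<Prod>b\<in>Basis. f b (x \<bullet> b))"
    by (subst lborel_eq, subst integrable_distr_eq) (auto simp: int intro!: product_integrable_prod)
  show "(\<integral>x. (\<Prod>b\<in>Basis. f b (x \<bullet> b)) \<partial>lborel) = (\<Prod>b\<in>Basis. \<integral>t. f b t \<partial>lborel)"
    by (subst lborel_eq, subst integral_distr) (auto simp: int intro!: product_integral_prod)
qed

lemma integral_lborel_prod_axes:
  fixes e :: "'i \<Rightarrow> 'a::euclidean_space"
    and f :: "'i \<Rightarrow> real \<Rightarrow> 'b::{real_normed_field,banach,second_countable_topology}"
  assumes e: "bij_betw e I Basis" and int: "\<And>i. i \<in> I \<Longrightarrow> integrable lborel (f i)"
  shows "integrable lborel (\<lambda>x. \<Prod>i\<in>I. f i (x \<bullet> e i))"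
    "(\<integral>x. (\<Prod>i\<in>I. f i (x \<bullet> e i)) \<partial>lborel) = (\<Prod>i\<in>I. \<integral>t. f i t \<partial>lborel)"
proof -
  define g where "g b = f (the_inv_into I e b)" for b
  have g: "g (e i) = f i" if "i \<in> I" for i
    using that e by (simp add: g_def the_inv_into_f_f bij_betw_def)
  have int_g: "integrable lborel (g b)" if "b \<in> Basis" for b
    using that g int unfolding bij_betw_imp_surj_on[OF e, symmetric] by auto
  have eq: "(\<Prod>i\<in>I. f i (x \<bullet> e i)) = (\<Prod>b\<in>Basis. g b (x \<bullet> b))" for x
    by (subst prod.reindex_bij_betw[OF e, symmetric]) (auto intro!: prod.cong simp: g)
  have eq': "(\<Prod>i\<in>I. \<integral>t. f i t \<partial>lborel) = (\<Prod>b\<in>Basis. \<integral>t. g b t \<partial>lborel)"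
    by (subst prod.reindex_bij_betw[OF e, symmetric]) (auto intro!: prod.cong simp: g)
  show "integrable lborel (\<lambda>x. \<Prod>i\<in>I. f i (x \<bullet> e i))"
    "(\<integral>x. (\<Prod>i\<in>I. f i (x \<bullet> e i)) \<partial>lborel) = (\<Prod>i\<in>I. \<integral>t. f i t \<partial>lborel)"
    unfolding eq eq' using integral_lborel_prod_Basis[of g] int_g by auto
qed

section \<open>Coordinates of the block space and boxes of multi-indices\<close>

lemma bij_betw_axis_Basis: "bij_betw (\<lambda>j. axis j 1) UNIV (Basis :: (real ^ 'n) set)"
  by (auto simp: bij_betw_def Basis_vec_def inj_on_def axis_eq_axis)

definition axis2 :: "'k::finite \<times> 'n::finite \<Rightarrow> real ^ 'n ^ 'k" where
  "axis2 = (\<lambda>(i, j). axis i (axis j 1))"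

lemma bij_betw_axis2_Basis: "bij_betw axis2 UNIV (Basis :: (real ^ 'n ^ 'k) set)"
  by (auto simp: bij_betw_def Basis_vec_def inj_on_def axis_eq_axis axis2_def)

lemma inner_axis2 [simp]: "z \<bullet> axis2 p = z $ fst p $ snd p"
  by (simp add: axis2_def inner_axis case_prod_beta)

text \<open>Transfers boxes of vectors to spaces of functions, where finiteness and the exchange of
  sums with products are available.\<close>

lemma vec_eq_image_PiE:
  "{v :: 'a ^ 'i::finite. \<forall>i. v $ i \<in> S i} = vec_lambda ` (PiE UNIV S)"
  by (force simp: image_iff PiE_def intro!: bexI[of _ "vec_nth _"])

lemma finite_vec_Collect:
  "(\<And>i. finite (S i)) \<Longrightarrow> finite {v :: 'a ^ 'i::finite. \<forall>i. v $ i \<in> S i}"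
  unfolding vec_eq_image_PiE by (intro finite_imageI finite_PiE) auto

lemma sum_prod_vec:
  fixes F :: "'i::finite \<Rightarrow> 'a \<Rightarrow> 'b::comm_semiring_1"
  assumes "\<And>i. finite (S i)"
  shows "(\<Sum>v\<in>{v :: 'a ^ 'i. \<forall>i. v $ i \<in> S i}. \<Prod>i\<in>UNIV. F i (v $ i)) = (\<Prod>i\<in>UNIV. \<Sum>a\<in>S i. F i a)"
proof -
  have "inj_on vec_lambda (PiE UNIV S)"
    by (auto simp: inj_on_def vec_lambda_inject)
  then show ?thesis
    unfolding vec_eq_image_PiE using assms by (simp add: sum.reindex prod_sum_PiE)
qed

section \<open>Schur's test and Hoelder's inequality\<close>

text \<open>Jensen's inequality for exp at the points ln (h i).\<close>

lemma weighted_AM_GM: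
  fixes \<theta> h :: "'i \<Rightarrow> real"
  assumes "finite F" "F \<noteq> {}" "\<And>i. i \<in> F \<Longrightarrow> \<theta> i \<ge> 0" "(\<Sum>i\<in>F. \<theta> i) = 1" "\<And>i. i \<in> F \<Longrightarrow> h i \<ge> 0"
  shows "(\<Prod>i\<in>F. h i powr \<theta> i) \<le> (\<Sum>i\<in>F. \<theta> i * h i)"
proof (cases "\<exists>i\<in>F. h i = 0")
  case True
  \<comment> \<open>Since \<open>0 powr x = 0\<close> even for x = 0, one vanishing entry
    annihilates the product whatever its exponent.\<close>
  then have "(\<Prod>i\<in>F. h i powr \<theta> i) = 0"
    using assms(1) by (auto intro!: prod_zero)
  moreover have "0 \<le> (\<Sum>i\<in>F. \<theta> i * h i)"
    using assms by (intro sum_nonneg) auto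
  ultimately show ?thesis
    by (simp only:)
next
  case False
  then have pos: "h i > 0" if "i \<in> F" for i
    using assms(5) that by (simp add: order_less_le)
  have "(\<Prod>i\<in>F. h i powr \<theta> i) = exp (\<Sum>i\<in>F. \<theta> i *\<^sub>R ln (h i))"
    using pos assms(1) False by (auto simp: exp_sum powr_def intro!: prod.cong)
  also have "\<dots> \<le> (\<Sum>i\<in>F. \<theta> i * exp (ln (h i)))"
    using assms by (intro convex_on_sum[OF _ _ exp_convex]) auto
  also have "\<dots> = (\<Sum>i\<in>F. \<theta> i * h i)"
    using pos by (intro sum.cong) auto
  finally show ?thesis .
qed

text \<open>Hoelder's inequality for several factors: normalize to g i / N i, apply the inequality
  of means pointwise with weights p / q i, and integrate. \<open>F\<close> is the set of finite
  exponents; the factors outside it belong to L^\<infinity> and are removed by their uniform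
  bounds.\<close>

lemma nn_integral_prod_powr_le:
  fixes g :: "'i::finite \<Rightarrow> 'a \<Rightarrow> real" and q N :: "'i \<Rightarrow> real"
  assumes [measurable]: "\<And>i. g i \<in> borel_measurable M"
    and g: "\<And>i x. g i x \<ge> 0" and N: "\<And>i. N i > 0" and p: "p > 0"
    and q: "\<And>i. i \<in> F \<Longrightarrow> q i > 0" "(\<Sum>i\<in>F. 1 / q i) = 1 / p"
    and bound: "\<And>i. i \<in> F \<Longrightarrow> (\<integral>\<^sup>+x. ennreal (g i x powr q i) \<partial>M) \<le> ennreal (N i powr q i)"
    and bound': "\<And>i x. i \<notin> F \<Longrightarrow> g i x \<le> N i"
  shows "(\<integral>\<^sup>+x. ennreal ((\<Prod>i\<in>UNIV. g i x) powr p) \<partial>M) \<le> ennreal ((\<Prod>i\<in>UNIV. N i) powr p)"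
proof -
  define h where "h i x = (g i x / N i) powr q i" for i x
  \<comment> \<open>\<open>F\<close> is nonempty because an empty sum is 0, not 1 / p.\<close>
  have F: "finite F" "F \<noteq> {}"
    using q(2) p by auto
  have theta: "(\<Sum>i\<in>F. p / q i) = 1"
    using q(2) p by (simp add: sum_distrib_left[symmetric] divide_inverse)
  have N0: "(\<Prod>i\<in>UNIV. N i) > 0"
    using N by (simp add: prod_pos)
  have Nnz: "N i \<noteq> 0" for i
    using N[of i] by simp
  have pw: "(\<Prod>i\<in>UNIV. g i x) powr p \<le> (\<Prod>i\<in>UNIV. N i) powr p * (\<Sum>i\<in>F. p / q i * h i x)" for x
  proof -
    have gN: "0 \<le> g i x / N i" for i
      using g[of i x] N[of i] by simp
    have "(\<Prod>i\<in>UNIV. g i x) = (\<Prod>i\<in>UNIV. N i) * (\<Prod>i\<in>UNIV. g i x / N i)"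
      using Nnz by (simp add: prod_dividef)
    also have "(\<Prod>i\<in>UNIV. g i x / N i) = (\<Prod>i\<in>F. g i x / N i) * (\<Prod>i\<in>-F. g i x / N i)"
      by (subst prod.union_disjoint[symmetric]) (auto intro: prod.cong)
    also have "(\<Prod>i\<in>UNIV. N i) * ((\<Prod>i\<in>F. g i x / N i) * (\<Prod>i\<in>-F. g i x / N i)) \<le>
        (\<Prod>i\<in>UNIV. N i) * ((\<Prod>i\<in>F. g i x / N i) * 1)"
      using N0 gN bound' N by (intro mult_left_mono prod_le_1 prod_nonneg conjI) (auto simp: less_imp_le)
    finally have "(\<Prod>i\<in>UNIV. g i x) \<le> (\<Prod>i\<in>UNIV. N i) * (\<Prod>i\<in>F. g i x / N i)"
      by simp
    then have "(\<Prod>i\<in>UNIV. g i x) powr p \<le> ((\<Prod>i\<in>UNIV. N i) * (\<Prod>i\<in>F. g i x / N i)) powr p"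
      using g p by (intro powr_mono2 prod_nonneg) auto
    also have "\<dots> = (\<Prod>i\<in>UNIV. N i) powr p * (\<Prod>i\<in>F. g i x / N i) powr p"
      by (rule powr_mult)
    also have "\<dots> \<le> (\<Prod>i\<in>UNIV. N i) powr p * (\<Sum>i\<in>F. p / q i * h i x)"
    proof (rule mult_left_mono)
      have "(\<Prod>i\<in>F. g i x / N i) powr p = (\<Prod>i\<in>F. (g i x / N i) powr p)"
        by (rule prod_powr_distrib)
      also have "\<dots> = (\<Prod>i\<in>F. h i x powr (p / q i))"
      proof (rule prod.cong[OF refl])
        fix i assume "i \<in> F"
        then show "(g i x / N i) powr p = h i x powr (p / q i)"
          using q(1)[of i] by (simp add: h_def powr_powr)
      qed
      also have "\<dots> \<le> (\<Sum>i\<in>F. p / q i * h i x)"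
        using p q(1) by (intro weighted_AM_GM F theta) (auto simp: h_def less_imp_le)
      finally show "(\<Prod>i\<in>F. g i x / N i) powr p \<le> (\<Sum>i\<in>F. p / q i * h i x)" .
    qed simp
    finally show ?thesis .
  qed
  have int_h: "(\<integral>\<^sup>+x. ennreal (h i x) \<partial>M) \<le> 1" if "i \<in> F" for i
  proof -
    have Npos: "N i powr q i > 0"
      using N[of i] by simp
    have "(\<integral>\<^sup>+x. ennreal (h i x) \<partial>M) = (\<integral>\<^sup>+x. ennreal (1 / N i powr q i) * ennreal (g i x powr q i) \<partial>M)"
      using N g by (simp add: h_def powr_divide less_imp_le flip: ennreal_mult)
    also have "\<dots> = ennreal (1 / N i powr q i) * (\<integral>\<^sup>+x. ennreal (g i x powr q i) \<partial>M)"
      by (rule nn_integral_cmult) measurable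
    also have "\<dots> \<le> ennreal (1 / N i powr q i) * ennreal (N i powr q i)"
      by (rule mult_left_mono[OF bound[OF that]]) simp
    also have "\<dots> = 1"
      using Npos by (simp flip: ennreal_mult)
    finally show ?thesis .
  qed
  have "(\<integral>\<^sup>+x. ennreal ((\<Prod>i\<in>UNIV. g i x) powr p) \<partial>M) \<le>
      (\<integral>\<^sup>+x. ennreal ((\<Prod>i\<in>UNIV. N i) powr p) * (\<Sum>i\<in>F. ennreal (p / q i) * ennreal (h i x)) \<partial>M)"
  proof (rule nn_integral_mono)
    fix x
    have "(\<Sum>i\<in>F. ennreal (p / q i) * ennreal (h i x)) = ennreal (\<Sum>i\<in>F. p / q i * h i x)"
    proof (subst sum_ennreal[symmetric])
      show "0 \<le> p / q i * h i x" if "i \<in> F" for i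
        using p q(1)[OF that] by (simp add: h_def)
      show "(\<Sum>i\<in>F. ennreal (p / q i) * ennreal (h i x)) = (\<Sum>i\<in>F. ennreal (p / q i * h i x))"
        using p q(1) by (intro sum.cong refl ennreal_mult[symmetric]) (auto simp: h_def less_imp_le)
    qed
    then show "ennreal ((\<Prod>i\<in>UNIV. g i x) powr p) \<le>
        ennreal ((\<Prod>i\<in>UNIV. N i) powr p) * (\<Sum>i\<in>F. ennreal (p / q i) * ennreal (h i x))"
      using pw[of x] by (simp add: ennreal_leI flip: ennreal_mult')
  qed
  also have "\<dots> = ennreal ((\<Prod>i\<in>UNIV. N i) powr p) * (\<Sum>i\<in>F. ennreal (p / q i) * (\<integral>\<^sup>+x. ennreal (h i x) \<partial>M))"
    by (simp add: nn_integral_cmult nn_integral_sum h_def)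
  also have "\<dots> \<le> ennreal ((\<Prod>i\<in>UNIV. N i) powr p) * (\<Sum>i\<in>F. ennreal (p / q i) * 1)"
    by (intro mult_left_mono sum_mono int_h) auto
  also have "(\<Sum>i\<in>F. ennreal (p / q i) * 1) = 1"
    using p q(1) by (simp add: sum_ennreal theta less_imp_le)
  finally show ?thesis
    by simp
qed

text \<open>The q-th power is reached by a pointwise splitting: f \<le> c + c^(1 - q) f^q gives G
  \<le> c A + c^(1 - q) H, where G and H are the images of f and f^q. The level c is chosen for each
  x so that both terms agree. This costs the factor 2 and bounds G^q by a multiple of H, to which
  Tonelli and the column bound apply.\<close>

lemma Schur_test:
  fixes K :: "'a \<Rightarrow> 'a \<Rightarrow> ennreal" and f :: "'a \<Rightarrow> real"
  assumes "sigma_finite_measure M"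
  assumes [measurable]: "(\<lambda>(x, y). K x y) \<in> borel_measurable (M \<Otimes>\<^sub>M M)" "f \<in> borel_measurable M"
    and f: "\<And>y. f y \<ge> 0" and A: "A > 0" and q: "q \<ge> 1"
    and K1: "\<And>x. (\<integral>\<^sup>+y. K x y \<partial>M) \<le> ennreal A" and K2: "\<And>y. (\<integral>\<^sup>+x. K x y \<partial>M) \<le> ennreal A"
  shows "(\<integral>\<^sup>+x. ennreal (enn2real (\<integral>\<^sup>+y. ennreal (f y) * K x y \<partial>M) powr q) \<partial>M)
      \<le> ennreal ((2 * A) powr q) * (\<integral>\<^sup>+y. ennreal (f y powr q) \<partial>M)"
proof -
  interpret sigma_finite_measure M by fact
  interpret pair_sigma_finite M M ..
  have [measurable]: "K x \<in> borel_measurable M" if "x \<in> space M" for x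
    using measurable_compose_Pair1[OF that assms(2)] by simp
  define G H where "G x = (\<integral>\<^sup>+y. ennreal (f y) * K x y \<partial>M)"
    and "H x = (\<integral>\<^sup>+y. ennreal (f y powr q) * K x y \<partial>M)" for x
  have [measurable]: "H \<in> borel_measurable M"
    unfolding H_def by measurable
  have GH: "G x \<le> ennreal (c * A) + ennreal (c powr (1 - q)) * H x" if "c > 0" "x \<in> space M" for c x
  proof -
    have "f y \<le> c + c powr (1 - q) * f y powr q" for y
    proof (cases "f y \<le> c")
      case False
      then have "f y = f y powr (1 - q) * f y powr q"
        using \<open>c > 0\<close> by (simp flip: powr_add)
      also have "\<dots> \<le> c powr (1 - q) * f y powr q"
        using False \<open>c > 0\<close> q by (intro mult_right_mono powr_mono2') auto
      finally show ?thesis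
        using \<open>c > 0\<close> by simp
    qed (simp add: add_increasing2)
    then have "ennreal (f y) \<le> ennreal c + ennreal (c powr (1 - q)) * ennreal (f y powr q)" for y
      using \<open>c > 0\<close> by (simp add: ennreal_leI flip: ennreal_mult ennreal_plus)
    then have "G x \<le> (\<integral>\<^sup>+y. (ennreal c + ennreal (c powr (1 - q)) * ennreal (f y powr q)) * K x y \<partial>M)"
      unfolding G_def by (intro nn_integral_mono mult_right_mono) auto
    also have "\<dots> = ennreal c * (\<integral>\<^sup>+y. K x y \<partial>M) + ennreal (c powr (1 - q)) * H x"
      unfolding H_def using that by (simp add: distrib_right nn_integral_add nn_integral_cmult mult.assoc)
    also have "\<dots> \<le> ennreal c * ennreal A + ennreal (c powr (1 - q)) * H x"
      by (intro add_mono mult_left_mono K1) auto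
    finally show ?thesis
      using \<open>c > 0\<close> A by (simp add: ennreal_mult)
  qed
  have pw: "ennreal (enn2real (G x) powr q) \<le> ennreal ((2 * A) powr q / A) * H x" if x: "x \<in> space M" for x
  proof (cases "H x")
    case top
    then show ?thesis
      using A by (simp add: ennreal_mult_top)
  next
    case (real h)
    show ?thesis
    proof (cases "h = 0")
      case True
      \<comment> \<open>There is no balancing level when h = 0; the levels \<epsilon> / A with
        arbitrary \<epsilon> > 0 force G x to vanish.\<close>
      have "G x \<le> 0"
      proof (rule ennreal_le_epsilon)
        fix \<epsilon> :: real assume "\<epsilon> > 0"
        then show "G x \<le> 0 + ennreal \<epsilon>"
          using GH[of "\<epsilon> / A" x] A x real True by simp
      qed
      then show ?thesis
        by simp
    next
      case False
      then have h: "h > 0"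
        using real by simp
      \<comment> \<open>The level at which c A = c^(1 - q) h.\<close>
      define c where "c = (h / A) powr (1 / q)"
      have c: "c > 0" "c powr q = h / A"
        using h A q by (auto simp: c_def powr_powr)
      have "c powr (1 - q) * h = c powr (1 - q) * (A * c powr q)"
        using c A by simp
      also have "\<dots> = A * (c powr (1 - q) * c powr q)"
        by simp
      also have "\<dots> = c * A"
        using c(1) by (simp flip: powr_add)
      finally have ch: "c powr (1 - q) * h = c * A" .
      have "G x \<le> ennreal (c * A) + ennreal (c powr (1 - q)) * H x"
        by (rule GH[OF c(1) x])
      also have "\<dots> = ennreal (2 * A * c)"
        using ch c(1) A h real by (simp flip: ennreal_mult ennreal_plus)
      finally have "enn2real (G x) \<le> 2 * A * c"
        using A c(1) by (intro enn2real_leI) auto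
      then have "enn2real (G x) powr q \<le> (2 * A * c) powr q"
        using q by (intro powr_mono2) auto
      also have "\<dots> = (2 * A) powr q / A * h"
        using A c by (simp add: powr_mult)
      finally show ?thesis
        using real A by (simp add: ennreal_leI flip: ennreal_mult)
    qed
  qed
  have "(\<integral>\<^sup>+x. ennreal (enn2real (G x) powr q) \<partial>M) \<le> (\<integral>\<^sup>+x. ennreal ((2 * A) powr q / A) * H x \<partial>M)"
    by (intro nn_integral_mono pw)
  also have "\<dots> = ennreal ((2 * A) powr q / A) * (\<integral>\<^sup>+x. H x \<partial>M)"
    by (rule nn_integral_cmult) measurable
  also have "(\<integral>\<^sup>+x. H x \<partial>M) = (\<integral>\<^sup>+y. \<integral>\<^sup>+x. ennreal (f y powr q) * K x y \<partial>M \<partial>M)"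
    unfolding H_def by (rule Fubini') measurable
  also have "\<dots> = (\<integral>\<^sup>+y. ennreal (f y powr q) * (\<integral>\<^sup>+x. K x y \<partial>M) \<partial>M)"
    by (intro nn_integral_cong nn_integral_cmult) measurable
  also have "\<dots> \<le> (\<integral>\<^sup>+y. ennreal (f y powr q) * ennreal A \<partial>M)"
    by (intro nn_integral_mono mult_left_mono K2) auto
  also have "\<dots> = (\<integral>\<^sup>+y. ennreal (f y powr q) \<partial>M) * ennreal A"
    by (rule nn_integral_multc) measurable
  finally have "(\<integral>\<^sup>+x. ennreal (enn2real (G x) powr q) \<partial>M) \<le>
      ennreal ((2 * A) powr q / A) * ((\<integral>\<^sup>+y. ennreal (f y powr q) \<partial>M) * ennreal A)"
    by (simp add: mult_left_mono)
  also have "\<dots> = (ennreal ((2 * A) powr q / A) * ennreal A) * (\<integral>\<^sup>+y. ennreal (f y powr q) \<partial>M)"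
    by (simp only: mult_ac)
  also have "ennreal ((2 * A) powr q / A) * ennreal A = ennreal ((2 * A) powr q)"
    using A by (simp flip: ennreal_mult)
  finally show ?thesis
    unfolding G_def .
qed

section \<open>Decay of the symbol\<close>

lemma Lp_norm_leI:
  assumes "q > 0" "N \<ge> 0" "(\<integral>\<^sup>+x. ennreal (norm (f x) powr q) \<partial>lebesgue) \<le> ennreal (N powr q)"
  shows "Lp_norm (ennreal q) f \<le> ennreal N"
proof -
  define I where "I = (\<integral>\<^sup>+x. ennreal (norm (f x) powr q) \<partial>lebesgue)"
  have I: "I \<le> ennreal (N powr q)" "I < \<infinity>"
    using assms(3) by (auto simp: I_def intro: le_less_trans)
  have "enn2real I powr (1 / q) \<le> (N powr q) powr (1 / q)"
    using I assms by (intro powr_mono2 enn2real_leI) auto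
  also have "\<dots> = N"
    using assms by (simp add: powr_powr)
  finally have "enn2real I powr (1 / q) \<le> N" .
  then show ?thesis
    using assms less_imp_neq[OF I(2)] by (simp add: Lp_norm_def I_def[symmetric] ennreal_leI Let_def)
qed

lemma Lp_norm_finiteD:
  assumes "q > 0" "Lp_norm (ennreal q) f < \<infinity>"
  shows "(\<integral>\<^sup>+x. ennreal (norm (f x) powr q) \<partial>lebesgue) = ennreal (enn2real (Lp_norm (ennreal q) f) powr q)"
proof -
  define I where "I = (\<integral>\<^sup>+x. ennreal (norm (f x) powr q) \<partial>lebesgue)"
  have norm_eq: "Lp_norm (ennreal q) f = (if I = \<infinity> then \<infinity> else ennreal (enn2real I powr (1 / q)))"
    using assms(1) by (simp add: Lp_norm_def I_def Let_def)
  then have I: "I \<noteq> \<infinity>"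
    using assms(2) by auto
  then have "enn2real (Lp_norm (ennreal q) f) powr q = enn2real I"
    using assms(1) by (simp add: norm_eq powr_powr)
  then show ?thesis
    using I by (simp add: I_def[symmetric] less_top)
qed

section \<open>Parseval bound for localized Hermite expansions\<close>

lemma hermite_fun_block_eq:
  "hermite_fun_block \<nu> z = (\<Prod>p\<in>UNIV. hermite_fun (\<nu> $ fst p $ snd p) (z \<bullet> axis2 p))"
proof -
  have "hermite_fun_block \<nu> z = (\<Prod>i\<in>UNIV. \<Prod>j\<in>UNIV. hermite_fun (\<nu> $ i $ j) (z \<bullet> axis2 (i, j)))"
    by (simp add: hermite_fun_block_def hermite_fun_vec_def)
  also have "\<dots> = (\<Prod>p\<in>UNIV \<times> UNIV. hermite_fun (\<nu> $ fst p $ snd p) (z \<bullet> axis2 p))"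
    by (subst prod.cartesian_product) (simp add: case_prod_beta)
  finally show ?thesis
    by simp
qed

lemma hermite_fun_block_orthonormal:
  fixes \<nu> \<nu>' :: "nat ^ 'n ^ 'k"
  shows "integrable lborel (\<lambda>z. hermite_fun_block \<nu> z * hermite_fun_block \<nu>' z)"
    "(\<integral>z. hermite_fun_block \<nu> z * hermite_fun_block \<nu>' z \<partial>lborel) = (if \<nu> = \<nu>' then 1 else 0)"
proof -
  define f :: "'k \<times> 'n \<Rightarrow> real \<Rightarrow> real"
    where "f p t = hermite_fun (\<nu> $ fst p $ snd p) t * hermite_fun (\<nu>' $ fst p $ snd p) t" for p t
  have eq: "hermite_fun_block \<nu> z * hermite_fun_block \<nu>' z = (\<Prod>p\<in>UNIV. f p (z \<bullet> axis2 p))" for z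
    by (simp add: hermite_fun_block_eq f_def prod.distrib)
  have int: "integrable lborel (f p)" for p
    unfolding f_def by (rule integrable_hermite_fun_prod)
  show "integrable lborel (\<lambda>z. hermite_fun_block \<nu> z * hermite_fun_block \<nu>' z)"
    unfolding eq by (rule integral_lborel_prod_axes[OF bij_betw_axis2_Basis int])
  have "(\<integral>z. hermite_fun_block \<nu> z * hermite_fun_block \<nu>' z \<partial>lborel) = (\<Prod>p\<in>UNIV. \<integral>t. f p t \<partial>lborel)"
    unfolding eq by (rule integral_lborel_prod_axes[OF bij_betw_axis2_Basis int])
  also have "\<dots> = (\<Prod>p\<in>UNIV. if \<nu> $ fst p $ snd p = \<nu>' $ fst p $ snd p then 1 else 0)"
    by (simp only: f_def hermite_fun_orthonormal)
  also have "\<dots> = (if \<nu> = \<nu>' then 1 else 0)"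
    by (auto simp: vec_eq_iff)
  finally show "(\<integral>z. hermite_fun_block \<nu> z * hermite_fun_block \<nu>' z \<partial>lborel) = (if \<nu> = \<nu>' then 1 else 0)" .
qed

text \<open>Parseval: the square is expanded into a double sum, of which orthonormality keeps the
  diagonal.\<close>

lemma nn_integral_hermite_sum_sq:
  fixes u :: "nat ^ 'n ^ 'k \<Rightarrow> complex"
  assumes "finite S"
  shows "(\<integral>\<^sup>+z. ennreal ((norm (\<Sum>\<nu>\<in>S. u \<nu> * of_real (hermite_fun_block \<nu> z)))\<^sup>2) \<partial>lborel)
    = ennreal (\<Sum>\<nu>\<in>S. (norm (u \<nu>))\<^sup>2)"
proof -
  define F where "F z = (\<Sum>\<nu>\<in>S. u \<nu> * of_real (hermite_fun_block \<nu> z))" for z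
  have sq: "complex_of_real ((norm (F z))\<^sup>2) =
      (\<Sum>\<nu>\<in>S. \<Sum>\<nu>'\<in>S. (u \<nu> * cnj (u \<nu>')) * of_real (hermite_fun_block \<nu> z * hermite_fun_block \<nu>' z))" for z
    unfolding F_def complex_norm_square cnj_sum sum_product
    by (intro sum.cong refl) (simp add: mult_ac)
  have hb: "has_bochner_integral lborel
      (\<lambda>z. complex_of_real (hermite_fun_block \<nu> z * hermite_fun_block \<nu>' z)) (of_real (if \<nu> = \<nu>' then 1 else 0))"
    for \<nu> \<nu>' :: "nat ^ 'n ^ 'k"
    using hermite_fun_block_orthonormal[of \<nu> \<nu>']
    by (intro has_bochner_integral_of_real) (simp add: has_bochner_integral_iff)
  have "has_bochner_integral lborel (\<lambda>z. complex_of_real ((norm (F z))\<^sup>2))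
      (\<Sum>\<nu>\<in>S. \<Sum>\<nu>'\<in>S. (u \<nu> * cnj (u \<nu>')) * of_real (if \<nu> = \<nu>' then 1 else 0))"
    unfolding sq by (intro has_bochner_integral_sum has_bochner_integral_mult_right hb)
  also have "(\<Sum>\<nu>\<in>S. \<Sum>\<nu>'\<in>S. (u \<nu> * cnj (u \<nu>')) * of_real (if \<nu> = \<nu>' then 1 else 0)) =
      of_real (\<Sum>\<nu>\<in>S. (norm (u \<nu>))\<^sup>2)"
    unfolding of_real_sum complex_norm_square using assms by (simp add: if_distrib cong: if_cong)
  finally have "has_bochner_integral lborel (\<lambda>z. Re (complex_of_real ((norm (F z))\<^sup>2))) (Re (of_real (\<Sum>\<nu>\<in>S. (norm (u \<nu>))\<^sup>2)))"
    by (rule has_bochner_integral_Re)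
  then have hbR: "integrable lborel (\<lambda>z. (norm (F z))\<^sup>2)" "(\<integral>z. (norm (F z))\<^sup>2 \<partial>lborel) = (\<Sum>\<nu>\<in>S. (norm (u \<nu>))\<^sup>2)"
    by (simp_all add: has_bochner_integral_iff)
  show ?thesis
    unfolding F_def[symmetric] using hbR by (subst nn_integral_eq_integral) auto
qed

lemma sq_weight:
  "(norm (complex_of_real (sqrt (1 + (norm z)\<^sup>2) powr s) * w))\<^sup>2 = (1 + (norm z)\<^sup>2) powr s * (norm w)\<^sup>2"
proof -
  have "(sqrt (1 + (norm z)\<^sup>2) powr s)\<^sup>2 = (sqrt (1 + (norm z)\<^sup>2) * sqrt (1 + (norm z)\<^sup>2)) powr s"
    by (simp only: power2_eq_square powr_mult)
  also have "\<dots> = (1 + (norm z)\<^sup>2) powr s"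
    by (simp add: add_nonneg_nonneg)
  finally have "(sqrt (1 + (norm z)\<^sup>2) powr s)\<^sup>2 = (1 + (norm z)\<^sup>2) powr s" .
  then show ?thesis
    by (simp add: norm_mult power_mult_distrib)
qed

lemma weighted_L2_norm_finiteD:
  assumes "weighted_L2_norm s F \<le> ennreal N" "N \<ge> 0"
  shows "(\<integral>\<^sup>+z. ennreal ((1 + (norm z)\<^sup>2) powr s * (norm (F z))\<^sup>2) \<partial>lborel) \<le> ennreal (N\<^sup>2)"
proof -
  define G where "G z = complex_of_real (sqrt (1 + (norm z)\<^sup>2) powr s) * F z" for z
  have L: "Lp_norm (ennreal 2) G \<le> ennreal N"
    using assms(1) by (simp add: weighted_L2_norm_def G_def[abs_def])
  then have "Lp_norm (ennreal 2) G < \<infinity>"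
    by (rule le_less_trans) simp
  from Lp_norm_finiteD[OF _ this]
  have "(\<integral>\<^sup>+z. ennreal (norm (G z) powr 2) \<partial>lborel) = ennreal (enn2real (Lp_norm (ennreal 2) G) powr 2)"
    by (simp add: nn_integral_completion)
  also have "\<dots> \<le> ennreal (N powr 2)"
    using L assms(2) by (intro ennreal_leI powr_mono2 enn2real_leI) auto
  finally show ?thesis
    using assms(2) by (simp add: G_def sq_weight)
qed

text \<open>One coefficient is at most the l^2 norm of all of them, which by Parseval is the L^2
  norm of the expansion; the weight only increases it since s \<ge> 0. Finite support, later
  provided by the dyadic cut-off, makes the expansion a finite sum.\<close>

lemma hermite_symbol_le:
  fixes u :: "nat ^ 'n ^ 'k \<Rightarrow> complex"
  assumes "finite {\<nu>. u \<nu> \<noteq> 0}" "s \<ge> 0" "N \<ge> 0"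
    and "weighted_L2_norm s (inverse_hermite_transform u) \<le> ennreal N"
  shows "norm (u \<nu>) \<le> N"
proof (cases "u \<nu> = 0")
  case True
  then show ?thesis
    using assms by simp
next
  case False
  define S where "S = {\<nu>. u \<nu> \<noteq> 0}"
  have F: "inverse_hermite_transform u z = (\<Sum>\<nu>\<in>S. u \<nu> * of_real (hermite_fun_block \<nu> z))" for z
  proof -
    have "inverse_hermite_transform u z = (\<Sum>\<^sub>\<infinity>\<nu>\<in>S. u \<nu> * of_real (hermite_fun_block \<nu> z))"
      unfolding inverse_hermite_transform_def S_def by (rule infsum_cong_neutral) auto
    then show ?thesis
      using assms(1) by (simp add: S_def)
  qed
  have "ennreal ((norm (u \<nu>))\<^sup>2) \<le> ennreal (\<Sum>\<nu>\<in>S. (norm (u \<nu>))\<^sup>2)"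
    using False assms(1) by (intro ennreal_leI member_le_sum) (auto simp: S_def)
  also have "\<dots> = (\<integral>\<^sup>+z. ennreal ((norm (inverse_hermite_transform u z))\<^sup>2) \<partial>lborel)"
    unfolding F using assms(1) by (intro nn_integral_hermite_sum_sq[symmetric]) (simp add: S_def)
  also have "\<dots> \<le> (\<integral>\<^sup>+z. ennreal ((1 + (norm z)\<^sup>2) powr s * (norm (inverse_hermite_transform u z))\<^sup>2) \<partial>lborel)"
  proof (intro nn_integral_mono ennreal_leI)
    fix z :: "real ^ 'n ^ 'k"
    have "1 \<le> (1 + (norm z)\<^sup>2) powr s"
      using assms(2) by (intro ge_one_powr_ge_zero) auto
    then show "(norm (inverse_hermite_transform u z))\<^sup>2 \<le> (1 + (norm z)\<^sup>2) powr s * (norm (inverse_hermite_transform u z))\<^sup>2"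
      by (simp add: mult_le_cancel_right1)
  qed
  also have "\<dots> \<le> ennreal (N\<^sup>2)"
    by (rule weighted_L2_norm_finiteD[OF assms(4,3)])
  finally have "(norm (u \<nu>))\<^sup>2 \<le> N\<^sup>2"
    by (simp only: ennreal_le_iff zero_le_power2)
  then show ?thesis
    using assms(3) by (rule power2_le_imp_le)
qed

section \<open>Fourier inversion through Gaussian means and the Sobolev bound\<close>

lemma exp_norm_sq_eq_prod:
  fixes z :: "'a::euclidean_space"
  shows "exp (c * (norm z)\<^sup>2) = (\<Prod>b\<in>Basis. exp (c * (z \<bullet> b)\<^sup>2))"
proof -
  have "(norm z)\<^sup>2 = (\<Sum>b\<in>Basis. (z \<bullet> b)\<^sup>2)"
    unfolding power2_norm_eq_inner by (subst euclidean_inner) (simp add: power2_eq_square)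
  then show ?thesis
    by (simp add: sum_distrib_left exp_sum)
qed

lemma cis_inner_eq_prod:
  fixes z a :: "'a::euclidean_space"
  shows "cis (c * (z \<bullet> a)) = (\<Prod>b\<in>Basis. cis (c * (a \<bullet> b) * (z \<bullet> b)))"
proof -
  have "c * (z \<bullet> a) = (\<Sum>b\<in>Basis. c * (a \<bullet> b) * (z \<bullet> b))"
    by (subst euclidean_inner) (simp add: sum_distrib_left mult_ac)
  then show ?thesis
    by (simp add: cis_conv_exp exp_sum sum_distrib_left)
qed

lemma gauss_integral_euclidean:
  fixes c :: real
  assumes "c > 0"
  shows "integrable lborel (\<lambda>z::'a::euclidean_space. exp (- c * (norm z)\<^sup>2))"
    "(\<integral>z. exp (- c * (norm z)\<^sup>2) \<partial>(lborel :: 'a measure)) = sqrt (pi / c) ^ DIM('a)"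
  unfolding exp_norm_sq_eq_prod
  using integral_lborel_prod_Basis[of "\<lambda>_ t. exp (- c * t\<^sup>2)"] gauss_integral[OF assms] by simp_all

text \<open>A rescaling of the characteristic function of the standard normal law.\<close>

lemma fourier_gauss_real:
  fixes \<epsilon> a :: real
  assumes "\<epsilon> > 0"
  shows "integrable lborel (\<lambda>z. cis (2 * pi * a * z) * complex_of_real (exp (- (pi * \<epsilon>\<^sup>2) * z\<^sup>2)))"
    "(\<integral>z. cis (2 * pi * a * z) * complex_of_real (exp (- (pi * \<epsilon>\<^sup>2) * z\<^sup>2)) \<partial>lborel)
      = complex_of_real (exp (- (pi * a\<^sup>2 / \<epsilon>\<^sup>2)) / \<epsilon>)"
proof -
  show "integrable lborel (\<lambda>z. cis (2 * pi * a * z) * complex_of_real (exp (- (pi * \<epsilon>\<^sup>2) * z\<^sup>2)))"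
    using assms gauss_integral(1)[of "pi * \<epsilon>\<^sup>2"]
    by (rule_tac Bochner_Integration.integrable_bound[of _ "\<lambda>z. exp (- (pi * \<epsilon>\<^sup>2) * z\<^sup>2)"])
       (auto simp: norm_mult cis_conv_exp)
  \<comment> \<open>Chosen so that the substitution x = r z turns t x into 2 pi a z and x^2 / 2 into
    pi \<epsilon>^2 z^2.\<close>
  define t r where "t = sqrt (2 * pi) * a / \<epsilon>" and "r = sqrt (2 * pi) * \<epsilon>"
  have r: "r > 0"
    using assms by (simp add: r_def)
  have "complex_of_real (exp (- t\<^sup>2 / 2)) = (\<integral>x. std_normal_density x *\<^sub>R iexp (t * x) \<partial>lborel)"
    using char_std_normal_distribution
    by (simp add: fun_eq_iff char_def integral_density)
  also have "\<dots> = \<bar>r\<bar> *\<^sub>R (\<integral>z. std_normal_density (0 + r * z) *\<^sub>R iexp (t * (0 + r * z)) \<partial>lborel)"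
    using r by (intro lborel_integral_real_affine) simp
  also have "(\<lambda>z. std_normal_density (0 + r * z) *\<^sub>R iexp (t * (0 + r * z))) =
      (\<lambda>z. complex_of_real (1 / sqrt (2 * pi)) * (cis (2 * pi * a * z) * complex_of_real (exp (- (pi * \<epsilon>\<^sup>2) * z\<^sup>2))))"
  proof
    fix z
    have "t * (0 + r * z) = 2 * pi * a * z"
      using assms by (simp add: t_def r_def)
    moreover have "std_normal_density (0 + r * z) = 1 / sqrt (2 * pi) * exp (- (pi * \<epsilon>\<^sup>2) * z\<^sup>2)"
      by (simp add: normal_density_def r_def power_mult_distrib)
    ultimately show "std_normal_density (0 + r * z) *\<^sub>R iexp (t * (0 + r * z)) =
        complex_of_real (1 / sqrt (2 * pi)) * (cis (2 * pi * a * z) * complex_of_real (exp (- (pi * \<epsilon>\<^sup>2) * z\<^sup>2)))"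
      by (simp only: cis_conv_exp scaleR_conv_of_real of_real_mult mult_ac)
  qed
  finally have "complex_of_real (exp (- t\<^sup>2 / 2)) = \<bar>r\<bar> *\<^sub>R (complex_of_real (1 / sqrt (2 * pi)) *
      (\<integral>z. cis (2 * pi * a * z) * complex_of_real (exp (- (pi * \<epsilon>\<^sup>2) * z\<^sup>2)) \<partial>lborel))"
    by (simp only: integral_mult_right_zero)
  also have "\<dots> = complex_of_real (\<bar>r\<bar> * (1 / sqrt (2 * pi))) *
      (\<integral>z. cis (2 * pi * a * z) * complex_of_real (exp (- (pi * \<epsilon>\<^sup>2) * z\<^sup>2)) \<partial>lborel)"
    by (simp only: scaleR_conv_of_real of_real_mult mult.assoc)
  also have "\<bar>r\<bar> * (1 / sqrt (2 * pi)) = \<epsilon>"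
    using r assms by (simp add: r_def abs_mult)
  also have "- t\<^sup>2 / 2 = - (pi * a\<^sup>2 / \<epsilon>\<^sup>2)"
    by (simp add: t_def power_mult_distrib power_divide)
  finally have E: "complex_of_real (exp (- (pi * a\<^sup>2 / \<epsilon>\<^sup>2))) = complex_of_real \<epsilon> *
      (\<integral>z. cis (2 * pi * a * z) * complex_of_real (exp (- (pi * \<epsilon>\<^sup>2) * z\<^sup>2)) \<partial>lborel)" .
  show "(\<integral>z. cis (2 * pi * a * z) * complex_of_real (exp (- (pi * \<epsilon>\<^sup>2) * z\<^sup>2)) \<partial>lborel)
      = complex_of_real (exp (- (pi * a\<^sup>2 / \<epsilon>\<^sup>2)) / \<epsilon>)"
    unfolding of_real_divide E using assms by (intro nonzero_mult_div_cancel_left[symmetric]) simp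
qed

lemma fourier_gauss:
  fixes a :: "'a::euclidean_space"
  assumes "\<epsilon> > 0"
  shows "(\<integral>z. cis (2 * pi * (z \<bullet> a)) * complex_of_real (exp (- (pi * \<epsilon>\<^sup>2) * (norm z)\<^sup>2)) \<partial>lborel)
      = complex_of_real (exp (- (pi / \<epsilon>\<^sup>2) * (norm a)\<^sup>2) / \<epsilon> ^ DIM('a))"
proof -
  have "(\<integral>z. cis (2 * pi * (z \<bullet> a)) * complex_of_real (exp (- (pi * \<epsilon>\<^sup>2) * (norm z)\<^sup>2)) \<partial>lborel) =
      (\<integral>z. (\<Prod>b\<in>Basis. cis (2 * pi * (a \<bullet> b) * (z \<bullet> b)) * complex_of_real (exp (- (pi * \<epsilon>\<^sup>2) * (z \<bullet> b)\<^sup>2))) \<partial>lborel)"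
    unfolding exp_norm_sq_eq_prod of_real_prod prod.distrib cis_inner_eq_prod[symmetric] ..
  also have "\<dots> = (\<Prod>b\<in>Basis. complex_of_real (exp (- (pi * (a \<bullet> b)\<^sup>2 / \<epsilon>\<^sup>2)) / \<epsilon>))"
    using integral_lborel_prod_Basis(2)[of "\<lambda>b t. cis (2 * pi * (a \<bullet> b) * t) * complex_of_real (exp (- (pi * \<epsilon>\<^sup>2) * t\<^sup>2))"]
    by (simp only: fourier_gauss_real[OF assms])
  also have "\<dots> = complex_of_real (exp (- (pi / \<epsilon>\<^sup>2) * (norm a)\<^sup>2) / \<epsilon> ^ DIM('a))"
    unfolding exp_norm_sq_eq_prod by (simp add: prod_dividef)
  finally show ?thesis .
qed

lemma fourier_transform_lborel:
  assumes [measurable]: "g \<in> borel_measurable borel"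
  shows "fourier_transform g \<xi> = (\<integral>z. cis (- 2 * pi * (z \<bullet> \<xi>)) * g z \<partial>lborel)"
  unfolding fourier_transform_def cis_conv_exp by (rule integral_completion) measurable

lemma borel_measurable_fourier_transform [measurable]:
  assumes [measurable]: "g \<in> borel_measurable borel"
  shows "fourier_transform g \<in> borel_measurable borel"
  unfolding fourier_transform_lborel[OF assms, abs_def] cis_conv_exp by measurable

text \<open>
  The Gaussian means of the inversion integral are the convolutions of \<open>g\<close> with an approximate identity.
\<close>

lemma fourier_inversion_gauss_mean:
  fixes g :: "'a::euclidean_space \<Rightarrow> complex"
  assumes g: "integrable lborel g" and "\<epsilon> > 0"
  shows "(\<integral>z. fourier_transform g z * cis (2 * pi * (z \<bullet> x)) * complex_of_real (exp (- (pi * \<epsilon>\<^sup>2) * (norm z)\<^sup>2)) \<partial>lborel)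
    = (\<integral>y. g (x + \<epsilon> *\<^sub>R y) * complex_of_real (exp (- pi * (norm y)\<^sup>2)) \<partial>lborel)"
proof -
  have [measurable]: "g \<in> borel_measurable borel"
    using g by auto
  define \<gamma> where "\<gamma> z = exp (- (pi * \<epsilon>\<^sup>2) * (norm z)\<^sup>2)" for z :: 'a
  have \<gamma>: "integrable lborel \<gamma>" "\<And>z. \<gamma> z \<ge> 0"
    using gauss_integral_euclidean(1)[of "pi * \<epsilon>\<^sup>2"] assms(2) by (simp_all add: \<gamma>_def[abs_def])
  have [measurable]: "\<gamma> \<in> borel_measurable borel"
    unfolding \<gamma>_def by measurable
  define k where "k z w = cis (2 * pi * (z \<bullet> (x - w))) * complex_of_real (\<gamma> z) * g w" for z w
  have [measurable]: "case_prod k \<in> borel_measurable (lborel \<Otimes>\<^sub>M lborel)"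
    unfolding k_def cis_conv_exp by measurable
  have norm_k: "norm (k z w) = \<gamma> z * norm (g w)" for z w
    using \<gamma>(2) by (simp add: k_def norm_mult)
  \<comment> \<open>The Gaussian factor makes the double integral absolutely convergent, whether or
    not \<open>fourier_transform g\<close> is integrable.\<close>
  have int_k: "integrable (lborel \<Otimes>\<^sub>M lborel) (case_prod k)"
  proof (rule lborel_pair.Fubini_integrable)
    show "integrable lborel (\<lambda>z. \<integral>w. norm (case_prod k (z, w)) \<partial>lborel)"
      using \<gamma>(1) by (simp add: norm_k)
    show "AE z in lborel. integrable lborel (\<lambda>w. case_prod k (z, w))"
    proof (rule AE_I2)
      fix z
      have "integrable lborel (\<lambda>w. \<gamma> z *\<^sub>R g w)"
        using g by (rule integrable_scaleR_right)
      then show "integrable lborel (\<lambda>w. case_prod k (z, w))"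
      proof (rule Bochner_Integration.integrable_bound)
        show "(\<lambda>w. case_prod k (z, w)) \<in> borel_measurable lborel"
          unfolding case_prod_conv k_def cis_conv_exp by measurable
      qed (simp add: norm_k \<gamma>)
    qed
  qed measurable
  have "(\<integral>z. fourier_transform g z * cis (2 * pi * (z \<bullet> x)) * complex_of_real (\<gamma> z) \<partial>lborel) =
      (\<integral>z. \<integral>w. k z w \<partial>lborel \<partial>lborel)"
  proof (rule Bochner_Integration.integral_cong[OF refl])
    fix z
    have "(\<integral>w. k z w \<partial>lborel) = (\<integral>w. cis (- 2 * pi * (w \<bullet> z)) * g w * (cis (2 * pi * (z \<bullet> x)) * complex_of_real (\<gamma> z)) \<partial>lborel)"
    proof (rule Bochner_Integration.integral_cong[OF refl])
      fix w
      have "2 * pi * (z \<bullet> (x - w)) = - 2 * pi * (w \<bullet> z) + 2 * pi * (z \<bullet> x)"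
        by (simp add: inner_diff_right inner_commute algebra_simps)
      then have "cis (2 * pi * (z \<bullet> (x - w))) = cis (- 2 * pi * (w \<bullet> z)) * cis (2 * pi * (z \<bullet> x))"
        by (simp only: cis_mult)
      then show "k z w = cis (- 2 * pi * (w \<bullet> z)) * g w * (cis (2 * pi * (z \<bullet> x)) * complex_of_real (\<gamma> z))"
        by (simp only: k_def mult_ac)
    qed
    also have "\<dots> = fourier_transform g z * (cis (2 * pi * (z \<bullet> x)) * complex_of_real (\<gamma> z))"
      by (simp only: integral_mult_left_zero fourier_transform_lborel[OF \<open>g \<in> borel_measurable borel\<close>])
    finally show "fourier_transform g z * cis (2 * pi * (z \<bullet> x)) * complex_of_real (\<gamma> z) = (\<integral>w. k z w \<partial>lborel)"
      by (simp only: mult.assoc)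
  qed
  also have "\<dots> = (\<integral>w. \<integral>z. k z w \<partial>lborel \<partial>lborel)"
    by (rule lborel_pair.Fubini_integral[OF int_k, symmetric])
  also have "\<dots> = (\<integral>w. complex_of_real (exp (- (pi / \<epsilon>\<^sup>2) * (norm (x - w))\<^sup>2) / \<epsilon> ^ DIM('a)) * g w \<partial>lborel)"
    unfolding k_def \<gamma>_def integral_mult_left_zero fourier_gauss[OF assms(2)] ..
  \<comment> \<open>Substitution w = x + \<epsilon> y; its Jacobian will cancel the normalization of
    the Gaussian.\<close>
  also have "\<dots> = (\<integral>y. (\<epsilon> ^ DIM('a)) *\<^sub>R (complex_of_real (exp (- (pi / \<epsilon>\<^sup>2) * (norm (x - (x + \<epsilon> *\<^sub>R y)))\<^sup>2) / \<epsilon> ^ DIM('a)) * g (x + \<epsilon> *\<^sub>R y)) \<partial>lborel)"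
    using assms(2) by (subst lborel_affine[of \<epsilon> x], simp) (subst integral_density; simp add: integral_distr)
  also have "\<dots> = (\<integral>y. g (x + \<epsilon> *\<^sub>R y) * complex_of_real (exp (- pi * (norm y)\<^sup>2)) \<partial>lborel)"
  proof (rule Bochner_Integration.integral_cong[OF refl])
    fix y :: 'a
    have "- (pi / \<epsilon>\<^sup>2) * (norm (x - (x + \<epsilon> *\<^sub>R y)))\<^sup>2 = - pi * (norm y)\<^sup>2"
      using assms(2) by (simp add: power_mult_distrib)
    then show "(\<epsilon> ^ DIM('a)) *\<^sub>R (complex_of_real (exp (- (pi / \<epsilon>\<^sup>2) * (norm (x - (x + \<epsilon> *\<^sub>R y)))\<^sup>2) / \<epsilon> ^ DIM('a)) * g (x + \<epsilon> *\<^sub>R y)) =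
      g (x + \<epsilon> *\<^sub>R y) * complex_of_real (exp (- pi * (norm y)\<^sup>2))"
      using assms(2) by (simp add: scaleR_conv_of_real)
  qed
  finally show ?thesis
    unfolding \<gamma>_def .
qed

text \<open>Every Gaussian mean is at most the L^1 norm of the transform, and by continuity the
  means converge to g at every point. An almost everywhere bound would say nothing at the
  multi-indices, which form a null set.\<close>

lemma norm_le_nn_integral_fourier_transform:
  fixes g :: "'a::euclidean_space \<Rightarrow> complex"
  assumes g: "continuous_on UNIV g" "\<And>x. norm x > R \<Longrightarrow> g x = 0"
    and N: "(\<integral>\<^sup>+z. ennreal (norm (fourier_transform g z)) \<partial>lborel) \<le> ennreal N" "N \<ge> 0"
  shows "norm (g x) \<le> N"
proof -
  have gm[measurable]: "g \<in> borel_measurable borel"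
    by (rule borel_measurable_continuous_onI[OF g(1)])
  have "compact (g ` cball 0 R)"
    using g(1) by (intro compact_continuous_image) (auto intro: continuous_on_subset)
  then obtain B where B: "\<And>x. x \<in> cball 0 R \<Longrightarrow> norm (g x) \<le> B"
    using compact_imp_bounded bounded_iff by (metis imageI)
  have gB: "norm (g x) \<le> \<bar>B\<bar>" for x
    using B[of x] g(2)[of x] by (cases "norm x > R") auto
  have "integrable lborel (\<lambda>x. indicator (cball 0 R) x *\<^sub>R g x)"
    using g(1) by (intro borel_integrable_compact) (auto intro: continuous_on_subset)
  moreover have "(\<lambda>x. indicator (cball 0 R) x *\<^sub>R g x) = g"
    using g(2) by (force simp: indicator_def)
  ultimately have int_g: "integrable lborel g"
    by simp
  have int_ft: "integrable lborel (fourier_transform g)"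
    using N(1) by (intro integrableI_bounded) (auto intro: le_less_trans)
  have ft_le: "(\<integral>z. norm (fourier_transform g z) \<partial>lborel) \<le> N"
    using N int_ft by (simp add: integral_eq_nn_integral enn2real_leI)
  define J where "J n = (\<integral>y. g (x + (1 / real (Suc n)) *\<^sub>R y) * complex_of_real (exp (- pi * (norm y)\<^sup>2)) \<partial>lborel)" for n
  have J_le: "norm (J n) \<le> N" for n
  proof -
    define \<epsilon> where "\<epsilon> = 1 / real (Suc n)"
    have "\<epsilon> > 0"
      by (simp add: \<epsilon>_def)
    have "norm (J n) = norm (\<integral>z. fourier_transform g z * cis (2 * pi * (z \<bullet> x)) * complex_of_real (exp (- (pi * \<epsilon>\<^sup>2) * (norm z)\<^sup>2)) \<partial>lborel)"
      unfolding J_def \<epsilon>_def[symmetric] fourier_inversion_gauss_mean[OF int_g \<open>\<epsilon> > 0\<close>] ..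
    also have "\<dots> \<le> (\<integral>z. norm (fourier_transform g z) \<partial>lborel)"
    proof (rule order_trans[OF integral_norm_bound integral_mono])
      show bd: "norm (fourier_transform g z * cis (2 * pi * (z \<bullet> x)) * complex_of_real (exp (- (pi * \<epsilon>\<^sup>2) * (norm z)\<^sup>2)))
          \<le> norm (fourier_transform g z)" for z
        by (auto simp: norm_mult intro!: mult_left_le)
      have "integrable lborel (\<lambda>z. fourier_transform g z * cis (2 * pi * (z \<bullet> x)) * complex_of_real (exp (- (pi * \<epsilon>\<^sup>2) * (norm z)\<^sup>2)))"
        by (rule Bochner_Integration.integrable_bound[OF int_ft]) (use bd in \<open>auto simp: cis_conv_exp\<close>)
      then show "integrable lborel (\<lambda>z. norm (fourier_transform g z * cis (2 * pi * (z \<bullet> x)) * complex_of_real (exp (- (pi * \<epsilon>\<^sup>2) * (norm z)\<^sup>2))))"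
        by (rule integrable_norm)
      show "integrable lborel (\<lambda>z. norm (fourier_transform g z))"
        by (rule integrable_norm[OF int_ft])
    qed
    finally show ?thesis
      using ft_le by simp
  qed
  have "J \<longlonglongrightarrow> (\<integral>y. g x * complex_of_real (exp (- pi * (norm y)\<^sup>2)) \<partial>(lborel :: 'a measure))"
    unfolding J_def
  proof (rule integral_dominated_convergence[where w = "\<lambda>y. \<bar>B\<bar> * exp (- pi * (norm y)\<^sup>2)"])
    show "integrable lborel (\<lambda>y::'a. \<bar>B\<bar> * exp (- pi * (norm y)\<^sup>2))"
      by (intro integrable_mult_right gauss_integral_euclidean) simp
    show "AE y in lborel. (\<lambda>n. g (x + (1 / real (Suc n)) *\<^sub>R y) * complex_of_real (exp (- pi * (norm y)\<^sup>2)))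
        \<longlonglongrightarrow> g x * complex_of_real (exp (- pi * (norm y)\<^sup>2))"
    proof (rule AE_I2)
      fix y :: 'a
      have "(\<lambda>n. x + (1 / real (Suc n)) *\<^sub>R y) \<longlonglongrightarrow> x + 0 *\<^sub>R y"
        by (intro tendsto_intros LIMSEQ_Suc lim_1_over_n)
      then have "(\<lambda>n. g (x + (1 / real (Suc n)) *\<^sub>R y)) \<longlonglongrightarrow> g x"
        using g(1) by (intro isCont_tendsto_compose[of x g]) (auto simp: continuous_on_eq_continuous_at)
      then show "(\<lambda>n. g (x + (1 / real (Suc n)) *\<^sub>R y) * complex_of_real (exp (- pi * (norm y)\<^sup>2)))
        \<longlonglongrightarrow> g x * complex_of_real (exp (- pi * (norm y)\<^sup>2))"
        by (rule tendsto_mult_right)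
    qed
    show "AE y in lborel. norm (g (x + (1 / real (Suc n)) *\<^sub>R y) * complex_of_real (exp (- pi * (norm y)\<^sup>2)))
        \<le> \<bar>B\<bar> * exp (- pi * (norm y)\<^sup>2)" for n
      using gB by (intro AE_I2) (simp add: norm_mult mult_right_mono)
  qed measurable
  moreover have "(\<integral>y. g x * complex_of_real (exp (- pi * (norm y)\<^sup>2)) \<partial>(lborel :: 'a measure)) = g x"
    using gauss_integral_euclidean(2)[of pi, where 'a = 'a] by (simp only: integral_mult_right_zero integral_complex_of_real) simp
  ultimately have "J \<longlonglongrightarrow> g x"
    by (simp only:)
  then show ?thesis
    using J_le by (intro Lim_bounded[OF tendsto_norm]) auto
qed

text \<open>Cauchy-Schwarz in the form 2 x y \<le> x^2 + y^2, scaled by N. As s is at least the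
  dimension, the weight W dominates the product of the 1 + z_b^2 over all coordinates b, so 1 / W
  lies below \<open>P\<close>, whose integral is a power of pi.\<close>

lemma nn_integral_norm_le_weighted_L2:
  fixes h :: "'a::euclidean_space \<Rightarrow> complex"
  assumes [measurable]: "h \<in> borel_measurable borel" and s: "s \<ge> real DIM('a)" and N: "N > 0"
    and h: "(\<integral>\<^sup>+z. ennreal ((1 + (norm z)\<^sup>2) powr s * (norm (h z))\<^sup>2) \<partial>lborel) \<le> ennreal (N\<^sup>2)"
  shows "(\<integral>\<^sup>+z. ennreal (norm (h z)) \<partial>lborel) \<le> ennreal ((1 + pi ^ DIM('a)) * N)"
proof -
  define P where "P z = (\<Prod>b\<in>Basis. 1 / (1 + (z \<bullet> b)\<^sup>2))" for z :: 'a
  define W where "W z = (1 + (norm z)\<^sup>2) powr s" for z :: 'a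
  have P0: "P z \<ge> 0" for z
    by (auto simp: P_def intro!: prod_nonneg)
  have [measurable]: "P \<in> borel_measurable borel" "W \<in> borel_measurable borel"
    unfolding P_def W_def by measurable
  have W: "W z > 0" "1 / W z \<le> P z" for z
  proof -
    have one: "1 + (norm z)\<^sup>2 \<ge> 1"
      by simp
    then show "W z > 0"
      unfolding W_def by (simp only: powr_gt_zero)
    have "(\<Prod>b\<in>Basis. 1 + (z \<bullet> b)\<^sup>2) \<le> (\<Prod>b\<in>(Basis::'a set). 1 + (norm z)\<^sup>2)"
    proof (rule prod_mono)
      fix b :: 'a assume "b \<in> Basis"
      then have "\<bar>z \<bullet> b\<bar> \<le> norm z"
        by (rule Basis_le_norm)
      then show "0 \<le> 1 + (z \<bullet> b)\<^sup>2 \<and> 1 + (z \<bullet> b)\<^sup>2 \<le> 1 + (norm z)\<^sup>2"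
        using power_mono[of "\<bar>z \<bullet> b\<bar>" "norm z" 2] by simp
    qed
    also have "\<dots> = (1 + (norm z)\<^sup>2) powr real DIM('a)"
      using less_le_trans[OF zero_less_one one] by (subst powr_realpow) auto
    also have "\<dots> \<le> W z"
      unfolding W_def using s one by (intro powr_mono) auto
    finally have "(\<Prod>b\<in>Basis. 1 + (z \<bullet> b)\<^sup>2) \<le> W z" .
    moreover have "(\<Prod>b\<in>Basis. 1 + (z \<bullet> b)\<^sup>2) > 0"
      by (intro prod_pos) (auto simp: add_pos_nonneg)
    ultimately have "1 / W z \<le> 1 / (\<Prod>b\<in>Basis. 1 + (z \<bullet> b)\<^sup>2)"
      by (intro divide_left_mono) auto
    then show "1 / W z \<le> P z"
      by (simp add: P_def prod_dividef)
  qed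
  have int_P: "(\<integral>\<^sup>+z. ennreal (P z) \<partial>lborel) = ennreal (pi ^ DIM('a))"
  proof -
    have "integrable lborel P" "(\<integral>z. P z \<partial>lborel) = pi ^ DIM('a)"
      unfolding P_def using integral_lborel_prod_Basis[of "\<lambda>_ t. 1 / (1 + t\<^sup>2)"] integral_inverse_sq_scaled[of 1] by simp_all
    then show ?thesis
      using P0 by (simp add: nn_integral_eq_integral)
  qed
  have pw: "norm (h z) \<le> (1 / N) * (W z * (norm (h z))\<^sup>2) + N * P z" for z
  proof -
    define u where "u = W z / N"
    have u: "u > 0"
      using W(1)[of z] N by (simp add: u_def)
    have "2 * (sqrt u * norm (h z)) * (1 / sqrt u) \<le> (sqrt u * norm (h z))\<^sup>2 + (1 / sqrt u)\<^sup>2"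
      by (rule sum_squares_bound)
    then have "2 * norm (h z) \<le> u * (norm (h z))\<^sup>2 + 1 / u"
      using u by (simp add: power_mult_distrib power_divide)
    moreover have "1 / u = N * (1 / W z)" "u * (norm (h z))\<^sup>2 = (1 / N) * (W z * (norm (h z))\<^sup>2)"
      by (simp_all add: u_def)
    moreover have "N * (1 / W z) \<le> N * P z"
      using N W(2) by (intro mult_left_mono) auto
    ultimately have "2 * norm (h z) \<le> (1 / N) * (W z * (norm (h z))\<^sup>2) + N * P z"
      by (simp only:)
    then show ?thesis
      using norm_ge_zero[of "h z"] by linarith
  qed
  have "(\<integral>\<^sup>+z. ennreal (norm (h z)) \<partial>lborel) \<le>
      (\<integral>\<^sup>+z. ennreal (1 / N) * ennreal (W z * (norm (h z))\<^sup>2) + ennreal N * ennreal (P z) \<partial>lborel)"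
  proof (rule nn_integral_mono)
    fix z
    have "ennreal (norm (h z)) \<le> ennreal ((1 / N) * (W z * (norm (h z))\<^sup>2) + N * P z)"
      by (rule ennreal_leI[OF pw])
    also have "\<dots> = ennreal ((1 / N) * (W z * (norm (h z))\<^sup>2)) + ennreal (N * P z)"
      using N W(1)[of z] P0[of z] by (intro ennreal_plus) auto
    also have "\<dots> = ennreal (1 / N) * ennreal (W z * (norm (h z))\<^sup>2) + ennreal N * ennreal (P z)"
      using N W(1)[of z] P0[of z] by (intro arg_cong2[where f = plus] ennreal_mult) auto
    finally show "ennreal (norm (h z)) \<le> ennreal (1 / N) * ennreal (W z * (norm (h z))\<^sup>2) + ennreal N * ennreal (P z)" .
  qed
  also have "\<dots> = ennreal (1 / N) * (\<integral>\<^sup>+z. ennreal (W z * (norm (h z))\<^sup>2) \<partial>lborel) + ennreal N * (\<integral>\<^sup>+z. ennreal (P z) \<partial>lborel)"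
    by (simp add: nn_integral_add nn_integral_cmult)
  also have "\<dots> \<le> ennreal (1 / N) * ennreal (N\<^sup>2) + ennreal N * ennreal (pi ^ DIM('a))"
    unfolding int_P using h by (intro add_mono mult_left_mono) (auto simp: W_def)
  also have "\<dots> = ennreal ((1 + pi ^ DIM('a)) * N)"
  proof -
    have "ennreal (1 / N) * ennreal (N\<^sup>2) = ennreal N"
      using N by (simp add: power2_eq_square flip: ennreal_mult)
    moreover have "ennreal N * ennreal (pi ^ DIM('a)) = ennreal (N * pi ^ DIM('a))"
      using N by (simp add: ennreal_mult)
    ultimately show ?thesis
      using N by (simp add: algebra_simps flip: ennreal_plus)
  qed
  finally show ?thesis .
qed

lemma sobolev_symbol_le:
  fixes g :: "'a::euclidean_space \<Rightarrow> complex"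
  assumes "continuous_on UNIV g" "\<And>x. norm x > R \<Longrightarrow> g x = 0" "s \<ge> real DIM('a)" "N > 0"
    and "weighted_L2_norm s (fourier_transform g) \<le> ennreal N"
  shows "norm (g x) \<le> (1 + pi ^ DIM('a)) * N"
proof (rule norm_le_nn_integral_fourier_transform[OF assms(1,2)])
  have "g \<in> borel_measurable borel"
    by (rule borel_measurable_continuous_onI[OF assms(1)])
  then show "(\<integral>\<^sup>+z. ennreal (norm (fourier_transform g z)) \<partial>lborel) \<le> ennreal ((1 + pi ^ DIM('a)) * N)"
    using assms by (intro nn_integral_norm_le_weighted_L2[of _ s] weighted_L2_norm_finiteD) auto
qed (use assms in auto)

section \<open>From dyadic scales to product weights\<close>

text \<open>A product over coordinates, unlike a power of the Euclidean length, so that weighted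
  sums of Hermite functions factor into one-dimensional ones.\<close>

definition index_weight :: "real \<Rightarrow> nat ^ 'n \<Rightarrow> real" where
  "index_weight \<tau> \<mu> = (\<Prod>j\<in>UNIV. real (Suc (\<mu> $ j)) powr (- \<tau>))"

lemma index_weight_pos: "index_weight \<tau> \<mu> > 0"
  unfolding index_weight_def by (intro prod_pos) auto

text \<open>If R bounds all the entries, a decay of order \<tau> n \<kappa> in R can be distributed
  as \<tau> to each of the n \<kappa> coordinates.\<close>

lemma prod_index_weight_ge:
  fixes \<nu> :: "nat ^ 'n ^ 'k"
  assumes "\<And>i j. real (Suc (\<nu> $ i $ j)) \<le> R" "\<tau> \<ge> 0"
  shows "R powr (- (\<tau> * real (CARD('n) * CARD('k)))) \<le> (\<Prod>i\<in>UNIV. index_weight \<tau> (\<nu> $ i))"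
proof -
  have R: "R > 0"
    using assms(1)[of undefined undefined] by linarith
  have "R powr (- (\<tau> * real (CARD('n) * CARD('k)))) = (\<Prod>i\<in>(UNIV::'k set). \<Prod>j\<in>(UNIV::'n set). R powr (- \<tau>))"
    using R by (simp add: powr_realpow[symmetric] powr_powr algebra_simps flip: power_mult)
  also have "\<dots> \<le> (\<Prod>i\<in>UNIV. index_weight \<tau> (\<nu> $ i))"
    unfolding index_weight_def using assms by (intro prod_mono conjI prod_nonneg powr_mono2') auto
  finally show ?thesis .
qed

text \<open>The scale at which 2^(-k) r lies in [1, 2], where the cut-off function equals 1; r \<ge>
  2 makes k positive, as the scales of the norms are.\<close>

lemma dyadic_scale:
  assumes "r \<ge> 2"
  obtains k :: nat where "k > 0" "2 powr real k \<le> r" "r \<le> 2 powr real (Suc k)"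
proof
  define k where "k = nat \<lfloor>log 2 r\<rfloor>"
  have "log 2 r \<ge> 1"
    using assms by (simp add: le_log_iff)
  then have k: "real k \<le> log 2 r" "log 2 r \<le> real (Suc k)" "k > 0"
    unfolding k_def by linarith+
  show "k > 0" "2 powr real k \<le> r" "r \<le> 2 powr real (Suc k)"
    using k assms by (auto simp: le_log_iff log_le_iff)
qed

text \<open>For |\<nu>| \<ge> 2 there is a scale k whose cut-off equals 1 at \<nu>, so the bound of
  the localized piece, of order 2^(-k \<sigma>), is a bound of m x \<nu> itself. The finitely many
  other \<nu> are covered by the boundedness of the symbol.\<close>

lemma symbol_decay:
  fixes m :: "real ^ 'n \<Rightarrow> nat ^ 'n ^ 'k \<Rightarrow> complex"
  assumes \<psi>0: "\<And>t. t \<notin> {1 / 2..4} \<Longrightarrow> \<psi> t = 0" and \<psi>1: "\<And>t. t \<in> {1..2} \<Longrightarrow> \<psi> t = 1"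
    and m: "bounded_measurable_symbol m"
    and norms: "lu_hermite_norm \<psi> s m < \<infinity> \<or>
         (\<exists>M. restricts_to_symbol \<psi> M m \<and> lu_sobolev_norm \<psi> s M < \<infinity>)"
    and s: "s \<ge> real (CARD('n) * CARD('k))"
    and \<tau>: "\<tau> * real (CARD('n) * CARD('k)) = s - real (CARD('n) * CARD('k)) / 2"
  shows "\<exists>C\<ge>0. \<forall>x \<nu>. norm (m x \<nu>) \<le> C * (\<Prod>i\<in>UNIV. index_weight \<tau> (\<nu> $ i))"
proof -
  define d where "d = real (CARD('n) * CARD('k))"
  define \<sigma> where "\<sigma> = s - d / 2"
  have d: "d > 0"
    by (simp add: d_def)
  have \<tau>d: "\<tau> * d = \<sigma>"
    using \<tau> by (simp add: \<sigma>_def d_def)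
  have s0: "s \<ge> 0"
    using s d unfolding d_def[symmetric] by linarith
  have \<sigma>: "\<sigma> > 0"
    using s d unfolding d_def[symmetric] \<sigma>_def by linarith
  then have \<tau>0: "\<tau> \<ge> 0"
    using \<tau>d d by (metis less_imp_le zero_less_mult_pos2)
  \<comment> \<open>Beyond 2^(k + 2) the argument of \<psi> exceeds 4 and leaves its
    support.\<close>
  have cutoff0: "dyadic_cutoff \<psi> k \<xi> = 0" if "norm \<xi> > 2 powr real (k + 2)" for k and \<xi> :: "real ^ 'n ^ 'k"
  proof -
    have "2 powr (- real k) * norm \<xi> > 2 powr (- real k) * 2 powr real (k + 2)"
      using that by (intro mult_strict_left_mono) auto
    also have "2 powr (- real k) * 2 powr real (k + 2) = 4"
      by (simp flip: powr_add)
    finally show ?thesis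
      unfolding dyadic_cutoff_def by (intro \<psi>0) auto
  qed
  have scale: "weighted_L2_norm s F \<le> ennreal (2 powr (- (real k * \<sigma>)) * L)"
    if "ennreal (2 powr (real k * (s - real (CARD('n) * CARD('k)) / 2))) * weighted_L2_norm s F \<le> ennreal L" "L \<ge> 0"
    for k L and F :: "real ^ 'n ^ 'k \<Rightarrow> complex"
  proof -
    have "weighted_L2_norm s F = ennreal (2 powr (- (real k * \<sigma>)) * 2 powr (real k * \<sigma>)) * weighted_L2_norm s F"
      by (simp flip: powr_add)
    also have "\<dots> = ennreal (2 powr (- (real k * \<sigma>))) * (ennreal (2 powr (real k * \<sigma>)) * weighted_L2_norm s F)"
      by (simp add: ennreal_mult mult.assoc)
    also have "\<dots> \<le> ennreal (2 powr (- (real k * \<sigma>))) * ennreal L"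
      using that(1) by (intro mult_left_mono) (auto simp: \<sigma>_def d_def)
    finally show ?thesis
      using that(2) by (simp add: ennreal_mult)
  qed
  obtain L where L: "L \<ge> 0"
    "\<And>k x \<nu>. k > 0 \<Longrightarrow> norm (m x \<nu> * dyadic_cutoff \<psi> k (map_matrix real \<nu> :: real ^ 'n ^ 'k)) \<le> L * 2 powr (- (real k * \<sigma>))"
    using norms
  proof
    assume fin: "lu_hermite_norm \<psi> s m < \<infinity>"
    define L where "L = enn2real (lu_hermite_norm \<psi> s m)"
    have "norm (m x \<nu> * dyadic_cutoff \<psi> k (map_matrix real \<nu> :: real ^ 'n ^ 'k)) \<le> 2 powr (- (real k * \<sigma>)) * L"
      if "k > 0" for k x \<nu>
    proof (rule hermite_symbol_le)
      have "{\<nu>. m x \<nu> * dyadic_cutoff \<psi> k (map_matrix real \<nu> :: real ^ 'n ^ 'k) \<noteq> 0} \<subseteq>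
          {\<nu>. \<forall>i. \<nu> $ i \<in> {\<mu>. \<forall>j. \<mu> $ j \<in> {..2 ^ (k + 2)}}}"
      proof (clarsimp)
        fix \<nu> :: "nat ^ 'n ^ 'k" and i j
        assume "dyadic_cutoff \<psi> k (map_matrix real \<nu> :: real ^ 'n ^ 'k) \<noteq> 0"
        then have "norm (map_matrix real \<nu> :: real ^ 'n ^ 'k) \<le> 2 powr real (k + 2)"
          using cutoff0 by (meson not_le)
        moreover have "real (\<nu> $ i $ j) \<le> norm (map_matrix real \<nu> :: real ^ 'n ^ 'k)"
          using Finite_Cartesian_Product.norm_nth_le[of "map_matrix real \<nu> :: real ^ 'n ^ 'k" i] Finite_Cartesian_Product.norm_nth_le[of "map_matrix real \<nu> $ i :: real ^ 'n" j]
          by (simp add: map_matrix_def)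
        ultimately have "real (\<nu> $ i $ j) \<le> real (2 ^ (k + 2))"
          by (simp add: powr_realpow flip: of_nat_Suc)
        then show "\<nu> $ i $ j \<le> 4 * 2 ^ k"
          by (simp only: of_nat_le_iff) simp
      qed
      moreover have "finite {\<nu> :: nat ^ 'n ^ 'k. \<forall>i. \<nu> $ i \<in> {\<mu>. \<forall>j. \<mu> $ j \<in> {..2 ^ (k + 2)}}}"
        by (intro finite_vec_Collect) auto
      ultimately show "finite {\<nu>. m x \<nu> * dyadic_cutoff \<psi> k (map_matrix real \<nu> :: real ^ 'n ^ 'k) \<noteq> 0}"
        by (rule finite_subset)
      have "ennreal (2 powr (real k * (s - real (CARD('n) * CARD('k)) / 2))) *
        weighted_L2_norm s
          (inverse_hermite_transform (\<lambda>\<nu>. m x \<nu> * dyadic_cutoff \<psi> k (map_matrix real \<nu> :: real ^ 'n ^ 'k))) \<le> lu_hermite_norm \<psi> s m"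
        unfolding lu_hermite_norm_def using that by (intro SUP_upper2[of k] SUP_upper) auto
      also have "\<dots> = ennreal L"
        using fin by (simp add: L_def)
      finally show "weighted_L2_norm s
          (inverse_hermite_transform (\<lambda>\<nu>. m x \<nu> * dyadic_cutoff \<psi> k (map_matrix real \<nu> :: real ^ 'n ^ 'k))) \<le> ennreal (2 powr (- (real k * \<sigma>)) * L)"
        by (rule scale) (simp add: L_def)
    qed (use s0 in \<open>auto simp: L_def\<close>)
    then show ?thesis
      by (intro that[of L]) (auto simp: L_def mult.commute)
  next
    assume "\<exists>M. restricts_to_symbol \<psi> M m \<and> lu_sobolev_norm \<psi> s M < \<infinity>"
    then obtain M where M: "restricts_to_symbol \<psi> M m" and fin: "lu_sobolev_norm \<psi> s M < \<infinity>"
      by blast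
    \<comment> \<open>Increased by 1 to be positive, since the Sobolev bound divides by it.\<close>
    define L where "L = enn2real (lu_sobolev_norm \<psi> s M) + 1"
    have L: "L > 0"
      by (simp add: L_def add_nonneg_pos)
    have "norm (m x \<nu> * dyadic_cutoff \<psi> k (map_matrix real \<nu> :: real ^ 'n ^ 'k)) \<le>
        (1 + pi ^ DIM(real ^ 'n ^ 'k)) * (2 powr (- (real k * \<sigma>)) * L)"
      if "k > 0" for k x \<nu>
    proof -
      define g where "g \<xi> = M x \<xi> * dyadic_cutoff \<psi> k \<xi>" for \<xi>
      have "norm (g (map_matrix real \<nu>)) \<le> (1 + pi ^ DIM(real ^ 'n ^ 'k)) * (2 powr (- (real k * \<sigma>)) * L)"
      proof (rule sobolev_symbol_le)
        show "continuous_on UNIV g"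
          using M that unfolding g_def restricts_to_symbol_def by blast
        show "g \<xi> = 0" if "norm \<xi> > 2 powr real (k + 2)" for \<xi>
          using cutoff0[OF that] by (simp add: g_def)
        have "ennreal (2 powr (real k * (s - real (CARD('n) * CARD('k)) / 2))) *
          weighted_L2_norm s (fourier_transform g) \<le> lu_sobolev_norm \<psi> s M"
          unfolding lu_sobolev_norm_def g_def[abs_def] using that by (intro SUP_upper2[of k] SUP_upper) auto
        also have "\<dots> = ennreal (enn2real (lu_sobolev_norm \<psi> s M))"
          using fin by simp
        also have "\<dots> \<le> ennreal L"
          by (intro ennreal_leI) (simp add: L_def)
        finally show "weighted_L2_norm s (fourier_transform g) \<le> ennreal (2 powr (- (real k * \<sigma>)) * L)"
          using L by (intro scale) auto
      qed (use s L in \<open>auto simp: mult.commute\<close>)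
      then show ?thesis
        using M by (simp add: g_def restricts_to_symbol_def)
    qed
    then show ?thesis
      using L by (intro that[of "(1 + pi ^ DIM(real ^ 'n ^ 'k)) * L"]) (auto simp: mult_ac)
  qed
  obtain B where B: "\<And>x \<nu>. norm (m x \<nu>) \<le> B"
    using m unfolding bounded_measurable_symbol_def by blast
  have B0: "B \<ge> 0"
    using B[of undefined undefined] norm_ge_zero order_trans by blast
  \<comment> \<open>\<open>B\<close> covers |\<nu>| < 2 and \<open>L\<close> the dyadic scales. The
    factor 4^\<sigma> pays for passing from 2^k to 2^(k + 2), which bounds every entry plus 1, and
    for the bound 4 of these numbers when |\<nu>| < 2.\<close>
  define C where "C = (B + L) * 4 powr \<sigma>"
  have "norm (m x \<nu>) \<le> C * (\<Prod>i\<in>UNIV. index_weight \<tau> (\<nu> $ i))" for x \<nu>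
  proof -
    define \<xi> :: "real ^ 'n ^ 'k" where "\<xi> = map_matrix real \<nu>"
    have le: "real (\<nu> $ i $ j) \<le> norm \<xi>" for i j
      using Finite_Cartesian_Product.norm_nth_le[of \<xi> i] Finite_Cartesian_Product.norm_nth_le[of "\<xi> $ i" j] by (simp add: \<xi>_def map_matrix_def)
    show ?thesis
    proof (cases "norm \<xi> \<ge> 2")
      case True
      then obtain k where k: "k > 0" "2 powr real k \<le> norm \<xi>" "norm \<xi> \<le> 2 powr real (Suc k)"
        by (rule dyadic_scale)
      have "2 powr (- real k) * 2 powr real k \<le> 2 powr (- real k) * norm \<xi>"
        "2 powr (- real k) * norm \<xi> \<le> 2 powr (- real k) * 2 powr real (Suc k)"
        using k by (intro mult_left_mono; simp)+
      then have "dyadic_cutoff \<psi> k \<xi> = 1"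
        unfolding dyadic_cutoff_def by (intro \<psi>1) (simp flip: powr_add)
      then have "norm (m x \<nu>) \<le> L * 2 powr (- (real k * \<sigma>))"
        using L(2)[OF k(1), of x \<nu>] by (simp add: \<xi>_def)
      also have "\<dots> \<le> (B + L) * 2 powr (- (real k * \<sigma>))"
        using B0 by (intro mult_right_mono) auto
      also have "\<dots> = C * (2 powr (real k + 2)) powr (- \<sigma>)"
      proof -
        have "4 powr \<sigma> = 2 powr (2 * \<sigma>)"
          using powr_powr[of 2 2 \<sigma>] by simp
        then have "4 powr \<sigma> * (2 powr (real k + 2)) powr (- \<sigma>) = 2 powr (- (real k * \<sigma>))"
          by (simp add: powr_powr algebra_simps flip: powr_add)
        then show ?thesis
          by (simp add: C_def)
      qed
      also have "\<dots> \<le> C * (\<Prod>i\<in>UNIV. index_weight \<tau> (\<nu> $ i))"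
      proof (rule mult_left_mono)
        have "real (Suc (\<nu> $ i $ j)) \<le> 2 powr (real k + 2)" for i j
        proof -
          have "real (Suc (\<nu> $ i $ j)) \<le> 1 + 2 powr real (Suc k)"
            using le[of i j] k(3) by simp
          also have "\<dots> \<le> 2 powr real (Suc k) + 2 powr real (Suc k)"
            by (intro add_right_mono ge_one_powr_ge_zero) auto
          also have "\<dots> = 2 powr (real k + 2)"
            by (simp add: powr_add)
          finally show ?thesis .
        qed
        from prod_index_weight_ge[OF this \<tau>0]
        show "(2 powr (real k + 2)) powr (- \<sigma>) \<le> (\<Prod>i\<in>UNIV. index_weight \<tau> (\<nu> $ i))"
          using \<tau>d by (simp add: d_def)
      qed (use B0 L(1) in \<open>simp add: C_def\<close>)
      finally show ?thesis .
    next
      case False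
      have "norm (m x \<nu>) \<le> B + L"
        using B[of x \<nu>] L(1) by simp
      also have "\<dots> = C * 4 powr (- \<sigma>)"
        by (simp add: C_def flip: powr_add)
      also have "\<dots> \<le> C * (\<Prod>i\<in>UNIV. index_weight \<tau> (\<nu> $ i))"
      proof (rule mult_left_mono)
        have "real (Suc (\<nu> $ i $ j)) \<le> 4" for i j
          using le[of i j] False by simp
        from prod_index_weight_ge[OF this \<tau>0]
        show "4 powr (- \<sigma>) \<le> (\<Prod>i\<in>UNIV. index_weight \<tau> (\<nu> $ i))"
          using \<tau>d by (simp add: d_def)
      qed (use B0 L(1) in \<open>simp add: C_def\<close>)
      finally show ?thesis .
    qed
  qed
  then show ?thesis
    using B0 L(1) by (intro exI[of _ C]) (auto simp: C_def)
qed

section \<open>The majorant of the pseudo-multiplier\<close>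

definition vec_kernel :: "real \<Rightarrow> real ^ 'n \<Rightarrow> real ^ 'n \<Rightarrow> ennreal" where
  "vec_kernel \<tau> x y = (\<Prod>j\<in>UNIV. hermite_kernel \<tau> (x $ j) (y $ j))"

text \<open>The summand 1 yields positivity from \<open>zeta_sum_nonneg\<close> alone;
  \<open>Schur_test\<close> asks for a positive constant.\<close>

definition kernel_bound :: "'n::finite itself \<Rightarrow> real \<Rightarrow> real" where
  "kernel_bound _ \<tau> = (1 + 6 * zeta_sum \<tau>) ^ CARD('n)"

lemma kernel_bound_pos: "\<tau> > 1 \<Longrightarrow> kernel_bound N \<tau> > 0"
  using zeta_sum_nonneg[of \<tau>] by (simp add: kernel_bound_def)

lemma vec_kernel_commute: "vec_kernel \<tau> x y = vec_kernel \<tau> y x"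
  unfolding vec_kernel_def by (subst hermite_kernel_commute) simp

lemma borel_measurable_vec_nth [measurable]: "(\<lambda>x :: real ^ 'n. x $ j) \<in> borel_measurable borel"
  by (intro borel_measurable_continuous_onI continuous_intros)

lemma borel_measurable_vec_kernel [measurable]:
  assumes [measurable]: "f \<in> borel_measurable M" "g \<in> borel_measurable M"
  shows "(\<lambda>x. vec_kernel \<tau> (f x) (g x)) \<in> borel_measurable M"
  unfolding vec_kernel_def by measurable

lemma borel_measurable_hermite_fun_vec [measurable]: "hermite_fun_vec \<mu> \<in> borel_measurable borel"
  unfolding hermite_fun_vec_def[abs_def] by measurable

lemma vec_kernel_le:
  fixes x y :: "real ^ 'n"
  assumes "\<tau> > 1"
  shows "vec_kernel \<tau> x y \<le> ennreal (kernel_bound TYPE('n) \<tau>)"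
proof -
  have "vec_kernel \<tau> x y \<le> (\<Prod>j\<in>(UNIV::'n set). ennreal (6 * zeta_sum \<tau>))"
    unfolding vec_kernel_def by (intro prod_mono_ennreal hermite_kernel_le assms)
  also have "\<dots> \<le> (\<Prod>j\<in>(UNIV::'n set). ennreal (1 + 6 * zeta_sum \<tau>))"
    by (intro prod_mono_ennreal ennreal_leI) simp
  also have "\<dots> = ennreal (kernel_bound TYPE('n) \<tau>)"
    using zeta_sum_nonneg[OF assms] by (simp add: kernel_bound_def ennreal_power del: ennreal_plus)
  finally show ?thesis .
qed

lemma nn_integral_vec_kernel_le:
  fixes x :: "real ^ 'n"
  assumes "\<tau> > 1"
  shows "(\<integral>\<^sup>+y. vec_kernel \<tau> x y \<partial>lborel) \<le> ennreal (kernel_bound TYPE('n) \<tau>)"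
proof -
  have "(\<integral>\<^sup>+y. vec_kernel \<tau> x y \<partial>lborel) =
      (\<integral>\<^sup>+y. (\<Prod>j\<in>UNIV. hermite_kernel \<tau> (x $ j) (y \<bullet> axis j (1 :: real))) \<partial>lborel)"
    by (simp add: vec_kernel_def inner_axis)
  also have "\<dots> = (\<Prod>j\<in>UNIV. \<integral>\<^sup>+t. hermite_kernel \<tau> (x $ j) t \<partial>lborel)"
    by (rule nn_integral_lborel_prod_axes[OF bij_betw_axis_Basis]) measurable
  also have "\<dots> \<le> (\<Prod>j\<in>(UNIV::'n set). ennreal (1 + 6 * zeta_sum \<tau>))"
    by (intro prod_mono_ennreal order_trans[OF nn_integral_hermite_kernel_le[OF assms]] ennreal_leI) simp
  also have "\<dots> = ennreal (kernel_bound TYPE('n) \<tau>)"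
    using zeta_sum_nonneg[OF assms] by (simp add: kernel_bound_def ennreal_power del: ennreal_plus)
  finally show ?thesis .
qed

definition index_box :: "nat \<Rightarrow> (nat ^ 'n) set" where
  "index_box N = {\<mu>. \<forall>j. \<mu> $ j \<in> {..<N}}"

lemma finite_index_box [simp]: "finite (index_box N)"
  unfolding index_box_def by (rule finite_vec_Collect) simp

text \<open>Over a box the sum of products is a product of sums, each a partial sum of a
  one-dimensional kernel.\<close>

lemma sum_le_vec_kernel:
  "(\<Sum>\<mu>\<in>index_box N. ennreal (index_weight \<tau> \<mu> * \<bar>hermite_fun_vec \<mu> x\<bar> * \<bar>hermite_fun_vec \<mu> y\<bar>)) \<le> vec_kernel \<tau> x y"
proof -
  define F where "F j a = ennreal (real (Suc a) powr (- \<tau>) * \<bar>hermite_fun a (x $ j)\<bar> * \<bar>hermite_fun a (y $ j)\<bar>)" for j a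
  have "ennreal (index_weight \<tau> \<mu> * \<bar>hermite_fun_vec \<mu> x\<bar> * \<bar>hermite_fun_vec \<mu> y\<bar>) = (\<Prod>j\<in>UNIV. F j (\<mu> $ j))" for \<mu>
    unfolding F_def by (subst prod_ennreal) (auto simp: index_weight_def hermite_fun_vec_def abs_prod prod.distrib)
  then have "(\<Sum>\<mu>\<in>index_box N. ennreal (index_weight \<tau> \<mu> * \<bar>hermite_fun_vec \<mu> x\<bar> * \<bar>hermite_fun_vec \<mu> y\<bar>)) =
      (\<Prod>j\<in>UNIV. \<Sum>a<N. F j a)"
    unfolding index_box_def using sum_prod_vec[of "\<lambda>_. {..<N}" F] by simp
  also have "\<dots> \<le> vec_kernel \<tau> x y"
    unfolding vec_kernel_def hermite_kernel_def F_def by (intro prod_mono_ennreal sum_le_suminf summableI) auto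
  finally show ?thesis .
qed

text \<open>A lower bound of the kernel by one term; through it, finiteness of the operator will
  show that Hermite functions pair integrably with every f in L^p.\<close>

lemma term_le_vec_kernel:
  "ennreal (index_weight \<tau> \<mu> * \<bar>hermite_fun_vec \<mu> x\<bar> * \<bar>hermite_fun_vec \<mu> y\<bar>) \<le> vec_kernel \<tau> x y"
proof -
  obtain N where "\<forall>a\<in>range (\<lambda>j. \<mu> $ j). a < N"
    using finite_nat_set_iff_bounded[of "range (\<lambda>j. \<mu> $ j)"] by auto
  then have "\<mu> \<in> index_box N"
    by (auto simp: index_box_def)
  then have "ennreal (index_weight \<tau> \<mu> * \<bar>hermite_fun_vec \<mu> x\<bar> * \<bar>hermite_fun_vec \<mu> y\<bar>) \<le>
      (\<Sum>\<mu>\<in>index_box N. ennreal (index_weight \<tau> \<mu> * \<bar>hermite_fun_vec \<mu> x\<bar> * \<bar>hermite_fun_vec \<mu> y\<bar>))"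
    by (intro member_le_sum) auto
  then show ?thesis
    using sum_le_vec_kernel order_trans by blast
qed

text \<open>\<open>kernel_op\<close> does not depend on the values of \<open>f\<close> on null sets, so it may be computed from a Borel representative.\<close>

definition kernel_op :: "real \<Rightarrow> (real ^ 'n \<Rightarrow> complex) \<Rightarrow> real ^ 'n \<Rightarrow> ennreal" where
  "kernel_op \<tau> f x = (\<integral>\<^sup>+y. ennreal (norm (f y)) * vec_kernel \<tau> x y \<partial>lborel)"

text \<open>Members of L^p are only Lebesgue measurable, whereas Tonelli on the product of
  \<open>lborel\<close> with itself calls for Borel measurability.\<close>

lemma lebesgue_norm_borel_representative:
  fixes f :: "'a::euclidean_space \<Rightarrow> complex"
  assumes "f \<in> borel_measurable lebesgue"
  obtains u :: "'a \<Rightarrow> real" where "u \<in> borel_measurable borel" "\<And>y. u y \<ge> 0" "AE y in lborel. norm (f y) = u y"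
proof -
  have "(\<lambda>y. norm (f y)) \<in> borel_measurable (completion lborel)"
    using assms by measurable
  then obtain u' where u': "u' \<in> borel_measurable lborel" "AE y in lborel. norm (f y) = u' y"
    using completion_ex_borel_measurable_real by blast
  show ?thesis
  proof
    show "(\<lambda>y. \<bar>u' y\<bar>) \<in> borel_measurable borel"
      using u'(1) by simp
    show "AE y in lborel. norm (f y) = \<bar>u' y\<bar>"
      using u'(2)
    proof eventually_elim
      case (elim y)
      then show ?case
        using norm_ge_zero[of "f y"] by linarith
    qed
  qed simp
qed

lemma kernel_op_cong:
  "AE y in lborel. norm (f y) = u y \<Longrightarrow> kernel_op \<tau> f x = (\<integral>\<^sup>+y. ennreal (u y) * vec_kernel \<tau> x y \<partial>lborel)"
  unfolding kernel_op_def by (intro nn_integral_cong_AE) auto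

lemma borel_measurable_kernel_op [measurable]:
  assumes "f \<in> borel_measurable lebesgue"
  shows "kernel_op \<tau> f \<in> borel_measurable borel"
proof -
  from assms obtain u where [measurable]: "u \<in> borel_measurable borel" and u: "AE y in lborel. norm (f y) = u y"
    by (rule lebesgue_norm_borel_representative)
  show ?thesis
    unfolding kernel_op_cong[OF u, abs_def] by measurable
qed

text \<open>If the integrand is not integrable its Bochner integral is 0 by convention, so the bound
  holds for every function.\<close>

lemma norm_hermite_coeff_le:
  fixes f :: "real ^ 'n \<Rightarrow> complex"
  shows "ennreal (norm (hermite_coeff f \<mu>)) \<le> (\<integral>\<^sup>+y. ennreal (norm (f y) * \<bar>hermite_fun_vec \<mu> y\<bar>) \<partial>lborel)"
proof (cases "integrable lebesgue (\<lambda>y. f y * of_real (hermite_fun_vec \<mu> y))")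
  case True
  then show ?thesis
    using integral_norm_bound_ennreal[OF True] by (simp add: hermite_coeff_def norm_mult nn_integral_completion)
next
  case False
  then show ?thesis
    by (simp add: hermite_coeff_def not_integrable_integral_eq)
qed

text \<open>Coefficients are replaced by integrals of absolute values; the sum, taken under the
  integral sign, is a box sum of the kernel.\<close>

lemma sum_hermite_coeff_le_kernel_op:
  fixes f :: "real ^ 'n \<Rightarrow> complex"
  assumes "f \<in> borel_measurable lebesgue"
  shows "(\<Sum>\<mu>\<in>index_box N. ennreal (index_weight \<tau> \<mu> * norm (hermite_coeff f \<mu>) * \<bar>hermite_fun_vec \<mu> x\<bar>)) \<le> kernel_op \<tau> f x"
proof -
  from assms obtain u where [measurable]: "u \<in> borel_measurable borel" and u0: "\<And>y. u y \<ge> 0"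
    and u: "AE y in lborel. norm (f y) = u y"
    by (rule lebesgue_norm_borel_representative) blast
  have "(\<Sum>\<mu>\<in>index_box N. ennreal (index_weight \<tau> \<mu> * norm (hermite_coeff f \<mu>) * \<bar>hermite_fun_vec \<mu> x\<bar>)) \<le>
      (\<Sum>\<mu>\<in>index_box N. \<integral>\<^sup>+y. ennreal (u y) * ennreal (index_weight \<tau> \<mu> * \<bar>hermite_fun_vec \<mu> x\<bar> * \<bar>hermite_fun_vec \<mu> y\<bar>) \<partial>lborel)"
  proof (rule sum_mono)
    fix \<mu> :: "nat ^ 'n"
    define c where "c = index_weight \<tau> \<mu> * \<bar>hermite_fun_vec \<mu> x\<bar>"
    have c: "c \<ge> 0"
      using index_weight_pos[of \<tau> \<mu>] by (simp add: c_def)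
    have "ennreal (index_weight \<tau> \<mu> * norm (hermite_coeff f \<mu>) * \<bar>hermite_fun_vec \<mu> x\<bar>) = ennreal (c * norm (hermite_coeff f \<mu>))"
      by (simp add: c_def mult_ac)
    also have "\<dots> = ennreal c * ennreal (norm (hermite_coeff f \<mu>))"
      using c by (simp add: ennreal_mult)
    also have "\<dots> \<le> ennreal c * (\<integral>\<^sup>+y. ennreal (norm (f y) * \<bar>hermite_fun_vec \<mu> y\<bar>) \<partial>lborel)"
      by (intro mult_left_mono norm_hermite_coeff_le) simp
    also have "(\<integral>\<^sup>+y. ennreal (norm (f y) * \<bar>hermite_fun_vec \<mu> y\<bar>) \<partial>lborel) = (\<integral>\<^sup>+y. ennreal (u y * \<bar>hermite_fun_vec \<mu> y\<bar>) \<partial>lborel)"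
      using u by (intro nn_integral_cong_AE) auto
    also have "ennreal c * \<dots> = (\<integral>\<^sup>+y. ennreal c * ennreal (u y * \<bar>hermite_fun_vec \<mu> y\<bar>) \<partial>lborel)"
      by (intro nn_integral_cmult[symmetric]) measurable
    also have "\<dots> = (\<integral>\<^sup>+y. ennreal (u y) * ennreal (c * \<bar>hermite_fun_vec \<mu> y\<bar>) \<partial>lborel)"
      using c u0 by (intro nn_integral_cong) (simp add: mult_ac flip: ennreal_mult)
    finally show "ennreal (index_weight \<tau> \<mu> * norm (hermite_coeff f \<mu>) * \<bar>hermite_fun_vec \<mu> x\<bar>) \<le>
        (\<integral>\<^sup>+y. ennreal (u y) * ennreal (index_weight \<tau> \<mu> * \<bar>hermite_fun_vec \<mu> x\<bar> * \<bar>hermite_fun_vec \<mu> y\<bar>) \<partial>lborel)"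
      unfolding c_def .
  qed
  also have "\<dots> = (\<integral>\<^sup>+y. (\<Sum>\<mu>\<in>index_box N. ennreal (u y) * ennreal (index_weight \<tau> \<mu> * \<bar>hermite_fun_vec \<mu> x\<bar> * \<bar>hermite_fun_vec \<mu> y\<bar>)) \<partial>lborel)"
    by (rule nn_integral_sum[symmetric]) measurable
  also have "\<dots> \<le> (\<integral>\<^sup>+y. ennreal (u y) * vec_kernel \<tau> x y \<partial>lborel)"
    unfolding sum_distrib_left[symmetric] by (intro nn_integral_mono mult_left_mono sum_le_vec_kernel) simp
  also have "\<dots> = kernel_op \<tau> f x"
    by (rule kernel_op_cong[OF u, symmetric])
  finally show ?thesis .
qed

lemma enn2real_ge_1: "1 \<le> P \<Longrightarrow> P \<noteq> (\<infinity>::ennreal) \<Longrightarrow> 1 \<le> enn2real P"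
  by (metis enn2real_1 enn2real_mono infinity_ennreal_def less_top)

section \<open>The positive operator on a single Lebesgue space\<close>

context
  fixes f :: "real ^ 'n \<Rightarrow> complex" and P :: ennreal and \<tau> :: real
  assumes f: "f \<in> Lp_space P" and P: "1 \<le> P" and \<tau>: "\<tau> > 1"
begin

text \<open>The factor 2 makes the constant agree with the one that Schur's test gives at finite
  exponents.\<close>

lemma kernel_op_infinity_le:
  assumes "P = \<infinity>"
  shows "kernel_op \<tau> f x \<le> ennreal (2 * kernel_bound TYPE('n) \<tau> * enn2real (Lp_norm P f))"
proof -
  define N where "N = enn2real (Lp_norm P f)"
  have "AE y in lebesgue. ennreal (norm (f y)) \<le> Lp_norm P f"
    unfolding Lp_norm_def using esssup_AE[of "\<lambda>y. ennreal (norm (f y))" lebesgue] by (simp add: assms)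
  moreover have "Lp_norm P f = ennreal N"
    using f by (simp add: Lp_space_def N_def)
  ultimately have "AE y in lborel. ennreal (norm (f y)) \<le> ennreal N"
    by (simp add: AE_completion_iff)
  then have "kernel_op \<tau> f x \<le> (\<integral>\<^sup>+y. ennreal N * vec_kernel \<tau> x y \<partial>lborel)"
    unfolding kernel_op_def
    by (intro nn_integral_mono_AE) (auto elim!: eventually_mono intro: mult_right_mono)
  also have "\<dots> = ennreal N * (\<integral>\<^sup>+y. vec_kernel \<tau> x y \<partial>lborel)"
    by (rule nn_integral_cmult) measurable
  also have "\<dots> \<le> ennreal N * ennreal (2 * kernel_bound TYPE('n) \<tau>)"
    using kernel_bound_pos[OF \<tau>, of "TYPE('n)"]
    by (intro mult_left_mono order_trans[OF nn_integral_vec_kernel_le[OF \<tau>]] ennreal_leI) auto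
  also have "\<dots> = ennreal (2 * kernel_bound TYPE('n) \<tau> * N)"
    using kernel_bound_pos[OF \<tau>, of "TYPE('n)"] by (simp add: N_def mult_ac flip: ennreal_mult)
  finally show ?thesis
    unfolding N_def .
qed

lemma Lp_integral_representative:
  assumes "P \<noteq> \<infinity>" "AE y in lborel. norm (f y) = u y"
  shows "(\<integral>\<^sup>+y. ennreal (u y powr enn2real P) \<partial>lborel) = ennreal (enn2real (Lp_norm P f) powr enn2real P)"
proof -
  define q where "q = enn2real P"
  have q: "P = ennreal q" "q \<ge> 1"
    using assms(1) P enn2real_ge_1 by (auto simp: q_def less_top)
  have "(\<integral>\<^sup>+y. ennreal (u y powr q) \<partial>lborel) = (\<integral>\<^sup>+y. ennreal (norm (f y) powr q) \<partial>lborel)"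
    using assms(2) by (intro nn_integral_cong_AE) auto
  also have "\<dots> = ennreal (enn2real (Lp_norm (ennreal q) f) powr q)"
    using Lp_norm_finiteD[of q f] f q by (simp add: Lp_space_def nn_integral_completion)
  finally show ?thesis
    using q by simp
qed

text \<open>By u \<le> 1 + u^q: the 1 meets the integrability of the kernel, u^q its boundedness.
  Finiteness at every x matters because \<open>enn2real\<close> sends \<infinity> to 0, which would
  destroy pointwise domination.\<close>

lemma kernel_op_finite: "kernel_op \<tau> f x < \<infinity>"
proof (cases "P = \<infinity>")
  case True
  show ?thesis
    using kernel_op_infinity_le[OF True] by (rule le_less_trans) simp
next
  case False
  from f have "f \<in> borel_measurable lebesgue"
    by (simp add: Lp_space_def)
  then obtain u where [measurable]: "u \<in> borel_measurable borel" and u0: "\<And>y. u y \<ge> 0"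
    and u: "AE y in lborel. norm (f y) = u y"
    by (rule lebesgue_norm_borel_representative) blast
  define q where "q = enn2real P"
  have q: "q \<ge> 1"
    using enn2real_ge_1[OF P False] by (simp add: q_def)
  have "kernel_op \<tau> f x = (\<integral>\<^sup>+y. ennreal (u y) * vec_kernel \<tau> x y \<partial>lborel)"
    by (rule kernel_op_cong[OF u])
  also have "\<dots> \<le> (\<integral>\<^sup>+y. vec_kernel \<tau> x y + ennreal (u y powr q) * ennreal (kernel_bound TYPE('n) \<tau>) \<partial>lborel)"
  proof (rule nn_integral_mono)
    fix y
    have "u y \<le> 1 + u y powr q"
    proof (cases "u y \<le> 1")
      case False
      then show ?thesis
        using powr_mono[of 1 q "u y"] q by simp
    qed (simp add: add_increasing2)
    then have "ennreal (u y) \<le> 1 + ennreal (u y powr q)"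
      using u0 by (simp add: ennreal_leI flip: ennreal_1 ennreal_plus del: ennreal_1)
    then have "ennreal (u y) * vec_kernel \<tau> x y \<le> (1 + ennreal (u y powr q)) * vec_kernel \<tau> x y"
      by (rule mult_right_mono) simp
    also have "\<dots> = vec_kernel \<tau> x y + ennreal (u y powr q) * vec_kernel \<tau> x y"
      by (simp add: distrib_right)
    also have "\<dots> \<le> vec_kernel \<tau> x y + ennreal (u y powr q) * ennreal (kernel_bound TYPE('n) \<tau>)"
      by (intro add_left_mono mult_left_mono vec_kernel_le \<tau>) simp
    finally show "ennreal (u y) * vec_kernel \<tau> x y \<le> vec_kernel \<tau> x y + ennreal (u y powr q) * ennreal (kernel_bound TYPE('n) \<tau>)" .
  qed
  also have "\<dots> = (\<integral>\<^sup>+y. vec_kernel \<tau> x y \<partial>lborel) + (\<integral>\<^sup>+y. ennreal (u y powr q) \<partial>lborel) * ennreal (kernel_bound TYPE('n) \<tau>)"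
    by (simp add: nn_integral_add nn_integral_multc)
  also have "\<dots> < \<infinity>"
    using le_less_trans[OF nn_integral_vec_kernel_le[OF \<tau>, of x]] Lp_integral_representative[OF False u]
    by (simp add: q_def ennreal_mult_less_top)
  finally show ?thesis .
qed

lemma nn_integral_kernel_op_le:
  assumes "P \<noteq> \<infinity>"
  shows "(\<integral>\<^sup>+x. ennreal (enn2real (kernel_op \<tau> f x) powr enn2real P) \<partial>lborel)
    \<le> ennreal ((2 * kernel_bound TYPE('n) \<tau> * enn2real (Lp_norm P f)) powr enn2real P)"
proof -
  from f have "f \<in> borel_measurable lebesgue"
    by (simp add: Lp_space_def)
  then obtain u where um: "u \<in> borel_measurable borel" and u0: "\<And>y. u y \<ge> 0"
    and u: "AE y in lborel. norm (f y) = u y"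
    by (rule lebesgue_norm_borel_representative) blast
  have "(\<integral>\<^sup>+x. ennreal (enn2real (kernel_op \<tau> f x) powr enn2real P) \<partial>lborel) \<le>
      ennreal ((2 * kernel_bound TYPE('n) \<tau>) powr enn2real P) * (\<integral>\<^sup>+y. ennreal (u y powr enn2real P) \<partial>lborel)"
    unfolding kernel_op_cong[OF u]
  proof (rule Schur_test[OF sigma_finite_lborel])
    show "(\<lambda>(x, y). vec_kernel \<tau> x y) \<in> borel_measurable (lborel \<Otimes>\<^sub>M lborel)"
      by measurable
    show "(\<integral>\<^sup>+y. vec_kernel \<tau> x y \<partial>lborel) \<le> ennreal (kernel_bound TYPE('n) \<tau>)" for x :: "real ^ 'n"
      by (rule nn_integral_vec_kernel_le[OF \<tau>])
    then show "(\<integral>\<^sup>+x. vec_kernel \<tau> x y \<partial>lborel) \<le> ennreal (kernel_bound TYPE('n) \<tau>)" for y :: "real ^ 'n"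
      by (subst vec_kernel_commute)
  qed (use um u0 kernel_bound_pos[OF \<tau>] enn2real_ge_1[OF P assms] in auto)
  also have "\<dots> = ennreal ((2 * kernel_bound TYPE('n) \<tau>) powr enn2real P) * ennreal (enn2real (Lp_norm P f) powr enn2real P)"
    by (simp only: Lp_integral_representative[OF assms u])
  also have "\<dots> = ennreal ((2 * kernel_bound TYPE('n) \<tau> * enn2real (Lp_norm P f)) powr enn2real P)"
    by (simp add: powr_mult ennreal_mult)
  finally show ?thesis .
qed

text \<open>Settles vanishing norms, by which the normalization in Hoelder's inequality cannot
  divide.\<close>

lemma kernel_op_eq_0:
  assumes "Lp_norm P f = 0"
  shows "kernel_op \<tau> f x = 0"
proof (cases "P = \<infinity>")
  case True
  then show ?thesis
    using kernel_op_infinity_le[OF True, of x] assms by simp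
next
  case False
  from f have "f \<in> borel_measurable lebesgue"
    by (simp add: Lp_space_def)
  then obtain u where [measurable]: "u \<in> borel_measurable borel" and u0: "\<And>y. u y \<ge> 0"
    and u: "AE y in lborel. norm (f y) = u y"
    by (rule lebesgue_norm_borel_representative) blast
  have "(\<integral>\<^sup>+y. ennreal (u y powr enn2real P) \<partial>lborel) = 0"
    using Lp_integral_representative[OF False u] assms by simp
  then have "AE y in lborel. ennreal (u y powr enn2real P) = 0"
    by (subst (asm) nn_integral_0_iff_AE) auto
  then have "AE y in lborel. ennreal (u y) * vec_kernel \<tau> x y = 0"
    by eventually_elim simp
  then have "(\<integral>\<^sup>+y. ennreal (u y) * vec_kernel \<tau> x y \<partial>lborel) = (\<integral>\<^sup>+y. 0 \<partial>(lborel :: (real ^ 'n) measure))"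
    by (rule nn_integral_cong_AE)
  then show ?thesis
    unfolding kernel_op_cong[OF u] by simp
qed

text \<open>At a point x where the Hermite function does not vanish, the kernel dominates a positive
  multiple of its absolute value at y, so finiteness of \<open>kernel_op\<close> at x gives
  integrability. Linearity of the coefficients in f rests on this.\<close>

lemma integrable_hermite_coeff: "integrable lebesgue (\<lambda>y. f y * of_real (hermite_fun_vec \<mu> y))"
proof (rule integrableI_bounded)
  have [measurable]: "f \<in> borel_measurable lebesgue" "hermite_fun_vec \<mu> \<in> borel_measurable lebesgue"
    using f by (auto simp: Lp_space_def intro: measurable_completion)
  show "(\<lambda>y. f y * of_real (hermite_fun_vec \<mu> y)) \<in> borel_measurable lebesgue"
    by measurable
  \<comment> \<open>The zero function does not have L^2 norm 1.\<close>
  have "\<exists>t. hermite_fun a t \<noteq> 0" for a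
    using hermite_fun_orthonormal[of a a] by (rule_tac ccontr) simp
  then obtain t where t: "\<And>a. hermite_fun a (t a) \<noteq> 0"
    by metis
  define x :: "real ^ 'n" where "x = (\<chi> j. t (\<mu> $ j))"
  define c where "c = index_weight \<tau> \<mu> * \<bar>hermite_fun_vec \<mu> x\<bar>"
  have c: "c > 0"
    using t index_weight_pos[of \<tau> \<mu>] by (simp add: c_def x_def hermite_fun_vec_def)
  have "(\<integral>\<^sup>+y. ennreal (norm (f y) * \<bar>hermite_fun_vec \<mu> y\<bar>) \<partial>lborel) \<le>
      (\<integral>\<^sup>+y. ennreal (1 / c) * (ennreal (norm (f y)) * vec_kernel \<tau> x y) \<partial>lborel)"
  proof (rule nn_integral_mono)
    fix y
    have "norm (f y) * \<bar>hermite_fun_vec \<mu> y\<bar> = (1 / c) * (norm (f y) * (c * \<bar>hermite_fun_vec \<mu> y\<bar>))"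
      using c by simp
    then have "ennreal (norm (f y) * \<bar>hermite_fun_vec \<mu> y\<bar>) = ennreal (1 / c) * (ennreal (norm (f y)) * ennreal (c * \<bar>hermite_fun_vec \<mu> y\<bar>))"
      using c by (simp only: ennreal_mult mult_nonneg_nonneg norm_ge_zero abs_ge_zero less_imp_le zero_le_divide_1_iff)
    also have "\<dots> \<le> ennreal (1 / c) * (ennreal (norm (f y)) * vec_kernel \<tau> x y)"
      unfolding c_def by (intro mult_left_mono term_le_vec_kernel) auto
    finally show "ennreal (norm (f y) * \<bar>hermite_fun_vec \<mu> y\<bar>) \<le> ennreal (1 / c) * (ennreal (norm (f y)) * vec_kernel \<tau> x y)" .
  qed
  also have "\<dots> = ennreal (1 / c) * kernel_op \<tau> f x"
  proof -
    have "f \<in> borel_measurable lebesgue"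
      by measurable
    then obtain u where [measurable]: "u \<in> borel_measurable borel" and u: "AE y in lborel. norm (f y) = u y"
      by (rule lebesgue_norm_borel_representative)
    have "(\<integral>\<^sup>+y. ennreal (1 / c) * (ennreal (norm (f y)) * vec_kernel \<tau> x y) \<partial>lborel) =
        (\<integral>\<^sup>+y. ennreal (1 / c) * (ennreal (u y) * vec_kernel \<tau> x y) \<partial>lborel)"
      using u by (intro nn_integral_cong_AE) auto
    also have "\<dots> = ennreal (1 / c) * (\<integral>\<^sup>+y. ennreal (u y) * vec_kernel \<tau> x y \<partial>lborel)"
      by (rule nn_integral_cmult) measurable
    finally show ?thesis
      by (simp only: kernel_op_cong[OF u])
  qed
  also have "\<dots> < \<infinity>"
    using kernel_op_finite[of x] by (simp add: ennreal_mult_less_top)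
  finally show "(\<integral>\<^sup>+y. ennreal (norm (f y * of_real (hermite_fun_vec \<mu> y))) \<partial>lebesgue) < \<infinity>"
    by (simp add: norm_mult nn_integral_completion)
qed

end

section \<open>The multilinear series: convergence, measurability, linearity, norm bound\<close>

definition multi_box :: "nat \<Rightarrow> (nat ^ 'n ^ 'k) set" where
  "multi_box N = {\<nu>. \<forall>i. \<nu> $ i \<in> index_box N}"

lemma finite_multi_box [simp]: "finite (multi_box N)"
  unfolding multi_box_def by (rule finite_vec_Collect) simp

lemma subset_multi_box:
  fixes F :: "(nat ^ 'n ^ 'k) set"
  assumes "finite F"
  shows "\<forall>\<^sub>F N in sequentially. F \<subseteq> multi_box N"
proof -
  have "finite ((\<lambda>(\<nu>, i, j). \<nu> $ i $ j) ` (F \<times> UNIV \<times> UNIV))"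
    using assms by simp
  then obtain N0 where N0: "\<forall>a\<in>(\<lambda>(\<nu>, i, j). \<nu> $ i $ j) ` (F \<times> UNIV \<times> UNIV). a < N0"
    unfolding finite_nat_set_iff_bounded by blast
  have "F \<subseteq> multi_box N" if "N0 \<le> N" for N
  proof
    fix \<nu> assume "\<nu> \<in> F"
    have "\<nu> $ i $ j < N" for i j
    proof -
      have "\<nu> $ i $ j \<in> (\<lambda>(\<nu>, i, j). \<nu> $ i $ j) ` (F \<times> UNIV \<times> UNIV)"
        using \<open>\<nu> \<in> F\<close> by (intro image_eqI[of _ _ "(\<nu>, i, j)"]) auto
      then show ?thesis
        using N0 that by (meson less_le_trans)
    qed
    then show "\<nu> \<in> multi_box N"
      by (simp add: multi_box_def index_box_def)
  qed
  then show ?thesis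
    by (rule eventually_sequentiallyI)
qed

text \<open>Boxes exhaust the indices along a sequence, so the unordered sum is a sequential limit,
  and such limits preserve measurability.\<close>

lemma filterlim_multi_box: "filterlim multi_box (finite_subsets_at_top (UNIV :: (nat ^ 'n ^ 'k) set)) sequentially"
  unfolding filterlim_finite_subsets_at_top by (auto elim!: eventually_mono dest: subset_multi_box)

definition multiplier_term ::
    "(real ^ 'n \<Rightarrow> nat ^ 'n ^ 'k \<Rightarrow> complex) \<Rightarrow> ('k \<Rightarrow> real ^ 'n \<Rightarrow> complex) \<Rightarrow> real ^ 'n \<Rightarrow> nat ^ 'n ^ 'k \<Rightarrow> complex" where
  "multiplier_term m f x \<nu> = m x \<nu> * (\<Prod>i\<in>UNIV. hermite_coeff (f i) (\<nu> $ i)) *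
     (\<Prod>i\<in>UNIV. of_real (hermite_fun_vec (\<nu> $ i) x))"

lemma pseudo_multiplier_eq: "pseudo_multiplier m f x = (\<Sum>\<^sub>\<infinity>\<nu>. multiplier_term m f x \<nu>)"
  by (simp add: pseudo_multiplier_def multiplier_term_def)

context
  fixes m :: "real ^ 'n \<Rightarrow> nat ^ 'n ^ 'k \<Rightarrow> complex" and \<tau> C :: real and P :: "'k \<Rightarrow> ennreal"
  assumes m_meas: "\<And>\<nu>. (\<lambda>x. m x \<nu>) \<in> borel_measurable lebesgue"
    and m_le: "\<And>x \<nu>. norm (m x \<nu>) \<le> C * (\<Prod>i\<in>UNIV. index_weight \<tau> (\<nu> $ i))"
    and C: "C \<ge> 0" and \<tau>: "\<tau> > 1" and P: "\<And>i. 1 \<le> P i"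
begin

text \<open>A finite set of multi-indices lies in a box, where the sum of products over the blocks
  factors into one sum for each f i, bounded by the positive operator.\<close>

lemma sum_norm_multiplier_term_le:
  assumes f: "\<And>i. f i \<in> Lp_space (P i)" and "finite F"
  shows "(\<Sum>\<nu>\<in>F. norm (multiplier_term m f x \<nu>)) \<le> C * (\<Prod>i\<in>UNIV. enn2real (kernel_op \<tau> (f i) x))"
proof -
  define G where "G i \<mu> = index_weight \<tau> \<mu> * norm (hermite_coeff (f i) \<mu>) * \<bar>hermite_fun_vec \<mu> x\<bar>" for i \<mu>
  have G0: "G i \<mu> \<ge> 0" for i \<mu>
    using index_weight_pos[of \<tau> \<mu>] by (simp add: G_def)
  obtain N where N: "F \<subseteq> multi_box N"
    using eventually_happens'[OF _ subset_multi_box[OF assms(2)]] by auto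
  have "(\<Sum>\<nu>\<in>F. norm (multiplier_term m f x \<nu>)) \<le> (\<Sum>\<nu>\<in>F. C * (\<Prod>i\<in>UNIV. G i (\<nu> $ i)))"
  proof (rule sum_mono)
    fix \<nu>
    have "norm (multiplier_term m f x \<nu>) =
        norm (m x \<nu>) * ((\<Prod>i\<in>UNIV. norm (hermite_coeff (f i) (\<nu> $ i))) * (\<Prod>i\<in>UNIV. \<bar>hermite_fun_vec (\<nu> $ i) x\<bar>))"
      by (simp add: multiplier_term_def norm_mult prod_norm[symmetric])
    also have "\<dots> \<le> (C * (\<Prod>i\<in>UNIV. index_weight \<tau> (\<nu> $ i))) *
        ((\<Prod>i\<in>UNIV. norm (hermite_coeff (f i) (\<nu> $ i))) * (\<Prod>i\<in>UNIV. \<bar>hermite_fun_vec (\<nu> $ i) x\<bar>))"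
      by (intro mult_right_mono m_le mult_nonneg_nonneg prod_nonneg) auto
    also have "\<dots> = C * (\<Prod>i\<in>UNIV. G i (\<nu> $ i))"
      by (simp add: G_def prod.distrib mult_ac)
    finally show "norm (multiplier_term m f x \<nu>) \<le> C * (\<Prod>i\<in>UNIV. G i (\<nu> $ i))" .
  qed
  also have "\<dots> \<le> (\<Sum>\<nu>\<in>multi_box N. C * (\<Prod>i\<in>UNIV. G i (\<nu> $ i)))"
    using N G0 C by (intro sum_mono2) (auto intro!: mult_nonneg_nonneg prod_nonneg)
  also have "\<dots> = C * (\<Prod>i\<in>UNIV. \<Sum>\<mu>\<in>index_box N. G i \<mu>)"
    unfolding multi_box_def sum_distrib_left[symmetric] by (subst sum_prod_vec) auto
  also have "\<dots> \<le> C * (\<Prod>i\<in>UNIV. enn2real (kernel_op \<tau> (f i) x))"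
  proof (intro mult_left_mono prod_mono conjI C sum_nonneg G0)
    fix i :: 'k
    have "f i \<in> borel_measurable lebesgue"
      using f[of i] by (simp add: Lp_space_def)
    then have "ennreal (\<Sum>\<mu>\<in>index_box N. G i \<mu>) \<le> kernel_op \<tau> (f i) x"
      using sum_hermite_coeff_le_kernel_op[of "f i" \<tau> x N] G0 by (simp add: G_def sum_ennreal[symmetric] del: sum_ennreal)
    moreover have "kernel_op \<tau> (f i) x < \<infinity>"
      by (rule kernel_op_finite[OF f P \<tau>])
    ultimately show "(\<Sum>\<mu>\<in>index_box N. G i \<mu>) \<le> enn2real (kernel_op \<tau> (f i) x)"
      using G0 enn2real_mono[of "ennreal (\<Sum>\<mu>\<in>index_box N. G i \<mu>)" "kernel_op \<tau> (f i) x"] by (simp add: sum_nonneg)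
  qed
  finally show ?thesis .
qed

lemma abs_summable_multiplier_term:
  assumes "\<And>i. f i \<in> Lp_space (P i)"
  shows "(\<lambda>\<nu>. norm (multiplier_term m f x \<nu>)) summable_on UNIV"
  unfolding abs_summable_iff_bdd_above
  by (rule bdd_aboveI2, rule sum_norm_multiplier_term_le[OF assms]) auto

lemma norm_pseudo_multiplier_le:
  assumes "\<And>i. f i \<in> Lp_space (P i)"
  shows "norm (pseudo_multiplier m f x) \<le> C * (\<Prod>i\<in>UNIV. enn2real (kernel_op \<tau> (f i) x))"
  unfolding pseudo_multiplier_eq
  by (rule order_trans[OF norm_infsum_bound infsum_le_finite_sums])
     (auto intro: abs_summable_multiplier_term sum_norm_multiplier_term_le assms)

lemma borel_measurable_pseudo_multiplier:
  assumes "\<And>i. f i \<in> Lp_space (P i)"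
  shows "pseudo_multiplier m f \<in> borel_measurable lebesgue"
proof (rule borel_measurable_LIMSEQ_metric)
  have "hermite_fun_vec \<mu> \<in> borel_measurable lebesgue" for \<mu> :: "nat ^ 'n"
    by (auto intro: measurable_completion)
  note [measurable] = this m_meas
  show "(\<lambda>x. \<Sum>\<nu>\<in>multi_box N. multiplier_term m f x \<nu>) \<in> borel_measurable lebesgue" for N
    unfolding multiplier_term_def by measurable
  show "(\<lambda>N. \<Sum>\<nu>\<in>multi_box N. multiplier_term m f x \<nu>) \<longlonglongrightarrow> pseudo_multiplier m f x" for x
    unfolding pseudo_multiplier_eq
    using infsum_tendsto[OF abs_summable_summable[OF abs_summable_multiplier_term[OF assms]]] filterlim_multi_box
    by (rule filterlim_compose)
qed

text \<open>In each term only the factor of block i involves the varied function; summability of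
  both series lets the sum be split, at every x.\<close>

lemma pseudo_multiplier_linear:
  assumes f: "\<And>i. f i \<in> Lp_space (P i)" and g: "g \<in> Lp_space (P i)" and h: "h \<in> Lp_space (P i)"
  shows "pseudo_multiplier m (f(i := \<lambda>y. a * g y + b * h y)) x =
    a * pseudo_multiplier m (f(i := g)) x + b * pseudo_multiplier m (f(i := h)) x"
proof -
  have coeff: "hermite_coeff (\<lambda>y. a * g y + b * h y) \<mu> = a * hermite_coeff g \<mu> + b * hermite_coeff h \<mu>" for \<mu>
  proof -
    have "hermite_coeff (\<lambda>y. a * g y + b * h y) \<mu> =
        (\<integral>y. a * (g y * of_real (hermite_fun_vec \<mu> y)) + b * (h y * of_real (hermite_fun_vec \<mu> y)) \<partial>lebesgue)"
      unfolding hermite_coeff_def by (simp add: distrib_right mult.assoc)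
    also have "\<dots> = a * hermite_coeff g \<mu> + b * hermite_coeff h \<mu>"
      using integrable_hermite_coeff[OF g P \<tau>] integrable_hermite_coeff[OF h P \<tau>]
      by (simp add: hermite_coeff_def)
    finally show ?thesis .
  qed
  have upd: "(\<Prod>l\<in>UNIV. hermite_coeff ((f(i := u)) l) (\<nu> $ l)) =
      hermite_coeff u (\<nu> $ i) * (\<Prod>l\<in>UNIV - {i}. hermite_coeff (f l) (\<nu> $ l))" for u and \<nu> :: "nat ^ 'n ^ 'k"
    by (subst prod.remove[of _ i]) (auto intro!: prod.cong)
  have lin: "multiplier_term m (f(i := \<lambda>y. a * g y + b * h y)) x \<nu> =
      a * multiplier_term m (f(i := g)) x \<nu> + b * multiplier_term m (f(i := h)) x \<nu>" for \<nu>
    unfolding multiplier_term_def upd coeff by (simp add: algebra_simps)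
  have sm: "multiplier_term m (f(i := u)) x summable_on UNIV" if "u \<in> Lp_space (P i)" for u
  proof (rule abs_summable_summable[OF abs_summable_multiplier_term])
    show "(f(i := u)) l \<in> Lp_space (P l)" for l
      using that f[of l] by (cases "l = i") simp_all
  qed
  show ?thesis
    unfolding pseudo_multiplier_eq lin
    by (simp only: infsum_add[OF summable_on_cmult_right[OF sm[OF g]] summable_on_cmult_right[OF sm[OF h]]] infsum_cmult_right')
qed

text \<open>Hoelder's inequality for the product of the positive operators, each bounded on its own
  space with the same constant A.\<close>

lemma Lp_norm_pseudo_multiplier_le:
  assumes f: "\<And>i. f i \<in> Lp_space (P i)" and p: "1 \<le> p" "inverse p = (\<Sum>i\<in>UNIV. inverse (P i))"
  shows "Lp_norm p (pseudo_multiplier m f) \<le>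
    ennreal (C * (2 * kernel_bound TYPE('n) \<tau>) ^ CARD('k)) * (\<Prod>i\<in>UNIV. Lp_norm (P i) (f i))"
proof -
  define A where "A = 2 * kernel_bound TYPE('n) \<tau>"
  have A: "A > 0"
    using kernel_bound_pos[OF \<tau>] by (simp add: A_def)
  define N where "N i = enn2real (Lp_norm (P i) (f i))" for i
  define g where "g i x = enn2real (kernel_op \<tau> (f i) x)" for i x
  have fm: "f i \<in> borel_measurable lebesgue" for i
    using f[of i] by (simp add: Lp_space_def)
  have [measurable]: "g i \<in> borel_measurable borel" for i
    unfolding g_def[abs_def] using borel_measurable_kernel_op[OF fm[of i]] by measurable
  have g0: "g i x \<ge> 0" for i x
    by (simp add: g_def)
  have N0: "N i \<ge> 0" for i
    by (simp add: N_def)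
  have LN: "Lp_norm (P i) (f i) = ennreal (N i)" for i
    using f[of i] by (simp add: Lp_space_def N_def)
  have Tle: "norm (pseudo_multiplier m f x) \<le> C * (\<Prod>i\<in>UNIV. g i x)" for x
    using norm_pseudo_multiplier_le[OF f] by (simp add: g_def)
  have rhs: "ennreal (C * A ^ CARD('k)) * (\<Prod>i\<in>UNIV. Lp_norm (P i) (f i)) = ennreal (C * (\<Prod>i\<in>UNIV. A * N i))"
    using A C N0 by (simp add: LN prod_ennreal prod.distrib prod_nonneg mult.assoc flip: ennreal_mult)
  have g_inf: "g i x \<le> A * N i" if "P i = \<infinity>" for i x
    using kernel_op_infinity_le[OF f P \<tau> that, of x] A N0
    by (simp add: g_def N_def A_def enn2real_leI)
  have Tm: "(\<lambda>x. ennreal (norm (pseudo_multiplier m f x))) \<in> borel_measurable lebesgue"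
    using borel_measurable_pseudo_multiplier[OF f] by measurable
  have "Lp_norm p (pseudo_multiplier m f) \<le> ennreal (C * (\<Prod>i\<in>UNIV. A * N i))"
  proof (cases "p = \<infinity>")
    case True
    \<comment> \<open>The reciprocals are nonnegative and add up to 0.\<close>
    then have Pinf: "P i = \<infinity>" for i
      using p(2) by auto
    have "norm (pseudo_multiplier m f x) \<le> C * (\<Prod>i\<in>UNIV. A * N i)" for x
      using C g0 g_inf[OF Pinf] by (intro order_trans[OF Tle] mult_left_mono prod_mono) auto
    then have "esssup lebesgue (\<lambda>x. ennreal (norm (pseudo_multiplier m f x))) \<le> ennreal (C * (\<Prod>i\<in>UNIV. A * N i))"
      by (intro esssup_I Tm AE_I2 ennreal_leI)
    then show ?thesis
      by (simp add: True Lp_norm_def)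
  next
    case False
    define r where "r = enn2real p"
    have r: "p = ennreal r" "r \<ge> 1"
      using False enn2real_ge_1[OF p(1)] by (auto simp: r_def less_top)
    define F where "F = {i. P i \<noteq> \<infinity>}"
    define q where "q i = enn2real (P i)" for i
    have q: "P i = ennreal (q i)" "q i \<ge> 1" if "i \<in> F" for i
      using that enn2real_ge_1[OF P] by (auto simp: q_def F_def less_top)
    show ?thesis
    \<comment> \<open>A zero norm makes the whole series vanish; otherwise every A * N i is positive
      and can be divided by.\<close>
    proof (cases "\<exists>i. N i = 0")
      case True
      then obtain i where "N i = 0"
        by blast
      then have "g i x = 0" for x
        using kernel_op_eq_0[OF f P \<tau>, of i x] by (simp add: g_def LN)
      then have prod0: "(\<Prod>i\<in>UNIV. g i x) = 0" for x
        by (auto intro!: prod_zero)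
      have "pseudo_multiplier m f x = 0" for x
        using Tle[of x] unfolding prod0 by simp
      then have "Lp_norm p (pseudo_multiplier m f) \<le> ennreal 0"
        unfolding r(1) using r(2) by (intro Lp_norm_leI) auto
      then show ?thesis
        by simp
    next
      case False
      then have Npos: "A * N i > 0" for i
        using N0[of i] A by (simp add: order_less_le)
      have "ennreal (1 / r) = inverse p"
        using r by (simp add: inverse_ennreal inverse_eq_divide)
      also have "\<dots> = (\<Sum>i\<in>F. inverse (P i))"
        unfolding p(2) by (rule sum.mono_neutral_right) (auto simp: F_def)
      also have "\<dots> = (\<Sum>i\<in>F. ennreal (1 / q i))"
      proof (intro sum.cong refl)
        fix i assume "i \<in> F"
        from q[OF this] show "inverse (P i) = ennreal (1 / q i)"
          by (simp add: inverse_ennreal inverse_eq_divide)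
      qed
      also have "\<dots> = ennreal (\<Sum>i\<in>F. 1 / q i)"
        using q(2) by (intro sum_ennreal) force
      finally have "ennreal (1 / r) = ennreal (\<Sum>i\<in>F. 1 / q i)" .
      moreover have "(\<Sum>i\<in>F. 1 / q i) \<ge> 0"
        using q(2) by (intro sum_nonneg) force
      ultimately have sum_q: "(\<Sum>i\<in>F. 1 / q i) = 1 / r"
        using r(2) by (simp add: ennreal_inj)
      have "(\<integral>\<^sup>+x. ennreal ((\<Prod>i\<in>UNIV. g i x) powr r) \<partial>lborel) \<le> ennreal ((\<Prod>i\<in>UNIV. A * N i) powr r)"
      proof (rule nn_integral_prod_powr_le[OF _ g0 Npos _ _ sum_q])
        show "(\<integral>\<^sup>+x. ennreal (g i x powr q i) \<partial>lborel) \<le> ennreal ((A * N i) powr q i)" if "i \<in> F" for i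
          using nn_integral_kernel_op_le[OF f P \<tau>, of i] that by (simp add: g_def q_def N_def A_def F_def)
        show "g i x \<le> A * N i" if "i \<notin> F" for i x
          using that by (intro g_inf) (simp add: F_def)
        show "q i > 0" if "i \<in> F" for i
          using q(2)[OF that] by simp
      qed (use r(2) in auto)
      note int_g = this
      have "(\<integral>\<^sup>+x. ennreal (norm (pseudo_multiplier m f x) powr r) \<partial>lborel) \<le>
          (\<integral>\<^sup>+x. ennreal (C powr r) * ennreal ((\<Prod>i\<in>UNIV. g i x) powr r) \<partial>lborel)"
      proof (rule nn_integral_mono)
        fix x
        have "norm (pseudo_multiplier m f x) powr r \<le> (C * (\<Prod>i\<in>UNIV. g i x)) powr r"
          using Tle[of x] r(2) by (intro powr_mono2) auto
        then show "ennreal (norm (pseudo_multiplier m f x) powr r) \<le> ennreal (C powr r) * ennreal ((\<Prod>i\<in>UNIV. g i x) powr r)"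
          by (simp add: powr_mult ennreal_leI flip: ennreal_mult)
      qed
      also have "\<dots> = ennreal (C powr r) * (\<integral>\<^sup>+x. ennreal ((\<Prod>i\<in>UNIV. g i x) powr r) \<partial>lborel)"
        by (rule nn_integral_cmult) measurable
      also have "\<dots> \<le> ennreal (C powr r) * ennreal ((\<Prod>i\<in>UNIV. A * N i) powr r)"
        by (intro mult_left_mono int_g) simp
      also have "\<dots> = ennreal ((C * (\<Prod>i\<in>UNIV. A * N i)) powr r)"
        by (simp add: powr_mult ennreal_mult)
      finally show ?thesis
        unfolding r(1) using r(2) C Npos
        by (intro Lp_norm_leI mult_nonneg_nonneg prod_nonneg ballI less_imp_le[OF Npos]) (auto simp: nn_integral_completion)
    qed
  qed
  then show ?thesis
    using rhs by (simp add: A_def)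
qed

text \<open>The series converges absolutely for all L^p arguments, so the operator is its own
  extension and agrees trivially on test functions. No density argument intervenes, which matters
  when an exponent is \<infinity>.\<close>

lemma extends_to_bounded_multilinear_pseudo_multiplier:
  assumes "1 \<le> p" "inverse p = (\<Sum>i\<in>UNIV. inverse (P i))"
  shows "extends_to_bounded_multilinear (pseudo_multiplier m) P p"
  unfolding extends_to_bounded_multilinear_def
proof (intro exI[of _ "pseudo_multiplier m"] conjI allI impI)
  fix f :: "'k \<Rightarrow> real ^ 'n \<Rightarrow> complex"
  assume f: "\<forall>i. f i \<in> Lp_space (P i)"
  have "Lp_norm p (pseudo_multiplier m f) \<le>
      ennreal (C * (2 * kernel_bound TYPE('n) \<tau>) ^ CARD('k)) * (\<Prod>i\<in>UNIV. Lp_norm (P i) (f i))"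
    using f assms by (intro Lp_norm_pseudo_multiplier_le) auto
  also have "\<dots> < \<infinity>"
  proof -
    have "(\<Prod>i\<in>UNIV. Lp_norm (P i) (f i)) \<noteq> \<infinity>"
      using f by (auto simp: ennreal_prod_eq_top Lp_space_def less_top)
    then show ?thesis
      by (simp add: ennreal_mult_less_top less_top)
  qed
  finally show "pseudo_multiplier m f \<in> Lp_space p"
    using borel_measurable_pseudo_multiplier f by (simp add: Lp_space_def)
next
  show "\<exists>C. \<forall>f. (\<forall>i. f i \<in> Lp_space (P i)) \<longrightarrow>
      Lp_norm p (pseudo_multiplier m f) \<le> ennreal C * (\<Prod>i\<in>UNIV. Lp_norm (P i) (f i))"
    using Lp_norm_pseudo_multiplier_le assms by blast
qed (use pseudo_multiplier_linear in auto)

end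

theorem theorem1p2:
  fixes m :: "real ^ 'n \<Rightarrow> nat ^ 'n ^ 'k \<Rightarrow> complex"
    and \<psi> :: "real \<Rightarrow> complex"
    and s :: real
  assumes "CARD('k) \<ge> 2"
    and "test_function \<psi>"
    and "\<And>t. t \<notin> {1 / 2..4} \<Longrightarrow> \<psi> t = 0"
    and "\<And>t. t \<in> {1..2} \<Longrightarrow> \<psi> t = 1"
    and "bounded_measurable_symbol m"
    and "lu_hermite_norm \<psi> s m < \<infinity> \<or>
         (\<exists>M. restricts_to_symbol \<psi> M m \<and> lu_sobolev_norm \<psi> s M < \<infinity>)"
  shows "(let n = real CARD('n); \<kappa> = real CARD('k) in
         (s > max (3 * n * \<kappa> / 2 + (\<kappa> - 1) * gamma_value CARD('n) \<infinity>)
                  (3 * n * \<kappa> / 2 + (\<kappa> - 1) * n / 4) \<longrightarrow>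
          (\<forall>P p. (\<forall>i. 1 \<le> P i) \<and> 1 \<le> p \<and> p \<le> 2 \<and> inverse p = (\<Sum>i\<in>UNIV. inverse (P i)) \<longrightarrow>
             extends_to_bounded_multilinear (pseudo_multiplier m) P p)) \<and>
         (\<forall>P p \<gamma>. (\<forall>i. 1 \<le> P i) \<and> 2 \<le> p \<and> inverse p = (\<Sum>i\<in>UNIV. inverse (P i)) \<and>
             gamma_exponent TYPE('n) p \<gamma> \<and>
             s > max (3 * n * \<kappa> / 2 + (\<kappa> - 1) * n / 4)
                     (3 * n * \<kappa> / 2 + (n - 1) * (\<kappa> - 1) / 2 + \<gamma>) \<longrightarrow>
             extends_to_bounded_multilinear (pseudo_multiplier m) P p))"
proof -
  \<comment> \<open>Both parts are instances of this statement for p \<ge> 1: each assumption on s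
    contains this lower bound.\<close>
  have main: "extends_to_bounded_multilinear (pseudo_multiplier m) P p"
    if s: "s > 3 * real CARD('n) * real CARD('k) / 2 + (real CARD('k) - 1) * real CARD('n) / 4"
      and P: "\<forall>i. 1 \<le> P i" and p: "1 \<le> p" "inverse p = (\<Sum>i\<in>UNIV. inverse (P i))" for P p
  proof -
    define d where "d = real (CARD('n) * CARD('k))"
    have d: "d > 0"
      by (simp add: d_def)
    have "(real CARD('k) - 1) * real CARD('n) / 4 \<ge> 0"
      using assms(1) by simp
    moreover have "3 * d / 2 = 3 * real CARD('n) * real CARD('k) / 2"
      by (simp add: d_def)
    ultimately have sd: "s > 3 * d / 2"
      using s by linarith
    define \<tau> where "\<tau> = (s - d / 2) / d"
    have \<tau>: "\<tau> > 1"
      using sd d by (simp add: \<tau>_def)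
    have "\<exists>C\<ge>0. \<forall>x \<nu>. norm (m x \<nu>) \<le> C * (\<Prod>i\<in>UNIV. index_weight \<tau> (\<nu> $ i))"
    proof (rule symbol_decay[OF assms(3-6)])
      show "s \<ge> real (CARD('n) * CARD('k))"
        using sd d unfolding d_def[symmetric] by linarith
      show "\<tau> * real (CARD('n) * CARD('k)) = s - real (CARD('n) * CARD('k)) / 2"
        using d unfolding d_def[symmetric] by (simp add: \<tau>_def)
    qed
    then obtain C where C: "C \<ge> 0" "\<And>x \<nu>. norm (m x \<nu>) \<le> C * (\<Prod>i\<in>UNIV. index_weight \<tau> (\<nu> $ i))"
      by blast
    show ?thesis
      using assms(5) P C \<tau> p
      by (intro extends_to_bounded_multilinear_pseudo_multiplier[of m C \<tau>]) (auto simp: bounded_measurable_symbol_def)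
  qed
  have "1 \<le> p" if "2 \<le> p" for p :: ennreal
    using that by (rule order_trans[rotated]) simp
  then show ?thesis
    unfolding Let_def max_less_iff_conj by (auto intro!: main)
qed

end
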